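(* There is an algorithm that, given a finitely generated subgroup $H=\langle u_1,\dots,u_k\rangle$ of the free group $F_2$ (by a finite list of generators $u_1,\dots,u_k$), decides whether or not $H$ is the fixed point group of some automorphism of $F_2$.
   Context: $F_2$ is the free group with basis $\{a,b\}$, with elements given as words in $a^{\pm1},b^{\pm1}$. A subgroup $H$ of $F_2$ is the fixed point group of an automorphism $\phi$ of $F_2$ if $H$ is precisely the set of elements of $F_2$ which are fixed by $\phi$. *)

theory Defs
  imports "HOL-Algebra.Generated_Groups" "HOL-Library.Nat_Bijection"
begin

section \<open>Free groups\<close>

text \<open>The pair \<open>(g, True)\<close> stands for the letter \<open>g\<close>, and \<open>(g, False)\<close> for \<open>g\<close> inverse.
  The free group with basis the type \<open>'g\<close> is realised on the freely reduced words.\<close>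

type_synonym 'g letter = "'g \<times> bool"

type_synonym 'g word = "'g letter list"

definition letter_inv :: "'g letter \<Rightarrow> 'g letter" where
  "letter_inv x = (fst x, \<not> snd x)"

fun reduced :: "'g word \<Rightarrow> bool" where
  "reduced [] \<longleftrightarrow> True"
| "reduced [x] \<longleftrightarrow> True"
| "reduced (x # y # w) \<longleftrightarrow> y \<noteq> letter_inv x \<and> reduced (y # w)"

fun red_cons :: "'g letter \<Rightarrow> 'g word \<Rightarrow> 'g word" where
  "red_cons x [] = [x]"
| "red_cons x (y # w) = (if y = letter_inv x then w else x # y # w)"

definition reduce :: "'g word \<Rightarrow> 'g word" where
  "reduce w = foldr red_cons w []"

definition free_group :: "'g word monoid" where
  "free_group = \<lparr>carrier = {w. reduced w}, monoid.mult = (\<lambda>u v. reduce (u @ v)), one = []\<rparr>"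

lemma letter_inv_letter_inv [simp]: "letter_inv (letter_inv x) = x"
  by (simp add: letter_inv_def)

lemma letter_inv_neq [simp]: "letter_inv x \<noteq> x" "x \<noteq> letter_inv x"
  by (auto simp: letter_inv_def prod_eq_iff)

lemma reduced_tl: "reduced (x # w) \<Longrightarrow> reduced w"
  by (cases w) auto

lemma reduced_red_cons: "reduced w \<Longrightarrow> reduced (red_cons x w)"
  by (cases w) (auto dest: reduced_tl)

lemma reduced_foldr: "reduced v \<Longrightarrow> reduced (foldr red_cons u v)"
  by (induction u) (auto intro: reduced_red_cons)

lemma reduced_reduce: "reduced (reduce w)"
  by (simp add: reduce_def reduced_foldr)

lemma red_cons_reduced: "reduced (x # w) \<Longrightarrow> red_cons x w = x # w"
  by (cases w) auto

lemma reduce_reduced: "reduced w \<Longrightarrow> reduce w = w"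
proof (induction w)
  case (Cons x w)
  then show ?case
    using reduced_tl[OF Cons.prems] by (simp add: reduce_def red_cons_reduced)
qed (simp add: reduce_def)

lemma red_cons_inv: "reduced w \<Longrightarrow> red_cons x (red_cons (letter_inv x) w) = w"
  by (cases w rule: reduced.cases) auto

lemma foldr_red_cons:
  assumes "reduced w" "reduced v"
  shows "foldr red_cons (red_cons x w) v = red_cons x (foldr red_cons w v)"
proof (cases w)
  case (Cons y t)
  then show ?thesis
    using red_cons_inv[OF reduced_foldr[OF assms(2), of t], of x] by simp
qed simp

lemma foldr_reduce: "reduced v \<Longrightarrow> foldr red_cons (reduce u) v = foldr red_cons u v"
  by (induction u) (simp_all add: reduce_def foldr_red_cons reduced_foldr)

lemma reduce_append: "reduce (u @ v) = foldr red_cons u (reduce v)"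
  by (simp add: reduce_def)

lemma reduce_append_reduce:
  "reduce (reduce u @ v) = reduce (u @ v)" "reduce (u @ reduce v) = reduce (u @ v)"
  by (simp_all add: reduce_append foldr_reduce reduced_reduce reduce_reduced)

lemma reduce_inv_word: "reduce (rev (map letter_inv w) @ w) = []"
proof (induction w)
  case (Cons x w)
  have "red_cons (letter_inv x) (red_cons x (reduce w)) = reduce w"
    using red_cons_inv[of "reduce w" "letter_inv x"] by (simp add: reduced_reduce)
  then show ?case
    using Cons by (simp add: reduce_def)
qed (simp add: reduce_def)

lemma group_free_group: "group free_group"
proof (rule groupI)
  fix x assume "x \<in> carrier (free_group :: 'g word monoid)"
  have "reduce (reduce (rev (map letter_inv x)) @ x) = []"
    by (simp add: reduce_append_reduce reduce_inv_word)
  then show "\<exists>y\<in>carrier free_group. y \<otimes>\<^bsub>free_group\<^esub> x = \<one>\<^bsub>free_group\<^esub>"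
    by (intro bexI[of _ "reduce (rev (map letter_inv x))"])
      (auto simp: free_group_def reduced_reduce)
qed (auto simp: free_group_def reduced_reduce reduce_reduced reduce_append_reduce)

datatype gen = Gen_a | Gen_b

abbreviation F2 :: "gen word monoid" where
  "F2 \<equiv> free_group"

definition fixed_points :: "('a, 'b) monoid_scheme \<Rightarrow> ('a \<Rightarrow> 'a) \<Rightarrow> 'a set" where
  "fixed_points G \<phi> = {x \<in> carrier G. \<phi> x = x}"

definition is_fixed_point_group :: "('a, 'b) monoid_scheme \<Rightarrow> 'a set \<Rightarrow> bool" where
  "is_fixed_point_group G H \<longleftrightarrow> (\<exists>\<phi> \<in> iso G G. H = fixed_points G \<phi>)"


section \<open>Algorithms\<close>

text \<open>Algorithms are rendered by Kleene's partial recursive functions. Arities are implicit: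
  \<open>rec_computes f xs y\<close> says that \<open>f\<close> halts with value \<open>y\<close> on the argument tuple \<open>xs\<close>.\<close>

datatype recf =
    Zero
  | Succ
  | Proj nat
  | Comp recf "recf list"
  | PrimRec recf recf
  | Mu recf

inductive rec_computes :: "recf \<Rightarrow> nat list \<Rightarrow> nat \<Rightarrow> bool" where
  zero: "rec_computes Zero xs 0"
| succ: "rec_computes Succ [x] (Suc x)"
| proj: "i < length xs \<Longrightarrow> rec_computes (Proj i) xs (xs ! i)"
| comp: "list_all2 (\<lambda>g y. rec_computes g xs y) gs ys \<Longrightarrow> rec_computes f ys z
    \<Longrightarrow> rec_computes (Comp f gs) xs z"
| prim_0: "rec_computes f xs y \<Longrightarrow> rec_computes (PrimRec f g) (0 # xs) y"
| prim_Suc: "rec_computes (PrimRec f g) (n # xs) r \<Longrightarrow> rec_computes g (n # r # xs) y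
    \<Longrightarrow> rec_computes (PrimRec f g) (Suc n # xs) y"
| mu: "rec_computes f (n # xs) 0 \<Longrightarrow> (\<forall>m<n. \<exists>k. rec_computes f (m # xs) (Suc k))
    \<Longrightarrow> rec_computes (Mu f) xs n"

inductive_cases rec_computes_ZeroE: "rec_computes Zero xs y"
inductive_cases rec_computes_SuccE: "rec_computes Succ xs y"
inductive_cases rec_computes_ProjE: "rec_computes (Proj i) xs y"
inductive_cases rec_computes_CompE: "rec_computes (Comp f gs) xs y"
inductive_cases rec_computes_PrimRec_0E: "rec_computes (PrimRec f g) (0 # xs) y"
inductive_cases rec_computes_PrimRec_SucE: "rec_computes (PrimRec f g) (Suc n # xs) y"
inductive_cases rec_computes_MuE: "rec_computes (Mu f) xs y"

lemma rec_computes_deterministic: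
  "rec_computes f xs y \<Longrightarrow> rec_computes f xs z \<Longrightarrow> y = z"
proof (induction arbitrary: z rule: rec_computes.induct)
  case (zero xs)
  then show ?case by (rule rec_computes_ZeroE) simp
next
  case (succ x)
  then show ?case by (rule rec_computes_SuccE) simp
next
  case (proj i xs)
  from proj(2) show ?case by (rule rec_computes_ProjE) simp
next
  case (comp xs gs ys f y)
  from comp.prems obtain zs where
    zs: "list_all2 (\<lambda>g y. rec_computes g xs y) gs zs" "rec_computes f zs z"
    by (rule rec_computes_CompE)
  have "ys = zs"
    using comp.IH(1) zs(1) by (intro nth_equalityI) (simp_all add: list_all2_conv_all_nth)
  then show ?case using comp.IH(2) zs(2) by simp
next
  case (prim_0 f xs y g)
  from prim_0.prems have "rec_computes f xs z" by (rule rec_computes_PrimRec_0E)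
  then show ?case by (rule prim_0.IH)
next
  case (prim_Suc f g n xs r y)
  from prim_Suc.prems obtain r' where
    "rec_computes (PrimRec f g) (n # xs) r'" "rec_computes g (n # r' # xs) z"
    by (rule rec_computes_PrimRec_SucE)
  then show ?case using prim_Suc.IH by blast
next
  case (mu f n xs)
  from mu.prems have z: "rec_computes f (z # xs) 0" "\<forall>m<z. \<exists>k. rec_computes f (m # xs) (Suc k)"
    by (auto elim!: rec_computes_MuE)
  show ?case
  proof (rule linorder_cases[of n z])
    assume "n < z"
    then show ?thesis using z(2) mu.IH(1) by blast
  next
    assume "z < n"
    then obtain k where "\<forall>y. rec_computes f (z # xs) y \<longrightarrow> Suc k = y" using mu.IH(2) by blast
    then show ?thesis using z(1) by blast
  qed
qed

definition decidable :: "('i \<Rightarrow> nat) \<Rightarrow> ('i \<Rightarrow> bool) \<Rightarrow> bool" where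
  "decidable enc P \<longleftrightarrow> (\<exists>f. \<forall>x. rec_computes f [enc x] (if P x then 1 else 0))"

fun letter_code :: "gen letter \<Rightarrow> nat" where
  "letter_code (Gen_a, True) = 0"
| "letter_code (Gen_a, False) = 1"
| "letter_code (Gen_b, True) = 2"
| "letter_code (Gen_b, False) = 3"

definition word_code :: "gen word \<Rightarrow> nat" where
  "word_code w = list_encode (map letter_code w)"

definition words_code :: "gen word list \<Rightarrow> nat" where
  "words_code us = list_encode (map word_code us)"

end

theory Submission
  imports Defs "HOL-Library.Sublist" "HOL-Combinatorics.Permutations"
begin

text \<open>The fixed subgroup of an automorphism \<open>\<phi>\<close> of \<open>F\<^sub>2\<close> is trivial, generated by an element that is not a
  proper power, all of \<open>F\<^sub>2\<close>, or of the form \<open>\<langle>x, y x y\<inverse>\<rangle>\<close> for a basis \<open>x, y\<close>; all these subgroups occur.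
  For the last case one distinguishes the trace and determinant of the matrix of \<open>\<phi>\<close> on the abelianisation:
  elliptic matrices reduce to finite order, where \<open>\<phi>\<close> permutes letters or normalises Sanov's subgroup of
  \<open>SL\<^sub>2(\<int>)\<close>; a hyperbolic matrix moves the free generators of the commutator subgroup to infinity; a
  parabolic one acts on the Bass-Serre tree of \<open>\<langle>a\<rangle> * \<langle>b\<rangle>\<close> viewed as an HNN extension. Membership in each
  of the four families has a finite certificate, and so does non-membership: equality of finitely generated
  subgroups is witnessed by words in the generators, and inequality by a finite permutation representation
  in which one subgroup fixes a point and the other does not. Searching for a certificate decides the
  problem.\<close>


section \<open>Free groups as a type\<close>

text \<open>The case analysis exploits that a non-abelian fixed subgroup survives squaring. A trace
  t becomes t^2 - 2 for determinant 1 and t^2 + 2 for determinant -1, so only the traces 2, -1, -2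
  and the range from 3 upwards need arguments of their own, besides determinant -1 with trace 0,
  where the square is inner. Two facts about rank two carry all of this: an automorphism is
  determined by its matrix up to an inner one, and it sends the commutator of the basis to a
  conjugate of that commutator or of its inverse. So f is always \<open>conj g\<close> composed with
  a model having the same matrix, and the task is to control g. On the computational side no folding
  algorithm is programmed: it suffices that the property and its negation are both enumerable. The
  negation is the obstacle, since not being an image of the model subgroup under any automorphism is
  a statement about infinitely many automorphisms; it has to be reduced to finitely many
  inequalities between finitely generated subgroups.\<close>

abbreviation winv :: "'g word \<Rightarrow> 'g word" where
  "winv w \<equiv> rev (map letter_inv w)"

lemma letter_inv_eq_iff [simp]: "letter_inv x = letter_inv y \<longleftrightarrow> x = y"
  by (metis letter_inv_letter_inv)

lemma letter_inv_comp [simp]: "letter_inv \<circ> letter_inv = id"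
  by (simp add: fun_eq_iff)

lemma fst_letter_inv [simp]: "fst (letter_inv x) = fst x"
  by (simp add: letter_inv_def)

lemma winv_winv [simp]: "winv (winv w) = w"
  by (simp add: rev_map)

lemma reduced_append:
  "reduced (u @ v) \<longleftrightarrow> reduced u \<and> reduced v \<and> (u \<noteq> [] \<longrightarrow> v \<noteq> [] \<longrightarrow> hd v \<noteq> letter_inv (last u))"
  by (induction u rule: reduced.induct) (cases v; auto)+

lemma reduced_winv [simp]: "reduced (winv w) = reduced w"
proof -
  have *: "reduced w \<Longrightarrow> reduced (winv w)" for w :: "'a word"
  proof (induction w rule: reduced.induct)
    case (3 x y w)
    then show ?case
      by (simp add: reduced_append hd_rev last_map) metis
  qed auto
  show ?thesis
    using *[of w] *[of "winv w"] by auto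
qed

text \<open>As a type, the reduced words can be an instance of \<open>group_add\<close>, whose
  addition need not commute, so that group laws are available to the simplifier.\<close>

typedef 'g fg = "{w :: 'g word. reduced w}" morphisms wd Fg
  by (rule exI[of _ "[]"]) simp

lemma reduced_wd [simp]: "reduced (wd x)"
  using wd[of x] by simp

lemma wd_Fg [simp]: "reduced w \<Longrightarrow> wd (Fg w) = w"
  by (simp add: Fg_inverse)

lemma Fg_wd [simp]: "Fg (wd x) = x"
  by (rule wd_inverse)

lemma reduce_wd [simp]: "reduce (wd x) = wd x"
  by (simp add: reduce_reduced)

instantiation fg :: (type) group_add
begin

definition "0 = Fg []"

definition "x + y = Fg (reduce (wd x @ wd y))"

definition "- x = Fg (winv (wd x))"

definition "x - y = x + - (y :: 'a fg)"

instance
proof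
  fix a b c :: "'a fg"
  show "a + b + c = a + (b + c)"
    by (simp add: plus_fg_def reduced_reduce reduce_append_reduce)
  show "0 + a = a" "a + 0 = a"
    by (simp_all add: plus_fg_def zero_fg_def)
  show "- a + a = 0"
    by (simp add: plus_fg_def zero_fg_def uminus_fg_def reduce_inv_word)
  show "a + - b = a - b"
    by (simp add: minus_fg_def)
qed

end

lemma wd_zero [simp]: "wd 0 = []"
  by (simp add: zero_fg_def)

lemma wd_eq_Nil [simp]: "wd x = [] \<longleftrightarrow> x = 0"
  by (metis wd_zero wd_inject)

lemma wd_plus: "wd (x + y) = reduce (wd x @ wd y)"
  by (simp add: plus_fg_def reduced_reduce)

lemma wd_uminus: "wd (- x) = winv (wd x)"
  by (simp add: uminus_fg_def)

definition elt :: "'g word \<Rightarrow> 'g fg" where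
  "elt w = Fg (reduce w)"

lemma wd_elt: "wd (elt w) = reduce w"
  by (simp add: elt_def reduced_reduce)

lemma elt_wd [simp]: "elt (wd x) = x"
  by (simp add: elt_def)

lemma elt_append: "elt (u @ v) = elt u + elt v"
  by (simp add: elt_def plus_fg_def reduced_reduce reduce_append_reduce)

lemma elt_Nil [simp]: "elt [] = 0"
  by (simp add: elt_def zero_fg_def reduce_def)

lemma elt_Cons: "elt (l # w) = elt [l] + elt w"
  using elt_append[of "[l]" w] by simp

lemma elt_winv: "elt (winv w) = - elt w"
proof -
  have "elt (winv w) + elt w = 0"
    by (metis elt_append elt_def reduce_inv_word zero_fg_def)
  then show ?thesis
    by (simp add: eq_neg_iff_add_eq_0)
qed

lemma elt_letter_inv: "elt [letter_inv l] = - elt [l]"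
  using elt_winv[of "[l]"] by simp

definition gen :: "'g \<Rightarrow> 'g fg" where
  "gen i = elt [(i, True)]"

lemma elt_single: "elt [(i, s)] = (if s then gen i else - gen i)"
  using elt_letter_inv[of "(i, True)"] by (auto simp: gen_def letter_inv_def)

lemma wd_gen [simp]: "wd (gen i) = [(i, True)]" "wd (- gen i) = [(i, False)]"
  by (simp_all add: gen_def wd_elt wd_uminus reduce_reduced letter_inv_def)

lemma elt_reduced_wd: "reduced w \<Longrightarrow> wd (elt w) = w"
  by (simp add: wd_elt reduce_reduced)

lemma fg_induct [case_names zero gen neg]:
  assumes "P 0" "\<And>i x. P x \<Longrightarrow> P (gen i + x)" "\<And>i x. P x \<Longrightarrow> P (- gen i + x)"
  shows "P x"
proof -
  have "P (elt w)" for w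
  proof (induction w)
    case (Cons l w)
    then show ?case
      using assms(2,3) elt_Cons[of l w] by (cases l) (auto simp: elt_single)
  qed (simp add: assms(1))
  from this[of "wd x"] show ?thesis by simp
qed

section \<open>Homomorphisms and actions\<close>

lemmas group_simps = diff_conv_add_uminus add.assoc minus_add minus_add_cancel add_minus_cancel

definition ghom :: "('a :: group_add \<Rightarrow> 'b :: group_add) \<Rightarrow> bool" where
  "ghom f \<longleftrightarrow> (\<forall>x y. f (x + y) = f x + f y)"

lemma ghom_plus: "ghom f \<Longrightarrow> f (x + y) = f x + f y"
  by (simp add: ghom_def)

lemma ghom_zero: "ghom f \<Longrightarrow> f 0 = 0"
  by (metis add_0_right add_left_cancel ghom_plus)

lemma ghom_uminus: "ghom f \<Longrightarrow> f (- x) = - f x"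
  using ghom_plus[of f "- x" x] by (simp add: ghom_zero eq_neg_iff_add_eq_0)

lemma ghom_diff: "ghom f \<Longrightarrow> f (x - y) = f x - f y"
  using ghom_plus[of f x "- y"] by (simp add: ghom_uminus)

lemmas ghom_simps = ghom_plus ghom_zero ghom_uminus ghom_diff

lemma ghom_comp: "ghom f \<Longrightarrow> ghom g \<Longrightarrow> ghom (f \<circ> g)"
  by (simp add: ghom_def)

lemma ghom_id: "ghom id" "ghom (\<lambda>x. x)"
  by (simp_all add: ghom_def)

lemma ghom_ext:
  assumes "ghom f" "ghom g" "\<And>i. f (gen i) = g (gen i)"
  shows "f = g"
proof
  fix x show "f x = g x"
    by (induction x rule: fg_induct) (simp_all add: assms ghom_simps)
qed

text \<open>Inverse letters act as inverse maps, so a cancelled pair leaves no trace. Homomorphisms,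
  the matrix representation, the reading of lattice paths and the permutation actions are all
  obtained from this.\<close>

lemma foldr_reduce_action:
  assumes "\<And>l s. f (letter_inv l) (f l s) = s"
  shows "foldr f (reduce w) s = foldr f w s"
proof (induction w)
  case (Cons l w)
  have inv: "f l (f (letter_inv l) s) = s" for s
    using assms[of "letter_inv l"] by simp
  have "foldr f (red_cons l v) s = f l (foldr f v s)" for v
    by (cases v) (auto simp: inv)
  then show ?case
    using Cons by (simp add: reduce_def)
qed (simp add: reduce_def)

lemma foldr_wd_plus:
  assumes "\<And>l s. f (letter_inv l) (f l s) = s"
  shows "foldr f (wd (x + y)) s = foldr f (wd x) (foldr f (wd y) s)"
  by (simp add: wd_plus foldr_reduce_action[of f, OF assms])

definition lift :: "('g \<Rightarrow> 'h :: group_add) \<Rightarrow> 'g fg \<Rightarrow> 'h" where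
  "lift h x = foldr (\<lambda>l s. (if snd l then h (fst l) else - h (fst l)) + s) (wd x) 0"

lemma ghom_lift: "ghom (lift h)"
proof -
  let ?f = "\<lambda>l s. (if snd l then h (fst l) else - h (fst l)) + s"
  have *: "?f (letter_inv l) (?f l s) = s" for l s
    by (simp add: letter_inv_def add.assoc[symmetric])
  have shift: "foldr ?f w s = foldr ?f w 0 + s" for w s
    by (induction w) (simp_all add: add.assoc)
  show ?thesis
    unfolding ghom_def lift_def
    using foldr_wd_plus[of ?f, OF *] shift by metis
qed

lemma lift_gen [simp]: "lift h (gen i) = h i"
  by (simp add: lift_def)

lemmas lift_simps = ghom_plus[OF ghom_lift] ghom_zero[OF ghom_lift] ghom_uminus[OF ghom_lift] ghom_diff[OF ghom_lift]

section \<open>Length functions\<close>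

text \<open>Lengths are counted on the generators satisfying \<open>P\<close>; the same hyperbolicity argument serves
  the word length and the number of letters \<open>b\<close>, i.e. the translation length in the Bass-Serre tree
  of \<open>\<langle>a\<rangle> * \<langle>b\<rangle>\<close> as an HNN extension of \<open>\<langle>a\<rangle>\<close>.\<close>

definition cnt :: "('g \<Rightarrow> bool) \<Rightarrow> 'g word \<Rightarrow> nat" where
  "cnt P w = length (filter (P \<circ> fst) w)"

definition wlen :: "('g \<Rightarrow> bool) \<Rightarrow> 'g fg \<Rightarrow> nat" where
  "wlen P x = cnt P (wd x)"

text \<open>The Gromov product at the base point, in the Cayley tree or, when only the letter b is
  counted, in the Bass-Serre tree.\<close>

definition wgp :: "('g \<Rightarrow> bool) \<Rightarrow> 'g fg \<Rightarrow> 'g fg \<Rightarrow> nat" where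
  "wgp P x y = cnt P (longest_common_prefix (wd x) (wd y))"

abbreviation len :: "'g fg \<Rightarrow> nat" where "len \<equiv> wlen (\<lambda>_. True)"

abbreviation gp :: "'g fg \<Rightarrow> 'g fg \<Rightarrow> nat" where "gp \<equiv> wgp (\<lambda>_. True)"

lemma cnt_simps [simp]:
  "cnt P [] = 0" "cnt P (l # w) = (if P (fst l) then Suc (cnt P w) else cnt P w)"
  "cnt P (u @ v) = cnt P u + cnt P v"
  by (auto simp: cnt_def)

lemma cnt_winv [simp]: "cnt P (winv w) = cnt P w"
  by (induction w) auto

lemma cnt_True [simp]: "cnt (\<lambda>_. True) w = length w"
  by (simp add: cnt_def o_def)

lemma len_def: "len x = length (wd x)"
  by (simp add: wlen_def)

lemma len_eq_0 [simp]: "len x = 0 \<longleftrightarrow> x = 0"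
  by (simp add: len_def)

lemma len_pos: "0 < len x \<longleftrightarrow> x \<noteq> 0"
  by (metis len_eq_0 neq0_conv)

lemma wlen_zero [simp]: "wlen P 0 = 0"
  by (simp add: wlen_def)

lemma wlen_uminus [simp]: "wlen P (- x) = wlen P x"
  by (simp add: wlen_def wd_uminus)

lemma wlen_gen: "wlen P (gen i) = (if P i then 1 else 0)"
  by (simp add: wlen_def)

lemma lcp_commute: "longest_common_prefix u v = longest_common_prefix v u"
  by (induction u v rule: longest_common_prefix.induct) auto

lemma wgp_commute: "wgp P x y = wgp P y x"
  by (simp add: wgp_def lcp_commute)

lemma cnt_prefix_mono: "prefix u v \<Longrightarrow> cnt P u \<le> cnt P v"
  by (auto simp: prefix_def)

lemma wgp_le: "wgp P x y \<le> wlen P x" "wgp P x y \<le> wlen P y"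
  by (simp_all add: wgp_def wlen_def cnt_prefix_mono longest_common_prefix_prefix1
      longest_common_prefix_prefix2)

text \<open>Trees are 0-hyperbolic: both common prefixes are prefixes of y, hence comparable, and
  the shorter one is shared by all three words.\<close>

lemma wgp_ultra: "min (wgp P x y) (wgp P y z) \<le> wgp P x z"
proof -
  let ?u = "longest_common_prefix (wd x) (wd y)" and ?v = "longest_common_prefix (wd y) (wd z)"
  consider "prefix ?u ?v" | "prefix ?v ?u"
    by (metis longest_common_prefix_prefix1 longest_common_prefix_prefix2 prefix_same_cases)
  then show ?thesis
  proof cases
    case 1
    then have "prefix ?u (longest_common_prefix (wd x) (wd z))"
      by (metis longest_common_prefix_max_prefix longest_common_prefix_prefix1
          longest_common_prefix_prefix2 prefix_order.trans)
    then show ?thesis by (auto simp: wgp_def dest: cnt_prefix_mono[of _ _ P])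
  next
    case 2
    then have "prefix ?v (longest_common_prefix (wd x) (wd z))"
      by (metis longest_common_prefix_max_prefix longest_common_prefix_prefix1
          longest_common_prefix_prefix2 prefix_order.trans)
    then show ?thesis by (auto simp: wgp_def dest: cnt_prefix_mono[of _ _ P])
  qed
qed

lemma lcp_split:
  obtains p s t where "u = p @ s" "v = p @ t" "longest_common_prefix u v = p"
    "s \<noteq> [] \<Longrightarrow> t \<noteq> [] \<Longrightarrow> hd s \<noteq> hd t"
proof -
  have "\<exists>s t. u = longest_common_prefix u v @ s \<and> v = longest_common_prefix u v @ t \<and>
    (s \<noteq> [] \<longrightarrow> t \<noteq> [] \<longrightarrow> hd s \<noteq> hd t)"
    by (induction u v rule: longest_common_prefix.induct) auto
  then show ?thesis using that by blast
qed

lemma wd_diff_split: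
  obtains p s t where "wd x = p @ s" "wd y = p @ t" "longest_common_prefix (wd x) (wd y) = p"
    "wd (- x + y) = winv s @ t"
proof -
  obtain p s t where *: "wd x = p @ s" "wd y = p @ t" "longest_common_prefix (wd x) (wd y) = p"
    "s \<noteq> [] \<Longrightarrow> t \<noteq> [] \<Longrightarrow> hd s \<noteq> hd t" using lcp_split[of "wd x" "wd y"] by blast
  have red: "reduced s" "reduced t"
    using reduced_wd[of x] reduced_wd[of y] *(1,2) by (auto simp: reduced_append)
  have "reduced (winv s @ t)"
    using red *(4) by (auto simp: reduced_append last_rev hd_map)
  have "x = elt p + elt s" "y = elt p + elt t"
    using *(1,2) by (metis elt_wd elt_append)+
  then have "- x + y = elt (winv s @ t)"
    by (simp add: elt_append elt_winv minus_add add.assoc del: add_uminus_conv_diff)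
  then have "wd (- x + y) = winv s @ t"
    using \<open>reduced (winv s @ t)\<close> by (simp add: elt_reduced_wd)
  then show ?thesis using that * by blast
qed

text \<open>Exactly the common prefix cancels in \<open>- x + y\<close>. Nearly all length estimates
  below are linear consequences of this identity and \<open>wgp_ultra\<close>.\<close>

lemma wlen_diff: "wlen P (- x + y) + 2 * wgp P x y = wlen P x + wlen P y"
proof -
  obtain p s t where "wd x = p @ s" "wd y = p @ t" "longest_common_prefix (wd x) (wd y) = p"
    "wd (- x + y) = winv s @ t" using wd_diff_split[of x y] by blast
  then show ?thesis by (simp add: wlen_def wgp_def)
qed

lemma wlen_plus: "wlen P (x + y) + 2 * wgp P (- x) y = wlen P x + wlen P y"
  using wlen_diff[of P "- x" y] by simp

lemma wlen_plus_le: "wlen P (x + y) \<le> wlen P x + wlen P y"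
  using wlen_plus[of P x y] by simp

lemma wd_plus_append:
  assumes "len (x + y) = len x + len y"
  shows "wd (x + y) = wd x @ wd y"
proof -
  obtain p s t where *: "wd (- x) = p @ s" "wd y = p @ t" "longest_common_prefix (wd (- x)) (wd y) = p"
    "wd (- (- x) + y) = winv s @ t" using wd_diff_split[of "- x" y] by blast
  have "p = []"
    using wlen_plus[of "\<lambda>_. True" x y] *(3) assms by (simp add: wgp_def)
  then show ?thesis
    using * by (simp add: wd_uminus) (metis winv_winv)
qed

lemma reduced_nth: "reduced w \<Longrightarrow> Suc i < length w \<Longrightarrow> w ! Suc i \<noteq> letter_inv (w ! i)"
proof (induction w arbitrary: i rule: reduced.induct)
  case (3 x y w)
  then show ?case by (cases i) auto
qed auto

text \<open>If half of x cancelled in \<open>x + x\<close>, letters in mirror positions would be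
  inverse to each other up to the middle. For even length the two middle letters would cancel, for
  odd length the middle letter would be its own inverse.\<close>

lemma gp_uminus_self:
  assumes "x \<noteq> 0"
  shows "2 * gp (- x) x < len x"
proof (rule ccontr)
  assume less: "\<not> ?thesis"
  obtain p s t where *: "wd (- x) = p @ s" "wd x = p @ t" "longest_common_prefix (wd (- x)) (wd x) = p"
    using wd_diff_split[of "- x" x] by blast
  define w where "w = wd x"
  have p: "2 * length p \<ge> length w"
    using less *(3) by (simp add: wgp_def len_def w_def)
  have w: "reduced w" "w \<noteq> []" using assms by (auto simp: w_def)
  have inv: "w ! i = letter_inv (w ! (length w - 1 - i))" if "i < length p" for i
  proof -
    have "i < length w" using that *(2) by (simp add: w_def)
    have "w ! i = p ! i" using *(2) that by (simp add: w_def nth_append)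
    have "winv w = p @ s" using *(1) by (simp add: w_def wd_uminus)
    then have "p ! i = winv w ! i" using that by (simp add: nth_append)
    then show ?thesis using \<open>i < length w\<close> \<open>w ! i = p ! i\<close> by (simp add: rev_nth)
  qed
  show False
  proof (cases "even (length w)")
    case True
    then obtain m where m: "length w = 2 * m" by blast
    have "m \<noteq> 0" using w m by (metis length_0_conv mult_0_right)
    then obtain k where k: "m = Suc k" by (cases m) auto
    have "w ! k = letter_inv (w ! Suc k)" using inv[of k] p m k by (simp add: numeral_2_eq_2)
    then have "w ! Suc k = letter_inv (w ! k)" by simp
    then show False using reduced_nth[OF w(1), of k] m k by simp
  next
    case False
    then obtain m where m: "length w = 2 * m + 1" using oddE by blast
    then have "w ! m = letter_inv (w ! m)" using inv[of m] p by simp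
    then show False by simp
  qed
qed

lemma len_double: "x \<noteq> 0 \<Longrightarrow> len x < len (x + x)"
  using gp_uminus_self[of x] wlen_plus[of "\<lambda>_. True" x x] by linarith


section \<open>Subgroups and multiples\<close>

inductive_set sgp :: "'a :: group_add set \<Rightarrow> 'a set" for U where
  zero: "0 \<in> sgp U"
| plus: "u \<in> U \<Longrightarrow> x \<in> sgp U \<Longrightarrow> u + x \<in> sgp U"
| minus: "u \<in> U \<Longrightarrow> x \<in> sgp U \<Longrightarrow> - u + x \<in> sgp U"

lemma sgp_base: "u \<in> U \<Longrightarrow> u \<in> sgp U"
  using sgp.plus[OF _ sgp.zero] by force

lemma sgp_add: "x \<in> sgp U \<Longrightarrow> y \<in> sgp U \<Longrightarrow> x + y \<in> sgp U"
  by (induction rule: sgp.induct) (auto simp: add.assoc intro: sgp.intros)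

lemma sgp_uminus: "x \<in> sgp U \<Longrightarrow> - x \<in> sgp U"
proof (induction rule: sgp.induct)
  case (plus u x)
  then have "- x + (- u + 0) \<in> sgp U" by (intro sgp_add sgp.minus sgp.zero)
  then show ?case by (simp add: minus_add)
next
  case (minus u x)
  then have "- x + (u + 0) \<in> sgp U" by (intro sgp_add sgp.plus sgp.zero)
  then show ?case by (simp add: minus_add)
qed (simp add: sgp.zero)

lemma sgp_diff: "x \<in> sgp U \<Longrightarrow> y \<in> sgp U \<Longrightarrow> x - y \<in> sgp U"
  using sgp_add[of x U "- y"] sgp_uminus[of y U] by simp

lemmas sgp_closed = sgp.zero sgp_base sgp_add sgp_uminus sgp_diff

lemma sgp_subset: "U \<subseteq> sgp V \<Longrightarrow> sgp U \<subseteq> sgp V"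
proof
  fix x assume "U \<subseteq> sgp V" "x \<in> sgp U"
  from this(2,1) show "x \<in> sgp V"
    by (induction rule: sgp.induct) (auto intro: sgp_closed)
qed

lemma sgp_eqI: "U \<subseteq> sgp V \<Longrightarrow> V \<subseteq> sgp U \<Longrightarrow> sgp U = sgp V"
  by (simp add: sgp_subset subset_antisym)

lemma sgp_image:
  assumes "ghom f"
  shows "f ` sgp U = sgp (f ` U)"
proof
  show "f ` sgp U \<subseteq> sgp (f ` U)"
  proof
    fix y assume "y \<in> f ` sgp U"
    then obtain x where x: "x \<in> sgp U" "y = f x" by blast
    from x(1) have "f x \<in> sgp (f ` U)"
      by (induction rule: sgp.induct) (auto simp: ghom_simps[OF assms] intro: sgp.intros)
    then show "y \<in> sgp (f ` U)" using x by simp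
  qed
  show "sgp (f ` U) \<subseteq> f ` sgp U"
  proof
    fix y assume "y \<in> sgp (f ` U)"
    then show "y \<in> f ` sgp U"
    proof (induction rule: sgp.induct)
      case zero
      then show ?case by (metis assms ghom_zero image_eqI sgp.zero)
    next
      case (plus u x)
      then obtain u' x' where "u = f u'" "u' \<in> U" "x = f x'" "x' \<in> sgp U" by blast
      then show ?case using sgp.plus[of u' U x'] ghom_plus[OF assms, of u' x']
        by (metis image_eqI)
    next
      case (minus u x)
      then obtain u' x' where "u = f u'" "u' \<in> U" "x = f x'" "x' \<in> sgp U" by blast
      then show ?case
        using sgp.minus[of u' U x'] ghom_plus[OF assms, of "- u'" x'] ghom_uminus[OF assms, of u']
        by (metis image_eqI)
    qed
  qed
qed

definition zmul :: "int \<Rightarrow> 'a :: group_add \<Rightarrow> 'a" where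
  "zmul k x = (if k \<ge> 0 then ((+) x ^^ nat k) 0 else - ((+) x ^^ nat (- k)) 0)"

lemma zmul_0 [simp]: "zmul 0 x = 0"
  by (simp add: zmul_def)

lemma zmul_succ: "zmul (k + 1) x = x + zmul k x"
proof (cases "k \<ge> 0")
  case True
  then show ?thesis by (simp add: zmul_def nat_add_distrib)
next
  case False
  define n where "n = nat (- k - 1)"
  have comm: "((+) x ^^ m) 0 + x = x + ((+) x ^^ m) 0" for m
    by (induction m) (simp_all add: add.assoc)
  have k: "k = - int n - 1" "nat (- k) = Suc n" "nat (- (k + 1)) = n"
    using False by (simp_all add: n_def)
  have "zmul k x = - (((+) x ^^ n) 0 + x)"
    using False k by (simp add: zmul_def comm)
  moreover have "zmul (k + 1) x = - ((+) x ^^ n) 0"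
    using False k by (cases "k = -1") (simp_all add: zmul_def)
  ultimately show ?thesis by (simp add: minus_add add.assoc[symmetric] del: add_uminus_conv_diff)
qed

lemma zmul_pred: "zmul (k - 1) x = - x + zmul k x"
  using zmul_succ[of "k - 1" x] by (simp add: add.assoc[symmetric])

lemma zmul_1 [simp]: "zmul 1 x = x"
  using zmul_succ[of 0 x] by simp

lemma zmul_add: "zmul (j + k) x = zmul j x + zmul k x"
proof (induction j rule: int_induct[of _ 0])
  case (step1 i)
  then show ?case using zmul_succ[of "i + k" x] zmul_succ[of i x] by (simp add: algebra_simps)
next
  case (step2 i)
  have e: "i - 1 + k = i + k - 1" by simp
  show ?case unfolding e zmul_pred step2 by (simp add: add.assoc)
qed simp

lemma zmul_uminus: "zmul (- k) x = - zmul k x"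
  using zmul_add[of "- k" k x] by (simp add: eq_neg_iff_add_eq_0)

lemma zmul_diff: "zmul (j - k) x = zmul j x - zmul k x"
  using zmul_add[of j "- k" x] by (simp add: zmul_uminus)

lemma zmul_commute: "zmul j x + zmul k x = zmul k x + zmul j x"
  by (metis add.commute zmul_add)

lemma zmul_mult: "zmul (j * k) x = zmul j (zmul k x)"
proof (induction j rule: int_induct[of _ 0])
  case (step1 i)
  have e: "(i + 1) * k = k + i * k" by (simp add: algebra_simps)
  show ?case unfolding zmul_succ unfolding e zmul_add step1 ..
next
  case (step2 i)
  have e: "(i - 1) * k = - k + i * k" by (simp add: algebra_simps)
  show ?case unfolding zmul_pred unfolding e zmul_add step2 by (simp add: zmul_uminus)
qed simp

lemma zmul_zero [simp]: "zmul k 0 = 0"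
  by (metis mult_zero_right zmul_0 zmul_mult)

lemma ghom_zmul: "ghom f \<Longrightarrow> f (zmul k x) = zmul k (f x)"
  by (induction k rule: int_induct[of _ 0]) (simp_all add: zmul_succ zmul_pred ghom_simps)

lemma zmul_in_sgp: "x \<in> sgp U \<Longrightarrow> zmul k x \<in> sgp U"
  by (induction k rule: int_induct[of _ 0]) (simp_all add: zmul_succ zmul_pred sgp_closed del: add_uminus_conv_diff)

lemma sgp_single: "sgp {x} = range (\<lambda>k. zmul k x)"
proof
  show "sgp {x} \<subseteq> range (\<lambda>k. zmul k x)"
  proof
    fix y assume "y \<in> sgp {x}"
    then show "y \<in> range (\<lambda>k. zmul k x)"
    proof (induction rule: sgp.induct)
      case zero
      show ?case by (metis rangeI zmul_0)
    next
      case (plus u y)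
      then show ?case by clarify (metis singletonD rangeI zmul_succ)
    next
      case (minus u y)
      then show ?case by clarify (metis singletonD rangeI zmul_pred)
    qed
  qed
qed (auto intro: zmul_in_sgp sgp_closed)

lemma sum_list_replicate_zmul: "sum_list (replicate n x) = zmul (int n) x"
  by (induction n) (simp_all add: zmul_succ add.commute[of 1])

section \<open>Inner automorphisms\<close>

definition conj :: "'a :: group_add \<Rightarrow> 'a \<Rightarrow> 'a" where
  "conj g x = g + x - g"

lemma ghom_conj: "ghom (conj g)"
  by (simp add: ghom_def conj_def group_simps del: add_uminus_conv_diff)

lemmas conj_simps = ghom_simps[OF ghom_conj]

lemma conj_add: "conj (g + h) x = conj g (conj h x)"
  by (simp add: conj_def group_simps del: add_uminus_conv_diff)

lemma conj_zero [simp]: "conj 0 x = x"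
  by (simp add: conj_def)

lemma conj_inverse [simp]: "conj g (conj (- g) x) = x" "conj (- g) (conj g x) = x"
  by (simp_all add: conj_add[symmetric])

lemma conj_eq_iff: "conj g x = x \<longleftrightarrow> g + x = x + g"
  by (simp add: conj_def diff_eq_eq)

section \<open>Local cancellation\<close>

text \<open>If the cancellation on the two sides of each factor leaves a part of the factor, then
  the cancellations in a product do not interact.\<close>

fun lc :: "'g fg list \<Rightarrow> bool" where
  "lc [] \<longleftrightarrow> True"
| "lc [x] \<longleftrightarrow> x \<noteq> 0"
| "lc (x # y # zs) \<longleftrightarrow> 2 * gp (- x) y \<le> len x \<and> 2 * gp (- x) y \<le> len y \<and> 2 \<le> len (x + y) \<and>
     (zs \<noteq> [] \<longrightarrow> gp (- x) y + gp (- y) (hd zs) < len y) \<and> lc (y # zs)"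

text \<open>In an ultrametric the two smallest of three values agree.\<close>

lemma gp_transfer:
  assumes "wgp P x y < wgp P y z"
  shows "wgp P x z = wgp P x y"
  using wgp_ultra[of P x y z] wgp_ultra[of P x z y] assms
  by (simp add: wgp_commute[of P z y] min_def split: if_splits)

text \<open>By induction the sum of the tail begins with more of y than cancels against x, so
  \<open>gp_transfer\<close> makes x cancel against the whole tail exactly as against y. The lower
  bound 2 for sums of several factors later singles out the letters, which have length one.\<close>

lemma lc_sum:
  assumes "lc xs" "xs \<noteq> []"
  shows "gp (sum_list xs) (hd xs) + (if tl xs = [] then 0 else gp (- hd xs) (hd (tl xs))) = len (hd xs)
    \<and> (tl xs \<noteq> [] \<longrightarrow> gp (- hd xs) (sum_list (tl xs)) = gp (- hd xs) (hd (tl xs)))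
    \<and> (tl xs \<noteq> [] \<longrightarrow> 2 \<le> len (sum_list xs))
    \<and> sum_list xs \<noteq> 0"
  using assms
proof (induction xs rule: lc.induct)
  case (2 x)
  have "gp x x = len x" using wlen_diff[of "\<lambda>_. True" x x] by simp
  then show ?case using 2 by simp
next
  case (3 x y zs)
  define S where "S = sum_list (y # zs)"
  have IH: "gp S y + (if zs = [] then 0 else gp (- y) (hd zs)) = len y" "S \<noteq> 0"
    "zs \<noteq> [] \<Longrightarrow> 2 \<le> len S"
    using 3 by (auto simp: S_def)
  have y: "0 < len y" using 3(2) by (cases zs) (auto simp: len_pos)
  have "gp (- x) y < gp S y"
    using IH(1) 3(2) y by (auto split: if_splits)
  then have g: "gp (- x) S = gp (- x) y"
    using gp_transfer[of "\<lambda>_. True" "- x" y S] by (simp add: wgp_commute)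
  have l: "len (x + S) + 2 * gp (- x) y = len x + len S"
    using wlen_plus[of "\<lambda>_. True" x S] g by simp
  have "len S + 2 * gp (x + S) x = len (x + S) + len x"
    using wlen_diff[of "\<lambda>_. True" "x + S" x] by (simp add: minus_add add.assoc del: add_uminus_conv_diff)
  then have g2: "gp (x + S) x + gp (- x) y = len x" using l by linarith
  have x: "2 * gp (- x) y \<le> len x" using 3(2) by simp
  have l2: "2 \<le> len (x + S)"
  proof (cases "zs = []")
    case True
    then show ?thesis using 3(2) by (simp add: S_def)
  next
    case False
    then show ?thesis using IH(3) l x by linarith
  qed
  then have "x + S \<noteq> 0" by auto
  then show ?case using g g2 l2 by (simp add: S_def)
qed simp

text \<open>Less than half of each factor cancels against its successor, so prepending a factor
  lengthens the sum by at least one letter.\<close>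

lemma lc_sum_length:
  assumes "lc xs" "\<forall>i. Suc i < length xs \<longrightarrow> 2 * gp (- (xs ! i)) (xs ! Suc i) < len (xs ! i)"
  shows "length xs \<le> len (sum_list xs)"
  using assms
proof (induction xs rule: lc.induct)
  case (2 x)
  then have "0 < len x" by (simp add: len_pos)
  then show ?case by simp
next
  case (3 x y zs)
  have "gp (- x) (sum_list (y # zs)) = gp (- x) y"
    using lc_sum[OF 3(2)] by simp
  moreover have "2 * gp (- x) y < len x" using 3(3)[rule_format, of 0] by simp
  moreover have "length (y # zs) \<le> len (sum_list (y # zs))"
    using 3(2,3) by (intro 3(1)) auto
  ultimately show ?case
    using wlen_plus[of "\<lambda>_. True" x "sum_list (y # zs)"] by simp
qed simp

lemma lc_replicate:
  assumes "x \<noteq> 0"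
  shows "lc (replicate n x)"
proof (induction n)
  case (Suc n)
  have pos: "0 < len x" using assms by (simp add: len_pos)
  have "2 * gp (- x) x < len x" "len x < len (x + x)"
    using assms by (simp_all add: gp_uminus_self len_double)
  moreover obtain m where "n = 0 \<or> n = Suc m" by (cases n) auto
  ultimately show ?case
    using Suc assms pos by (cases m) auto
qed simp

lemma len_zmul:
  assumes "x \<noteq> 0"
  shows "n \<le> len (zmul (int n) x)"
  using lc_sum_length[OF lc_replicate[OF assms, of n]] gp_uminus_self[OF assms]
  by (simp add: sum_list_replicate_zmul)

lemma zmul_eq_0: "zmul k (x :: 'g fg) = 0 \<longleftrightarrow> k = 0 \<or> x = 0"
proof -
  have "zmul k x \<noteq> 0" if "k \<noteq> 0" "x \<noteq> 0"
  proof -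
    have "zmul (int (nat \<bar>k\<bar>)) x \<noteq> 0"
      using len_zmul[OF that(2), of "nat \<bar>k\<bar>"] that(1) by auto
    then show ?thesis by (cases "k \<ge> 0") (auto simp: zmul_uminus)
  qed
  then show ?thesis by auto
qed

section \<open>Commuting elements\<close>

text \<open>The shortest prefix containing k counted letters. It stops right after the k-th one,
  which picks a definite group element over the vertex at distance k, although uncounted letters do
  not change the distance.\<close>

fun bpre :: "('g \<Rightarrow> bool) \<Rightarrow> nat \<Rightarrow> 'g word \<Rightarrow> 'g word" where
  "bpre P k [] = []"
| "bpre P 0 w = []"
| "bpre P (Suc k) (l # w) = l # bpre P (if P (fst l) then k else Suc k) w"

lemma bpre_0 [simp]: "bpre P 0 w = []"
  by (cases w) auto

lemma bpre_append1: "k \<le> cnt P p \<Longrightarrow> bpre P k (p @ s) = bpre P k p"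
proof (induction P k p rule: bpre.induct)
  case (3 P k l w)
  then show ?case by (auto split: if_splits)
qed auto

lemma bpre_append2: "0 < k \<Longrightarrow> bpre P (cnt P p + k) (p @ q) = p @ bpre P k q"
proof (induction p)
  case (Cons l p)
  then obtain j where j: "cnt P p + k = Suc j" by (cases "cnt P p + k") auto
  then show ?case using Cons by (cases "P (fst l)") auto
qed simp

lemma bpre_agree:
  assumes "k \<le> wgp P x y"
  shows "bpre P k (wd x) = bpre P k (wd y)"
proof -
  obtain p s t where "wd x = p @ s" "wd y = p @ t" "longest_common_prefix (wd x) (wd y) = p"
    using wd_diff_split[of x y] by blast
  then show ?thesis using assms by (simp add: wgp_def bpre_append1)
qed

text \<open>The cancellation in \<open>u + x\<close> removes a prefix of x with at most
  \<open>wlen P u\<close> counted letters. It lies inside the prefix of weight k, so left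
  translation carries prefix to prefix and changes the weight by the change in length.\<close>

lemma bpre_shift:
  assumes "wlen P u < k"
  shows "u + elt (bpre P k (wd x)) = elt (bpre P (k + wlen P (u + x) - wlen P x) (wd (u + x)))"
proof -
  obtain t s q where *: "wd (- u) = t @ s" "wd x = t @ q" "wd (- (- u) + x) = winv s @ q"
    using wd_diff_split[of "- u" x] by blast
  have "wd u = winv s @ winv t" using *(1) by (metis wd_uminus winv_winv rev_append map_append)
  then have u: "u = elt (winv s) - elt t" "wlen P u = cnt P s + cnt P t"
    by (metis elt_wd elt_append elt_winv add_uminus_conv_diff, simp add: wlen_def)
  obtain j where j: "k = cnt P t + j" "0 < j"
    using assms u(2) by (metis add_lessD1 less_imp_add_positive add.commute)
  have "u + elt (bpre P k (wd x)) = elt (winv s @ bpre P j q)"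
    using j *(2) u(1) by (simp add: bpre_append2 elt_append add.assoc[symmetric])
  also have "winv s @ bpre P j q = bpre P (cnt P (winv s) + j) (winv s @ q)"
    using j(2) by (simp only: bpre_append2)
  finally show ?thesis
    using *(2,3) j(1) by (simp add: wlen_def add.commute)
qed

text \<open>Left multiplication by \<open>u\<close> and \<open>v\<close> shifts the prefixes of the long word \<open>G\<close>, so \<open>u + v\<close> and
  \<open>v + u\<close> agree on such a prefix.\<close>

lemma stabilisers_commute:
  assumes u: "u + G = G + u'" "wlen P u \<le> C" "wlen P u' \<le> C"
    and v: "v + G = G + v'" "wlen P v \<le> C" "wlen P v' \<le> C"
    and G: "6 * C < wlen P G"
  shows "u + v = v + u"
proof -
  define \<pi> where "\<pi> k = elt (bpre P k (wd G))" for k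
  have *: "x + \<pi> k = \<pi> (k + wlen P (x + G) - wlen P G)"
    if x: "x + G = G + x'" "wlen P x \<le> C" "wlen P x' \<le> C" and k: "C < k" "k \<le> 4 * C + 1" for x x' k
  proof -
    \<comment> \<open>Since x' is short, \<open>x + G\<close> and G differ only near their ends and
      share a long prefix.\<close>
    have "- G + (x + G) = x'" using x(1) by (simp add: add.assoc[symmetric])
    then have g: "wlen P x' + 2 * wgp P G (x + G) = wlen P G + wlen P (x + G)"
      using wlen_diff[of P G "x + G"] by simp
    have b: "wlen P (x + G) \<le> wlen P G + C" "wlen P G \<le> wlen P (x + G) + C"
      using wlen_plus_le[of P x G] wlen_plus_le[of P "- x" "x + G"] x(2)
      by (simp_all add: add.assoc[symmetric])
    have "k + wlen P (x + G) - wlen P G \<le> wgp P G (x + G)"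
      using g b x(3) k G by linarith
    then show ?thesis
      using bpre_shift[of P x k G] k x(2) bpre_agree[of _ P G "x + G"] by (simp add: \<pi>_def)
  qed
  have b: "wlen P (x + G) \<le> wlen P G + C" "wlen P G \<le> wlen P (x + G) + C" if "wlen P x \<le> C" for x
    using wlen_plus_le[of P x G] wlen_plus_le[of P "- x" "x + G"] that
    by (simp_all add: add.assoc[symmetric])
  define du where "du = wlen P (u + G)" define dv where "dv = wlen P (v + G)"
  note bu = b[OF u(2), folded du_def] and bv = b[OF v(2), folded dv_def]
  \<comment> \<open>A shift changes the weight by at most C. The first one lands between 2C + 1 and
    4C + 1, where the shift rule applies again; the second one reaches at most 5C + 1, which the
    bound 6C on the length of G keeps inside the prefix shared by G and its translate.\<close>
  define k where "k = 3 * C + 1"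
  have "u + v + \<pi> k = u + \<pi> (k + dv - wlen P G)"
    using *[OF v, of k] by (simp add: add.assoc k_def dv_def)
  also have "\<dots> = \<pi> (k + dv - wlen P G + du - wlen P G)"
    using *[OF u, of "k + dv - wlen P G"] bv by (simp add: k_def du_def)
  also have "k + dv - wlen P G + du - wlen P G = k + du - wlen P G + dv - wlen P G"
    using bu bv by (simp add: k_def)
  also have "\<pi> \<dots> = v + \<pi> (k + du - wlen P G)"
    using *[OF v, of "k + du - wlen P G"] bu by (simp add: k_def dv_def)
  also have "\<dots> = v + u + \<pi> k"
    using *[OF u, of k] by (simp add: add.assoc k_def du_def)
  finally show ?thesis by simp
qed

text \<open>Centralisers are abelian: y and z commute with all powers of x, and a power that is long
  compared with both serves as G in \<open>stabilisers_commute\<close>.\<close>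

lemma commute_trans:
  fixes x :: "'g fg"
  assumes "x \<noteq> 0" "x + y = y + x" "x + z = z + x"
  shows "y + z = z + y"
proof -
  define C where "C = max (len y) (len z)"
  define G where "G = zmul (int (6 * C + 1)) x"
  have *: "t + G = G + t" if "x + t = t + x" for t
  proof -
    have "conj t x = x" using that by (simp add: conj_eq_iff)
    then have "conj t (zmul k x) = zmul k x" for k by (metis ghom_zmul[OF ghom_conj])
    then show ?thesis by (simp add: G_def conj_eq_iff)
  qed
  have "6 * C < len G" using len_zmul[OF assms(1), of "6 * C + 1"] by (simp add: G_def)
  then show ?thesis
    by (intro stabilisers_commute[of y G y "\<lambda>_. True" C z z] *[OF assms(2)] *[OF assms(3)])
      (simp_all add: C_def)
qed

section \<open>Common roots of commuting elements\<close>

lemma prefix_exists: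
  assumes "h \<le> len x"
  obtains p where "len p = h" "gp p x = h"
proof
  have "reduced (take h (wd x))"
    by (metis append_take_drop_id reduced_append reduced_wd)
  then have p: "wd (elt (take h (wd x))) = take h (wd x)" by (rule elt_reduced_wd)
  then show "len (elt (take h (wd x))) = h" using assms by (simp add: len_def)
  have "longest_common_prefix (take h w) w = take h w" for w :: "'a word"
    by (induction w arbitrary: h) (auto simp: take_Cons split: nat.splits)
  then show "gp (elt (take h (wd x))) x = h" using p assms by (simp add: wgp_def len_def)
qed

text \<open>The hypotheses say that x begins with h and ends with the inverse of h, so conjugation
  cancels at both ends.\<close>

lemma conj_shorter:
  assumes "len h = 1" "gp h x > 0" "gp x (- x) > 0"
  shows "len (- h + x + h) < len x"
proof -
  have x0: "x \<noteq> 0" using assms(2) wgp_le(2)[of "\<lambda>_. True" h x] by auto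
  have lx: "3 \<le> len x" using gp_uminus_self[OF x0] assms(3) by (simp add: wgp_commute)
  have g1: "gp h x = 1" using assms(1,2) wgp_le(1)[of "\<lambda>_. True" h x] by simp
  have l1: "len (- h + x) + 1 = len x" using wlen_diff[of "\<lambda>_. True" h x] g1 assms(1) by simp
  have g2: "gp (- x) h > 0"
    using wgp_ultra[of "\<lambda>_. True" "- x" x h] assms(2,3) by (simp add: wgp_commute)
  have "gp (- (- h + x)) (- x) > 0"
    using wlen_diff[of "\<lambda>_. True" "- (- h + x)" "- x"] l1 lx assms(1)
    by (simp add: add.assoc minus_add del: add_uminus_conv_diff)
  then have "gp (- (- h + x)) h > 0"
    using wgp_ultra[of "\<lambda>_. True" "- (- h + x)" "- x" h] g2 by simp
  then show ?thesis
    using wlen_plus[of "\<lambda>_. True" "- h + x" h] l1 assms(1) by simp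
qed

lemma elt_concat_replicate: "elt (concat (replicate n w)) = zmul (int n) (elt w)"
  by (induction n) (simp_all add: elt_append zmul_succ add.commute[of 1])

text \<open>Induction on the total length. If \<open>x + y\<close> is shorter than y, it replaces y.
  If nothing cancels, the words commute in the free monoid and are powers of one word. Otherwise x
  and y share their first letter and both end with its inverse, so conjugating by it shortens
  both.\<close>

lemma commute_root:
  fixes x y :: "'g fg"
  assumes "x + y = y + x"
  shows "\<exists>z i j. x = zmul i z \<and> y = zmul j z"
  using assms
proof (induction "len x + len y" arbitrary: x y rule: less_induct)
  case less
  have wlog: "\<exists>z i j. x = zmul i z \<and> y = zmul j z"
    if xy: "x + y = y + x" "len x \<le> len y" and
      IH: "\<And>x' y' :: 'g fg. len x' + len y' < len x + len y \<Longrightarrow> x' + y' = y' + x' \<Longrightarrow>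
        \<exists>z i j. x' = zmul i z \<and> y' = zmul j z" for x y :: "'g fg"
  proof -
    have gxy: "gp (- x) y = gp (- y) x"
      using wlen_plus[of "\<lambda>_. True" x y] wlen_plus[of "\<lambda>_. True" y x] xy(1) by simp
    consider "x = 0" | "len (x + y) < len y" | "gp (- x) y = 0" |
      "x \<noteq> 0" "gp (- x) y > 0" "len y \<le> len (x + y)" by fastforce
    then show ?thesis
    proof cases
      case 1
      then show ?thesis by (metis zmul_0 zmul_1)
    next
      case 2
      have "x + (x + y) = x + y + x" by (simp only: add.assoc xy(1)[symmetric])
      with 2 obtain z i j where z: "x = zmul i z" "x + y = zmul j z"
        using IH[of x "x + y"] by auto
      then have "y = zmul (- i + j) z"
        by (metis add.assoc add.left_neutral left_minus zmul_add zmul_uminus)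
      then show ?thesis using z by blast
    next
      case 3
      then have "wd x @ wd y = wd y @ wd x"
        using wd_plus_append[of x y] wd_plus_append[of y x] wlen_plus[of "\<lambda>_. True" x y] xy(1) gxy
          wlen_plus[of "\<lambda>_. True" y x] by simp
      then obtain m n w where "concat (replicate m w) = wd x" "concat (replicate n w) = wd y"
        using comm_append_are_replicate by blast
      then show ?thesis by (metis elt_wd elt_concat_replicate)
    next
      case 4
      have c: "2 * gp (- x) y \<le> len x" using wlen_plus[of "\<lambda>_. True" x y] 4(3) by linarith
      have x0: "0 < len x" using 4 by (simp add: len_pos)
      have "gp x (x + y) > 0"
        using wlen_diff[of "\<lambda>_. True" x "x + y"] wlen_plus[of "\<lambda>_. True" x y] c x0
        by (simp add: add.assoc[symmetric])
      moreover have "gp y (y + x) > 0"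
        using wlen_diff[of "\<lambda>_. True" y "y + x"] wlen_plus[of "\<lambda>_. True" y x] c x0 xy(2) gxy
        by (simp add: add.assoc[symmetric])
      ultimately have g: "gp x y > 0"
        using wgp_ultra[of "\<lambda>_. True" x "x + y" y] xy(1) by (simp add: wgp_commute)
      have gx: "gp x (- x) > 0"
        using wgp_ultra[of "\<lambda>_. True" x y "- x"] g 4(2) by (simp add: wgp_commute)
      have gy: "gp y (- y) > 0"
        using wgp_ultra[of "\<lambda>_. True" y x "- y"] g 4(2) gxy by (simp add: wgp_commute)
      obtain h where h: "len h = 1" "gp h x = 1"
        using prefix_exists[of 1 x] x0 by (metis less_eq_Suc_le One_nat_def)
      have "gp h y > 0" using wgp_ultra[of "\<lambda>_. True" h x y] g h by simp
      then have "len (conj (- h) x) < len x" "len (conj (- h) y) < len y"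
        using conj_shorter[OF h(1)] gx gy h(2) by (simp_all add: conj_def)
      moreover have "conj (- h) x + conj (- h) y = conj (- h) y + conj (- h) x"
        by (simp add: conj_simps[symmetric] xy(1))
      ultimately obtain z i j where "conj (- h) x = zmul i z" "conj (- h) y = zmul j z"
        using IH[of "conj (- h) x" "conj (- h) y"] by auto
      then have "x = zmul i (conj h z)" "y = zmul j (conj h z)"
        by (metis conj_inverse(1) ghom_zmul[OF ghom_conj])+
      then show ?thesis by blast
    qed
  qed
  show ?case
  proof (cases "len x \<le> len y")
    case True
    show ?thesis by (rule wlog[OF less.prems True]) (use less.hyps in blast)
  next
    case False
    have "\<exists>z i j. y = zmul i z \<and> x = zmul j z"
      by (rule wlog) (use False less.prems less.hyps in \<open>auto simp: add.commute\<close>)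
    then show ?thesis by blast
  qed
qed

text \<open>Roots are unique: x and y both commute with the common multiple, hence are multiples of
  one element, and there is no torsion.\<close>

lemma zmul_inject:
  fixes x y :: "'g fg"
  assumes "zmul k x = zmul k y" "k \<noteq> 0"
  shows "x = y"
proof (cases "zmul k x = 0")
  case True
  then show ?thesis using assms by (metis zmul_eq_0)
next
  case False
  have "zmul k t + t = t + zmul k t" for t :: "'g fg" using zmul_commute[of k t 1] by simp
  then have "x + y = y + x" using commute_trans[OF False] assms(1) by metis
  then obtain z i j where z: "x = zmul i z" "y = zmul j z" using commute_root by blast
  then have "zmul (k * i - k * j) z = 0" using assms(1) by (simp add: zmul_diff zmul_mult)
  then have "i = j \<or> z = 0" using assms(2) by (auto simp: zmul_eq_0)
  then show ?thesis using z by auto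
qed


section \<open>Nielsen's theory of bases of the free group of rank two\<close>

abbreviation ga :: "gen fg" where "ga \<equiv> gen Gen_a"
abbreviation gb :: "gen fg" where "gb \<equiv> gen Gen_b"

definition sub :: "'h :: group_add \<Rightarrow> 'h \<Rightarrow> gen fg \<Rightarrow> 'h" where
  "sub x y = lift (case_gen x y)"

text \<open>The exponent sums \<open>ea\<close> and \<open>eb\<close> are the coordinates of the
  abelianisation.\<close>

definition ea :: "gen fg \<Rightarrow> int" where "ea = sub 1 0"
definition eb :: "gen fg \<Rightarrow> int" where "eb = sub 0 1"

lemma ghom_sub: "ghom (sub x y)"
  by (simp add: sub_def ghom_lift)

lemma ghom_ea: "ghom ea" and ghom_eb: "ghom eb"
  by (simp_all add: ea_def eb_def ghom_sub)

lemmas sub_simps = ghom_simps[OF ghom_sub]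
lemmas ea_simps [simp] = ghom_simps[OF ghom_ea]
lemmas eb_simps [simp] = ghom_simps[OF ghom_eb]

lemma sub_gen [simp]: "sub x y ga = x" "sub x y gb = y"
  by (simp_all add: sub_def)

lemma exponent_gen [simp]: "ea ga = 1" "ea gb = 0" "eb ga = 0" "eb gb = 1"
  by (simp_all add: ea_def eb_def)

lemma ea_conj [simp]: "ea (conj g x) = ea x" "eb (conj g x) = eb x"
  by (simp_all add: conj_def)

lemma ea_zmul [simp]: "ea (zmul k x) = k * ea x" "eb (zmul k x) = k * eb x"
proof -
  have *: "zmul k n = k * n" for n :: int
    by (induction k rule: int_induct[of _ 0]) (simp_all add: zmul_succ zmul_pred algebra_simps)
  show "ea (zmul k x) = k * ea x" "eb (zmul k x) = k * eb x"
    by (simp_all add: ghom_zmul ghom_ea ghom_eb *)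
qed

lemma ghom_ext2: "ghom f \<Longrightarrow> ghom g \<Longrightarrow> f ga = g ga \<Longrightarrow> f gb = g gb \<Longrightarrow> f = g"
  by (rule ghom_ext, assumption, assumption) (metis gen.exhaust)

lemma ghom_sub_eq: "ghom f \<Longrightarrow> f = sub (f ga) (f gb)"
  by (rule ghom_ext2) (simp_all add: ghom_sub)

lemma sgp_gens: "sgp {ga, gb} = UNIV"
proof -
  have "gen i \<in> {ga, gb}" for i by (cases i) auto
  then have "x \<in> sgp {ga, gb}" for x
    by (induction x rule: fg_induct) (auto intro: sgp.intros)
  then show ?thesis by auto
qed

definition aut :: "('a :: group_add \<Rightarrow> 'a) \<Rightarrow> bool" where
  "aut f \<longleftrightarrow> ghom f \<and> bij f"

lemma autI: "ghom f \<Longrightarrow> (\<And>x. f (g x) = x) \<Longrightarrow> (\<And>x. g (f x) = x) \<Longrightarrow> aut f"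
  by (metis aut_def bijI')

lemma aut_comp: "aut f \<Longrightarrow> aut g \<Longrightarrow> aut (f \<circ> g)"
  by (simp add: aut_def ghom_comp bij_comp)

abbreviation finv :: "('a \<Rightarrow> 'b) \<Rightarrow> 'b \<Rightarrow> 'a" where
  "finv \<equiv> inv_into UNIV"

lemma aut_inv:
  assumes "aut f"
  shows "aut (finv f)"
proof -
  have f: "ghom f" "bij f" "surj f" "inj f" using assms by (auto simp: aut_def bij_def)
  have "finv f (x + y) = finv f x + finv f y" for x y
    by (rule injD[OF f(4)]) (simp add: ghom_plus[OF f(1)] surj_f_inv_f[OF f(3)])
  then show ?thesis using f by (simp add: aut_def ghom_def bij_imp_bij_inv)
qed

lemma aut_conj: "aut (conj g)"
  by (rule autI[of _ "conj (- g)"]) (simp_all add: ghom_conj)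

lemma aut_sub_inverse:
  assumes "sub x y u = ga" "sub x y v = gb" "sub u v x = ga" "sub u v y = gb"
  shows "aut (sub x y)"
proof (rule autI[of _ "sub u v"])
  have "sub x y \<circ> sub u v = id" "sub u v \<circ> sub x y = id"
    by (rule ghom_ext2; simp add: assms ghom_comp ghom_sub ghom_id)+
  then show "sub x y (sub u v z) = z" "sub u v (sub x y z) = z" for z
    by (metis comp_apply id_apply)+
qed (rule ghom_sub)

lemma aut_elementary:
  "aut (sub ga (ga + gb))" "aut (sub (ga + gb) gb)" "aut (sub (- ga) gb)" "aut (sub ga (- gb))"
  "aut (sub gb ga)" "aut (sub ga (zmul k ga + gb))" "aut (sub ga (gb + zmul k ga))"
  by (rule aut_sub_inverse[of _ _ ga "- ga + gb"] aut_sub_inverse[of _ _ "ga - gb" gb]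
      aut_sub_inverse[of _ _ "- ga" gb] aut_sub_inverse[of _ _ ga "- gb"] aut_sub_inverse[of _ _ gb ga]
      aut_sub_inverse[of _ _ ga "zmul (- k) ga + gb"] aut_sub_inverse[of _ _ ga "gb + zmul (- k) ga"];
      simp add: sub_simps ghom_zmul[OF ghom_sub] add.assoc[symmetric] zmul_uminus; fail)+

definition letters :: "gen fg \<Rightarrow> gen fg \<Rightarrow> bool" where
  "letters p q \<longleftrightarrow> p \<in> {ga, - ga} \<and> q \<in> {gb, - gb} \<or> p \<in> {gb, - gb} \<and> q \<in> {ga, - ga}"

inductive pos :: "gen fg \<Rightarrow> gen fg \<Rightarrow> gen fg \<Rightarrow> gen fg \<Rightarrow> bool" for p q where
  base: "pos p q p q"
| addr: "pos p q x y \<Longrightarrow> pos p q x (x + y)"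
| addl: "pos p q x y \<Longrightarrow> pos p q (x + y) y"
| conj: "pos p q x y \<Longrightarrow> pos p q (conj g x) (conj g y)"

text \<open>Up to signs, conjugation and the choice of the letters, every basis is obtained by
  positive moves. Hence it is determined up to conjugation by its abelianisation.\<close>

definition good :: "gen fg \<Rightarrow> gen fg \<Rightarrow> bool" where
  "good x y \<longleftrightarrow> (\<exists>p q. letters p q \<and> (\<exists>X\<in>{x, - x}. \<exists>Y\<in>{y, - y}. pos p q X Y))"

text \<open>Exchanging the roles turns \<open>x + y\<close> into \<open>y + x\<close>, which a
  conjugation by x or by \<open>- y\<close> repairs; for this the moves include simultaneous
  conjugation.\<close>

lemma pos_swap: "pos p q x y \<Longrightarrow> pos q p y x"
proof (induction rule: pos.induct)
  case (addr x y)
  have "pos q p (conj x (y + x)) (conj x x)" by (intro pos.conj pos.addl addr)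
  then show ?case by (simp add: conj_def add.assoc[symmetric])
next
  case (addl x y)
  have "pos q p (conj (- y) y) (conj (- y) (y + x))" by (intro pos.conj pos.addr addl)
  then show ?case by (simp add: conj_def add.assoc[symmetric])
qed (auto intro: pos.intros)

lemma good_swap: "good x y \<Longrightarrow> good y x"
  unfolding good_def using pos_swap letters_def by metis

lemma good_neg: "good x y \<Longrightarrow> good (- x) y" "good x y \<Longrightarrow> good x (- y)"
  unfolding good_def by auto

lemma good_neg_iff: "good (- x) y = good x y" "good x (- y) = good x y"
  using good_neg by (metis minus_minus)+

lemma good_conj: "good x y \<Longrightarrow> good (conj g x) (conj g y)"
  unfolding good_def by (auto simp: conj_simps[symmetric] dest: pos.conj[where g = g])

lemma good_conj_iff: "good (conj g x) (conj g y) = good x y"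
  using good_conj[of x y g] good_conj[of "conj g x" "conj g y" "- g"] by auto

lemma good_pos: "letters p q \<Longrightarrow> pos p q x y \<Longrightarrow> good x y"
  unfolding good_def by blast

lemma letters_neg: "letters p q \<Longrightarrow> letters p (- q)"
  by (auto simp: letters_def)

lemma letters_swap: "letters p q \<Longrightarrow> letters q p"
  by (auto simp: letters_def)

text \<open>A subtraction undoes the last addition up to sign and conjugation, or, at the letters
  themselves, is an addition for the letters p and \<open>- q\<close>.\<close>

lemma pos_diff:
  assumes "pos p q x y" "letters p q"
  shows "good x (x - y)"
  using assms
proof (induction rule: pos.induct)
  case base
  have "pos p (- q) p (p + - q)" by (intro pos.addr pos.base)
  then show ?case using base by (auto intro: good_pos letters_neg)
next
  case (addr x y)
  have "good (conj x x) (conj x (- y))"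
    using addr by (simp add: good_conj_iff good_neg_iff good_pos)
  then show ?case by (simp add: conj_def group_simps del: add_uminus_conv_diff)
next
  case (addl x y)
  have "pos q p (conj x (y + x)) (conj x x)"
    using addl(1) by (intro pos.conj pos.addl) (rule pos_swap)
  then have "pos q p (x + y) x" by (simp add: conj_def add.assoc[symmetric])
  then show ?case using addl(3) good_pos[of q p "x + y" x] letters_swap[of p q] by simp
next
  case (conj x y g)
  then show ?case by (metis good_conj_iff conj_simps(4))
qed

lemma good_add:
  assumes "good x y"
  shows "good x (x + y)"
proof -
  obtain p q X Y where *: "letters p q" "X \<in> {x, - x}" "Y \<in> {y, - y}" "pos p q X Y"
    using assms unfolding good_def by blast
  have same: "good X (X + Y)" using *(1,4) by (intro good_pos pos.addr)
  have diff: "good X (X - Y)" using *(1,4) by (rule pos_diff[rotated])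
  consider "X = x" "Y = y" | "X = - x" "Y = - y" | "X = x" "Y = - y" | "X = - x" "Y = y"
    using * by auto
  then show ?thesis
  proof cases
    case 2
    have "good (- x) (- x - y)" using same 2 by simp
    then have "good (conj x (- x)) (conj x (- x - y))" by (simp only: good_conj_iff)
    then have "good (- x) (- (x + y))"
      by (simp add: conj_def minus_add group_simps del: add_uminus_conv_diff)
    then show ?thesis by (simp only: good_neg_iff)
  next
    case 4
    have "good (- x) (- (- x - y))" using diff 4 by (simp only: good_neg_iff)
    then have "good (conj x (- x)) (conj x (- (- x - y)))" by (simp only: good_conj_iff)
    then have "good (- x) (x + y)"
      by (simp add: conj_def minus_add group_simps del: add_uminus_conv_diff)
    then show ?thesis by (simp only: good_neg_iff)
  qed (use same diff in auto)
qed

lemma good_add_iff: "good x (x + y) = good x y"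
proof
  assume "good x (x + y)"
  then have "good (- x) (- x + (x + y))" by (intro good_add) (simp add: good_neg_iff)
  then show "good x y" by (simp only: good_neg_iff minus_add_cancel)
qed (rule good_add)

lemma good_add_iff2: "good (x + y) y = good x y"
proof -
  have "good (x + y) y \<longleftrightarrow> good y (- y + - x)"
    by (metis good_neg_iff(2) good_swap minus_add)
  also have "\<dots> \<longleftrightarrow> good x y"
    by (metis good_add_iff good_neg_iff good_swap)
  finally show ?thesis .
qed

section \<open>Nielsen reduction of generating pairs\<close>

lemma ea_gens_not_commute: "ga + gb \<noteq> gb + ga"
proof -
  have "wd (ga + gb) = [(Gen_a, True), (Gen_b, True)]" "wd (gb + ga) = [(Gen_b, True), (Gen_a, True)]"
    by (simp_all add: wd_plus reduce_reduced letter_inv_def)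
  then show ?thesis by auto
qed

lemma generators_not_commute:
  assumes "sgp {x, y} = (UNIV :: gen fg set)"
  shows "x + y \<noteq> y + x"
proof
  assume "x + y = y + x"
  then obtain z i j where "x = zmul i z" "y = zmul j z" using commute_root by blast
  then have "{x, y} \<subseteq> sgp {z}" by (auto simp: sgp_single)
  then have "sgp {z} = UNIV" using assms sgp_subset[of "{x, y}" "{z}"] by auto
  then obtain i j where "ga = zmul i z" "gb = zmul j z" unfolding sgp_single by (metis UNIV_I imageE)
  then show False using ea_gens_not_commute zmul_commute by metis
qed

lemma len_1_letter:
  assumes "len x \<le> 1" "x \<noteq> (0 :: gen fg)"
  shows "x \<in> {ga, - ga, gb, - gb}"
proof -
  have "length (wd x) = 1" using assms by (simp add: len_def le_Suc_eq)
  then obtain l where "wd x = [l]" by (metis One_nat_def length_0_conv length_Suc_conv)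
  then have "x = elt [l]" by (metis elt_wd)
  then show ?thesis
    by (cases l; cases "fst l") (auto simp: elt_single)
qed

text \<open>Write x = p + q with halves of length h. The hypotheses make y begin with
  \<open>- q\<close> and end with \<open>- p\<close>, so
  \<open>conj (- p) (x + y) = q + y + p\<close> is shorter than y by 2h while the conjugate of x
  does not grow. Such a conjugation replaces the well-ordering of words that commonly breaks ties in
  Nielsen reduction.\<close>

lemma tie_step:
  fixes x y :: "'g fg"
  assumes "2 * gp (- y) x = len x" "2 * gp (- x) y = len x" "x \<noteq> 0" "len x \<le> len y"
  shows "\<exists>p. len (conj (- p) x) + len (conj (- p) (x + y)) < len x + len y"
proof -
  define h where "h = gp (- x) y"
  have h: "len x = 2 * h" "gp (- y) x = h" "gp (- x) y = h" "0 < h"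
    using assms(1,2,3) len_pos[of x] by (auto simp: h_def)
  obtain p where p: "len p = h" "gp p x = h" using prefix_exists[of h x] h by auto
  define q where "q = - p + x"
  have q: "len q = h" using wlen_diff[of "\<lambda>_. True" p x] p h by (simp add: q_def)
  have lq: "len (q + y) \<le> len y - h" "len y - h \<le> len (q + y)" 
  proof -
    have "len (x - q) = h" using p by (simp add: q_def diff_conv_add_uminus minus_add add.assoc[symmetric] del: add_uminus_conv_diff)
    then have "gp (- x) (- q) = h"
      using wlen_diff[of "\<lambda>_. True" "- x" "- q"] h q by simp
    then have "gp (- q) y \<ge> h"
      using wgp_ultra[of "\<lambda>_. True" "- q" "- x" y] h by (simp add: wgp_commute)
    then show "len (q + y) \<le> len y - h" "len y - h \<le> len (q + y)"
      using wlen_plus[of "\<lambda>_. True" q y] q wgp_le(1)[of "\<lambda>_. True" "- q" y] by simp_all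
  qed
  have "gp (- y) p \<ge> h"
    using wgp_ultra[of "\<lambda>_. True" "- y" x p] h p by (simp add: wgp_commute)
  moreover have "gp (- (q + y)) (- y) \<ge> h"
    using wlen_diff[of "\<lambda>_. True" "- (q + y)" "- y"] lq q assms(4) h
    by (simp add: add.assoc)
  ultimately have "gp (- (q + y)) p \<ge> h"
    using wgp_ultra[of "\<lambda>_. True" "- (q + y)" "- y" p] by simp
  then have "len (q + y + p) \<le> len y - 2 * h"
    using wlen_plus[of "\<lambda>_. True" "q + y" p] lq p assms(4) h by simp
  moreover have "conj (- p) (x + y) = q + y + p"
    by (simp add: conj_def q_def add.assoc)
  moreover have "len (conj (- p) x) \<le> 2 * h"
    using wlen_plus_le[of "\<lambda>_. True" q p] q p by (simp add: conj_def q_def)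
  ultimately show ?thesis using h assms(4) by (intro exI[of _ p]) simp
qed

lemma not_successively:
  "\<not> successively P xs \<Longrightarrow> \<exists>us l m vs. xs = us @ l # m # vs \<and> \<not> P l m"
proof (induction xs rule: induct_list012)
  case (3 x y zs)
  show ?case
  proof (cases "P x y")
    case True
    then obtain us l m vs where "y # zs = us @ l # m # vs" "\<not> P l m" using 3 by auto
    then show ?thesis by (metis append_Cons)
  qed (use append_Nil in blast)
qed auto

text \<open>An expression with the fewest factors has no two adjacent inverse factors.\<close>

lemma sgp_reduced_sum:
  assumes "z \<in> sgp U"
  obtains ls where "set ls \<subseteq> U \<union> uminus ` U" "sum_list ls = z" "successively (\<lambda>l m. m \<noteq> - l) ls"
proof -
  let ?P = "\<lambda>ls. set ls \<subseteq> U \<union> uminus ` U \<and> sum_list ls = z"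
  have ex: "\<exists>ls. ?P ls"
    using assms
  proof (induction rule: sgp.induct)
    case zero
    show ?case by (rule exI[of _ "[]"]) simp
  next
    case (plus u x)
    then obtain ls where "set ls \<subseteq> U \<union> uminus ` U" "sum_list ls = x" by blast
    then show ?case using plus by (intro exI[of _ "u # ls"]) auto
  next
    case (minus u x)
    then obtain ls where "set ls \<subseteq> U \<union> uminus ` U" "sum_list ls = x" by blast
    then show ?case using minus by (intro exI[of _ "- u # ls"]) auto
  qed
  then obtain ls where ls: "?P ls" "\<And>ls'. ?P ls' \<Longrightarrow> length ls \<le> length ls'"
    using ex_has_least_nat[of ?P _ length] by blast
  have "successively (\<lambda>l m. m \<noteq> - l) ls"
  proof (rule ccontr)
    assume "\<not> ?thesis"
    then obtain us l m vs where *: "ls = us @ l # m # vs" "m = - l"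
      using not_successively by blast
    then have "?P (us @ vs)" using ls(1) by (auto simp: add.assoc[symmetric])
    from ls(2)[OF this] * show False by simp
  qed
  then show ?thesis using that ls by blast
qed

text \<open>Minimal lengths bound every cancellation by half of each factor. A factor could be used
  up from both sides only if both cancellations are exactly half of it, and that is what the absence
  of ties excludes.\<close>

lemma lc_two_generators:
  fixes x y :: "'g fg"
  assumes len: "\<And>X Y. X \<in> {x, - x} \<Longrightarrow> Y \<in> {y, - y} \<Longrightarrow> len x \<le> len (X + Y) \<and> len y \<le> len (X + Y)"
    and tie: "\<And>X Y. X \<in> {x, - x} \<and> Y \<in> {y, - y} \<or> X \<in> {y, - y} \<and> Y \<in> {x, - x} \<Longrightarrow>
        \<not> (2 * gp (- Y) X = len X \<and> 2 * gp (- X) Y = len X)"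
    and nz: "x \<noteq> 0" "y \<noteq> 0" and two: "2 \<le> len x \<or> 2 \<le> len y"
    and ls: "set ls \<subseteq> {x, - x, y, - y}" "successively (\<lambda>l m. m \<noteq> - l) ls"
  shows "lc ls"
proof -
  let ?L = "{x, - x, y, - y}"
  let ?opp = "\<lambda>l m. l \<in> {x, - x} \<and> m \<in> {y, - y} \<or> l \<in> {y, - y} \<and> m \<in> {x, - x}"
  have opp: "m = l \<or> ?opp l m" if "l \<in> ?L" "m \<in> ?L" "m \<noteq> - l" for l m
    using that by auto
  have nzL: "l \<noteq> 0" if "l \<in> ?L" for l using that nz by auto
  have A0: "len l \<le> len (l + m)" "len m \<le> len (l + m)" "2 \<le> len (l + m)" if "?opp l m" for l m
  proof -
    have "len x \<le> len (l + m) \<and> len y \<le> len (l + m)"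
      using that
    proof
      assume "l \<in> {y, - y} \<and> m \<in> {x, - x}"
      then have "- m \<in> {x, - x}" "- l \<in> {y, - y}" by auto
      from len[OF this] show ?thesis by (metis minus_add wlen_uminus)
    qed (use len in auto)
    then show "len l \<le> len (l + m)" "len m \<le> len (l + m)" "2 \<le> len (l + m)"
      using that two by auto
  qed
  have A: "2 * gp (- l) m \<le> len l" "2 * gp (- l) m \<le> len m" "2 \<le> len (l + m)"
    if "l \<in> ?L" "m \<in> ?L" "m \<noteq> - l" for l m
  proof -
    show "2 * gp (- l) m \<le> len l" "2 * gp (- l) m \<le> len m" "2 \<le> len (l + m)"
      using opp[OF that] A0[of l m] wlen_plus[of "\<lambda>_. True" l m] gp_uminus_self[of l] len_double[of l]
        nzL[OF that(1)] len_pos[of l]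
      by (cases "m = l"; force)+
  qed
  \<comment> \<open>Otherwise both cancellations are exactly half of m. Then n = l gives a tie,
    while n = - l makes half of m cancel against m itself, contrary to
    \<open>gp_uminus_self\<close>.\<close>
  have B: "gp (- l) m + gp (- m) n < len m"
    if "l \<in> ?L" "m \<in> ?L" "n \<in> ?L" "m \<noteq> - l" "n \<noteq> - m" for l m n
  proof (cases "m = l \<or> n = m")
    case True
    then show ?thesis
      using A[OF that(1,2,4)] A[OF that(2,3,5)] gp_uminus_self[OF nzL[OF that(2)]] by auto
  next
    case False
    then have o: "?opp l m" "?opp m n" using opp that by blast+
    show ?thesis
    proof (rule ccontr)
      assume "\<not> ?thesis"
      then have h: "2 * gp (- l) m = len m" "2 * gp (- m) n = len m"
        using A[OF that(1,2,4)] A[OF that(2,3,5)] by linarith+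
      consider "n = l" | "n = - l" | "m \<in> {x, - x} \<and> m \<in> {y, - y}" using o by auto
      then show False
      proof cases
        case 1
        then show False using tie[of m l] o h by blast
      next
        case 2
        then have "2 * gp m (- m) \<ge> len m"
          using wgp_ultra[of "\<lambda>_. True" m "- l" "- m"] h by (simp add: wgp_commute)
        then show False using gp_uminus_self[OF nzL[OF that(2)]] by (simp add: wgp_commute)
      next
        case 3
        then have "n = l \<or> n = - l" using o by auto
        then show False
        proof
          assume "n = l" then show False using tie[of m l] o h by blast
        next
          assume "n = - l"
          then have "2 * gp m (- m) \<ge> len m"
            using wgp_ultra[of "\<lambda>_. True" m "- l" "- m"] h by (simp add: wgp_commute)
          then show False using gp_uminus_self[OF nzL[OF that(2)]] by (simp add: wgp_commute)
        qed
      qed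
    qed
  qed
  show ?thesis
    using ls
  proof (induction ls rule: lc.induct)
    case (2 l)
    then show ?case using nzL by auto
  next
    case (3 l m zs)
    have lm: "l \<in> ?L" "m \<in> ?L" "m \<noteq> - l" using 3 by auto
    have "gp (- l) m + gp (- m) (hd zs) < len m" if "zs \<noteq> []"
    proof -
      obtain n ns where "zs = n # ns" using \<open>zs \<noteq> []\<close> by (cases zs) auto
      then show ?thesis using 3 lm B[of l m n] by auto
    qed
    then show ?case using 3 A[OF lm] by auto
  qed simp
qed

lemma good_letters:
  assumes "letters x y"
  shows "good x y"
  using assms pos.base good_pos by blast

text \<open>Induction on the total length: an addition or \<open>tie_step\<close> shortens the pair
  and preserves goodness both ways. When neither applies, reduced products of the pair satisfy
  \<open>lc\<close>, so a letter, having length one, can only be a product of a single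
  factor.\<close>

lemma generators_good:
  assumes "sgp {x, y} = (UNIV :: gen fg set)"
  shows "good x y"
  using assms
proof (induction "len x + len y" arbitrary: x y rule: less_induct)
  case less
  have IH: "good x' y'" if "len x' + len y' < len x + len y" "{x, y} \<subseteq> sgp {x', y'}" for x' y'
    using less.hyps[OF that(1)] sgp_subset[OF that(2)] less.prems by auto
  have nz: "x \<noteq> 0" "y \<noteq> 0" using generators_not_commute[OF less.prems] by auto
  show ?case
  proof (cases "\<exists>X Y. X \<in> {x, - x} \<and> Y \<in> {y, - y} \<and> (len (X + Y) < len x \<or> len (X + Y) < len y)")
    case True
    then obtain X Y where XY: "X \<in> {x, - x}" "Y \<in> {y, - y}" "len (X + Y) < len x \<or> len (X + Y) < len y"
      by blast
    have l: "len X = len x" "len Y = len y" using XY by auto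
    have "{X, Y} \<subseteq> sgp {X, X + Y}" "{X, Y} \<subseteq> sgp {X + Y, Y}"
    proof -
      have "- X + (X + Y) \<in> sgp {X, X + Y}" "(X + Y) - Y \<in> sgp {X + Y, Y}"
        by (intro sgp_closed; simp)+
      then show "{X, Y} \<subseteq> sgp {X, X + Y}" "{X, Y} \<subseteq> sgp {X + Y, Y}"
        by (auto simp: add.assoc[symmetric] intro: sgp_closed)
    qed
    moreover have "{x, y} \<subseteq> sgp U" if "{X, Y} \<subseteq> sgp U" for U
      using that XY(1,2) sgp_uminus[of X U] sgp_uminus[of Y U] by auto
    ultimately have "good X (X + Y) \<or> good (X + Y) Y"
      using XY(3) l IH[of X "X + Y"] IH[of "X + Y" Y] by auto
    then have "good X Y" by (simp add: good_add_iff good_add_iff2)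
    then show ?thesis using XY(1,2) by (auto simp: good_neg_iff)
  next
    case False
    then have len: "len x \<le> len (X + Y) \<and> len y \<le> len (X + Y)"
      if "X \<in> {x, - x}" "Y \<in> {y, - y}" for X Y using that by (meson not_le)
    let ?opp = "\<lambda>l m. l \<in> {x, - x} \<and> m \<in> {y, - y} \<or> l \<in> {y, - y} \<and> m \<in> {x, - x}"
    show ?thesis
    proof (cases "\<exists>X Y. ?opp X Y \<and> 2 * gp (- Y) X = len X \<and> 2 * gp (- X) Y = len X")
      case True
      then obtain X Y where XY: "?opp X Y" "2 * gp (- Y) X = len X" "2 * gp (- X) Y = len X"
        by blast
      have "len X \<le> len Y" using XY wgp_le(2)[of "\<lambda>_. True" "- X" Y]
      proof -
        have "len X \<le> len (X + Y)"
          using XY(1)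
        proof
          assume *: "X \<in> {y, - y} \<and> Y \<in> {x, - x}"
          then have "- Y \<in> {x, - x}" "- X \<in> {y, - y}" by auto
          then have "len y \<le> len (- Y + - X)" using len by blast
          then show ?thesis using * by (metis insertE minus_add singletonD wlen_uminus)
        next
          assume *: "X \<in> {x, - x} \<and> Y \<in> {y, - y}"
          then have "len x \<le> len (X + Y)" "len X = len x" using len[of X Y] by auto
          then show ?thesis by simp
        qed
        then show ?thesis using wlen_plus[of "\<lambda>_. True" X Y] XY(3) by linarith
      qed
      moreover have "X \<noteq> 0" using XY(1) nz by auto
      ultimately obtain p where p: "len (conj (- p) X) + len (conj (- p) (X + Y)) < len X + len Y"
        using tie_step XY(2,3) by blast
      have "conj (- p) ` {x, y} \<subseteq> conj (- p) ` sgp {X, X + Y}"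
      proof (rule image_mono)
        have "- X + (X + Y) \<in> sgp {X, X + Y}" by (intro sgp_closed; simp)
        then have "Y \<in> sgp {X, X + Y}" by (simp add: add.assoc[symmetric])
        then show "{x, y} \<subseteq> sgp {X, X + Y}"
          using XY(1) sgp_uminus[of X "{X, X + Y}"] sgp_uminus[of Y "{X, X + Y}"] sgp_base[of X "{X, X + Y}"]
          by auto
      qed
      moreover have "sgp (conj (- p) ` {x, y}) = UNIV"
        using sgp_image[OF ghom_conj, of "- p" "{x, y}"] less.prems aut_conj[of "- p"]
        by (simp add: aut_def bij_def)
      ultimately have "sgp {conj (- p) X, conj (- p) (X + Y)} = UNIV"
        using sgp_image[OF ghom_conj, of "- p" "{X, X + Y}"]
          sgp_subset[of "conj (- p) ` {x, y}" "conj (- p) ` {X, X + Y}"] by auto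
      moreover have "len X + len Y = len x + len y" using XY(1) by auto
      ultimately have "good (conj (- p) X) (conj (- p) (X + Y))" using less.hyps p by simp
      then have "good X Y" by (simp add: good_conj_iff good_add_iff)
      then show ?thesis using XY(1) by (auto simp: good_neg_iff intro: good_swap)
    next
      case no_tie: False
      define S where "S u v \<longleftrightarrow> v \<in> {u, - u}" for u v :: "gen fg"
      \<comment> \<open>Either both generators have length one and are letters, or both letters
        occur in the pair. In both cases the pair matches the letters up to signs and order.\<close>
      have "x \<in> {ga, - ga, gb, - gb} \<and> y \<in> {ga, - ga, gb, - gb} \<or>
        ga \<in> {x, - x, y, - y} \<and> gb \<in> {x, - x, y, - y}"
      proof (cases "2 \<le> len x \<or> 2 \<le> len y")
        case True
        have "z \<in> {x, - x, y, - y}" if "len z = 1" for z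
        proof -
          have "z \<in> sgp {x, y}" using less.prems by simp
          then obtain ls where ls: "set ls \<subseteq> {x, y} \<union> uminus ` {x, y}" "sum_list ls = z"
            "successively (\<lambda>l m. m \<noteq> - l) ls" by (rule sgp_reduced_sum)
          have "lc ls"
            by (rule lc_two_generators[of x y]) (use len no_tie nz True ls in auto)
          have "ls \<noteq> []" using ls(2) that by auto
          have "tl ls = []"
            using lc_sum[OF \<open>lc ls\<close> \<open>ls \<noteq> []\<close>] ls(2) that by (cases "tl ls = []") simp_all
          then have "ls = [z]" using ls(2) \<open>ls \<noteq> []\<close> by (cases ls) auto
          then show ?thesis using ls(1) by auto
        qed
        then show ?thesis by (simp add: wlen_gen)
      next
        case False
        then show ?thesis using len_1_letter[of x] len_1_letter[of y] nz by simp
      qed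
      then have cases: "(S ga x \<or> S gb x) \<and> (S ga y \<or> S gb y) \<or> (S x ga \<or> S y ga) \<and> (S x gb \<or> S y gb)"
        unfolding S_def by blast
      have sym: "S u v \<Longrightarrow> S v u" for u v unfolding S_def by auto
      have trans: "S u v \<Longrightarrow> S v w \<Longrightarrow> S u w" for u v w unfolding S_def by auto
      have 1: "\<not> S x y" using generators_not_commute[OF less.prems] by (auto simp: S_def)
      have 2: "\<not> S ga gb"
      proof
        assume "S ga gb"
        then have "eb gb = eb ga \<or> eb gb = - eb ga"
          unfolding S_def by (metis eb_simps(3) insertE singletonD)
        then show False by simp
      qed
      have "S ga x \<and> S gb y \<or> S gb x \<and> S ga y"
        using cases
      proof
        assume "(S ga x \<or> S gb x) \<and> (S ga y \<or> S gb y)"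
        then show ?thesis using 1 sym trans by blast
      next
        assume "(S x ga \<or> S y ga) \<and> (S x gb \<or> S y gb)"
        then show ?thesis using 2 sym trans by blast
      qed
      then have "letters x y" by (simp add: letters_def S_def)
      then show ?thesis by (rule good_letters)
    qed
  qed
qed


lemma aut_good:
  assumes "good x y"
  shows "aut (sub x y)"
proof -
  have base: "aut (sub p q)" if "letters p q" for p q
  proof -
    have "aut (sub p q)" if "p \<in> {ga, - ga}" "q \<in> {gb, - gb}" for p q
      using that by (intro aut_sub_inverse[of p q p q]) (auto simp: sub_simps)
    moreover have "aut (sub p q)" if "p \<in> {gb, - gb}" "q \<in> {ga, - ga}" for p q
    proof -
      have "sub p q = sub q p \<circ> sub gb ga"
        by (rule ghom_ext2) (simp_all add: ghom_comp ghom_sub)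
      then show ?thesis using calculation[of q p] that aut_comp aut_elementary(5) by simp
    qed
    ultimately show ?thesis using that by (auto simp: letters_def)
  qed
  have pos: "aut (sub X Y)" if "pos p q X Y" "letters p q" for p q X Y
    using that
  proof (induction rule: pos.induct)
    case (addr x y)
    have "sub x (x + y) = sub x y \<circ> sub ga (ga + gb)"
      by (rule ghom_ext2) (simp_all add: ghom_comp ghom_sub sub_simps)
    with aut_comp[OF addr.IH[OF addr.prems] aut_elementary(1)] show ?case by (simp only:)
  next
    case (addl x y)
    have "sub (x + y) y = sub x y \<circ> sub (ga + gb) gb"
      by (rule ghom_ext2) (simp_all add: ghom_comp ghom_sub sub_simps)
    with aut_comp[OF addl.IH[OF addl.prems] aut_elementary(2)] show ?case by (simp only:)
  next
    case (conj x y g)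
    have "sub (conj g x) (conj g y) = conj g \<circ> sub x y"
      by (rule ghom_ext2) (simp_all add: ghom_comp ghom_sub ghom_conj)
    with aut_comp[OF aut_conj conj.IH[OF conj.prems]] show ?case by (simp only:)
  qed (use base in blast)
  obtain p q X Y where *: "letters p q" "X \<in> {x, - x}" "Y \<in> {y, - y}" "pos p q X Y"
    using assms unfolding good_def by blast
  have 1: "sub (- u) v = sub u v \<circ> sub (- ga) gb" "sub u (- v) = sub u v \<circ> sub ga (- gb)" for u v :: "gen fg"
    by (rule ghom_ext2; simp add: ghom_comp ghom_sub sub_simps)+
  have 2: "aut (sub u v) \<Longrightarrow> aut (sub (- u) v)" "aut (sub u v) \<Longrightarrow> aut (sub u (- v))" for u v :: "gen fg"
    by (drule aut_comp[OF _ aut_elementary(3)], simp only: 1[symmetric])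
      (drule aut_comp[OF _ aut_elementary(4)], simp only: 1[symmetric])
  show ?thesis
  proof -
    have 3: "aut (sub x y)" if "aut (sub X y)" for y
      using *(2) that 2(1)[of X y] by auto
    have "aut (sub X y)"
      using *(3) pos[OF *(4,1)] 2(2)[of X Y] by auto
    then show ?thesis by (rule 3)
  qed
qed

lemma aut_generators: "sgp {x, y} = UNIV \<Longrightarrow> aut (sub x y)"
  by (rule aut_good[OF generators_good])

lemma generators_aut:
  assumes "aut f"
  shows "sgp {f ga, f gb} = UNIV"
  using sgp_image[of f "{ga, gb}"] assms by (simp add: aut_def bij_def sgp_gens)

lemma good_aut: "aut f \<Longrightarrow> good (f ga) (f gb)"
  by (rule generators_good[OF generators_aut])

section \<open>Automorphisms acting trivially on the abelianisation\<close>

inductive_set mon :: "gen fg \<Rightarrow> gen fg \<Rightarrow> gen fg set" for p q where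
  zero: "0 \<in> mon p q"
| p: "m \<in> mon p q \<Longrightarrow> p + m \<in> mon p q"
| q: "m \<in> mon p q \<Longrightarrow> q + m \<in> mon p q"

lemma mon_add: "m \<in> mon p q \<Longrightarrow> n \<in> mon p q \<Longrightarrow> m + n \<in> mon p q"
  by (induction rule: mon.induct) (auto simp: add.assoc intro: mon.intros)

text \<open>Additions stay in the monoid and a conjugation is absorbed into g, so both members are
  made positive by the same conjugation.\<close>

lemma pos_mon: "pos p q x y \<Longrightarrow> \<exists>g. conj g x \<in> mon p q \<and> conj g y \<in> mon p q"
proof (induction rule: pos.induct)
  case base
  have "p \<in> mon p q" "q \<in> mon p q" using mon.intros(2,3)[OF mon.zero] by force+
  then show ?case by (intro exI[of _ 0]) simp
next
  case (conj x y h)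
  then obtain g where g: "conj g x \<in> mon p q" "conj g y \<in> mon p q" by blast
  have "conj (g - h) (conj h z) = conj g z" for z
    by (simp add: conj_add[symmetric])
  then show ?case using g by (intro exI[of _ "g - h"]) simp
qed (auto simp: conj_simps intro: mon_add)

text \<open>Within the monoid exponents of p and q only accumulate, so the total of their absolute
  values is the number of factors.\<close>

lemma mon_exponents:
  assumes "m \<in> mon p q" "letters p q" "\<bar>ea m\<bar> + \<bar>eb m\<bar> = 1"
  shows "m \<in> {p, q}"
proof -
  have *: "\<exists>i j :: nat. ea m = int i * ea p + int j * ea q \<and> eb m = int i * eb p + int j * eb q \<and>
      (i + j = 0 \<longrightarrow> m = 0) \<and> (i + j = 1 \<longrightarrow> m \<in> {p, q})"
    using assms(1)
  proof (induction rule: mon.induct)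
    case (p m)
    then obtain i j :: nat where "ea m = int i * ea p + int j * ea q" "eb m = int i * eb p + int j * eb q"
      "i + j = 0 \<longrightarrow> m = 0" "i + j = 1 \<longrightarrow> m \<in> {p, q}" by blast
    then show ?case
      by (intro exI[of _ "Suc i"] exI[of _ j]) (simp add: algebra_simps)
  next
    case (q m)
    then obtain i j :: nat where "ea m = int i * ea p + int j * ea q" "eb m = int i * eb p + int j * eb q"
      "i + j = 0 \<longrightarrow> m = 0" "i + j = 1 \<longrightarrow> m \<in> {p, q}" by blast
    then show ?case
      by (intro exI[of _ i] exI[of _ "Suc j"]) (simp add: algebra_simps)
  qed (intro exI[of _ 0]; simp)
  then obtain i j :: nat where ij: "ea m = int i * ea p + int j * ea q" "eb m = int i * eb p + int j * eb q"
    "i + j = 1 \<longrightarrow> m \<in> {p, q}" by blast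
  have "\<bar>ea m\<bar> + \<bar>eb m\<bar> = int i + int j"
    using assms(2) ij(1,2) by (auto simp: letters_def)
  then show ?thesis using ij(3) assms(3) by simp
qed

text \<open>Nielsen's theorem that the outer automorphism group of F_2 embeds in GL_2(Z): one
  conjugation makes both images positive, and positive elements with unit exponent vectors are
  single letters.\<close>

lemma aut_IA_inner:
  assumes "aut f" "ea (f ga) = 1" "eb (f ga) = 0" "ea (f gb) = 0" "eb (f gb) = 1"
  shows "\<exists>g. f = conj g"
proof -
  obtain p q X Y where *: "letters p q" "X \<in> {f ga, - f ga}" "Y \<in> {f gb, - f gb}" "pos p q X Y"
    using good_aut[OF assms(1)] unfolding good_def by blast
  obtain g where g: "conj g X \<in> mon p q" "conj g Y \<in> mon p q" using pos_mon[OF *(4)] by blast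
  have "conj g X \<in> {p, q}" "conj g Y \<in> {p, q}"
    by (rule mon_exponents[OF g(1) *(1)] mon_exponents[OF g(2) *(1)]; use * assms(2-5) in auto)+
  moreover have "{p, q} \<subseteq> {ga, - ga, gb, - gb}" using *(1) by (auto simp: letters_def)
  ultimately have L: "conj g X \<in> {ga, - ga, gb, - gb}" "conj g Y \<in> {ga, - ga, gb, - gb}" by blast+
  have neg: "z \<in> {ga, - ga, gb, - gb}" if "- z \<in> {ga, - ga, gb, - gb}" for z
  proof -
    define w where "w = - z"
    have "w \<in> {ga, - ga, gb, - gb}" "z = - w" using that by (simp_all add: w_def)
    then show ?thesis by (elim insertE emptyE) simp_all
  qed
  have L': "conj g z \<in> {ga, - ga, gb, - gb}" if "conj g Z \<in> {ga, - ga, gb, - gb}" "Z \<in> {z, - z}" for z Z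
  proof -
    from that(2) have "Z = z \<or> Z = - z" by simp
    then show ?thesis
    proof
      assume "Z = - z"
      then show ?thesis by - (rule neg, use that(1) in \<open>simp only: conj_simps(3)\<close>)
    qed (use that(1) in simp)
  qed
  have "conj g (f ga) \<in> {ga, - ga, gb, - gb}" "conj g (f gb) \<in> {ga, - ga, gb, - gb}"
    using L'[OF L(1) *(2)] L'[OF L(2) *(3)] by blast+
  moreover have "ea (conj g (f ga)) = 1" "eb (conj g (f gb)) = 1" using assms by simp_all
  moreover have "w \<in> {ga, - ga, gb, - gb} \<Longrightarrow> ea w = 1 \<Longrightarrow> w = ga"
    "w \<in> {ga, - ga, gb, - gb} \<Longrightarrow> eb w = 1 \<Longrightarrow> w = gb" for w
    by (elim insertE emptyE; simp)+
  ultimately have "conj g (f ga) = ga" "conj g (f gb) = gb" by blast+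
  then have "f ga = conj (- g) ga" "f gb = conj (- g) gb" by (metis conj_inverse(2))+
  then have "f = conj (- g)"
    using assms(1) by (intro ghom_ext2) (auto simp: aut_def ghom_conj)
  then show ?thesis by blast
qed

section \<open>The commutator of a basis\<close>

definition com :: "'a :: group_add \<Rightarrow> 'a \<Rightarrow> 'a" where
  "com x y = x + y - x - y"

lemma com_simps:
  "com (- x) y = conj (- x) (- com x y)" "com x (- y) = conj (- y) (- com x y)"
  "com y x = - com x y" "com x (x + y) = conj x (com x y)" "com (x + y) y = com x y"
  "com (conj g x) (conj g y) = conj g (com x y)"
  by (simp_all add: com_def conj_def group_simps del: add_uminus_conv_diff)

text \<open>Each move and each change of sign that leads from the letters to a basis conjugates the
  commutator, inverts it, or leaves it alone.\<close>

lemma aut_com: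
  assumes "aut f"
  shows "\<exists>g. f (com ga gb) = conj g (com ga gb) \<or> f (com ga gb) = conj g (- com ga gb)"
proof -
  define c where "c = com ga gb"
  define R where "R z \<longleftrightarrow> (\<exists>g. z = conj g c \<or> z = conj g (- c))" for z
  have Rneg: "R (- z)" if "R z" for z
    using that unfolding R_def by (metis conj_simps(3) minus_minus)
  have Rconj: "R (conj h z)" if "R z" for h z
    using that unfolding R_def by (metis conj_add)
  have Rneg_iff: "R (- z) = R z" for z using Rneg[of z] Rneg[of "- z"] by auto
  have Rconj_iff: "R (conj h z) = R z" for h z using Rconj[of z h] Rconj[of "conj h z" "- h"] by auto
  have Rc: "R c" unfolding R_def by (metis conj_zero)
  have base: "R (com p q)" if "letters p q" for p q
    using that Rc by (auto simp: letters_def com_simps(1-3)[of gb ga] com_simps(1,2)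
        Rneg_iff Rconj_iff c_def simp del: minus_minus)
  have "R (com X Y)" if "pos p q X Y" "letters p q" for p q X Y
    using that by (induction rule: pos.induct) (auto simp: com_simps(4-6) Rconj_iff base)
  moreover obtain p q X Y where *: "letters p q" "X \<in> {f ga, - f ga}" "Y \<in> {f gb, - f gb}" "pos p q X Y"
    using good_aut[OF assms(1)] unfolding good_def by blast
  ultimately have "R (com X Y)" by blast
  then have "R (com (f ga) (f gb))"
    using *(2,3) by (auto simp: com_simps(1,2) Rneg_iff Rconj_iff)
  moreover have "com (f ga) (f gb) = f c"
    using assms by (simp add: aut_def c_def com_def ghom_simps)
  ultimately show ?thesis unfolding R_def c_def by metis
qed


section \<open>Automorphisms and their abelianisations\<close>

lemma exponent_hom:
  assumes "ghom f"
  shows "ea (f u) = ea u * ea (f ga) + eb u * ea (f gb)" "eb (f u) = ea u * eb (f ga) + eb u * eb (f gb)"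
proof -
  have "f = sub (f ga) (f gb)" by (rule ghom_sub_eq[OF assms])
  moreover have "ea (sub x y u) = ea u * ea x + eb u * ea y \<and> eb (sub x y u) = ea u * eb x + eb u * eb y" for x y
  proof -
    have step: "gen i \<in> {ga, gb}" for i by (cases i) auto
    show ?thesis
    proof (induction u rule: fg_induct)
      case (gen i u)
      then show ?case using step[of i] by (auto simp: sub_simps algebra_simps)
    next
      case (neg i u)
      then show ?case using step[of i] by (auto simp: sub_simps algebra_simps)
    qed (simp add: sub_simps)
  qed
  ultimately show "ea (f u) = ea u * ea (f ga) + eb u * ea (f gb)" "eb (f u) = ea u * eb (f ga) + eb u * eb (f gb)"
    by metis+
qed

lemma aut_ghom: "aut f \<Longrightarrow> ghom f"
  by (simp add: aut_def)

lemmas aut_exponent = exponent_hom[OF aut_ghom]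

lemma aut_cancel [simp]: "aut f \<Longrightarrow> f (finv f x) = x" "aut f \<Longrightarrow> finv f (f x) = x"
  by (simp_all add: aut_def bij_is_surj surj_f_inv_f bij_is_inj)

lemma aut_inj: "aut f \<Longrightarrow> f x = f y \<longleftrightarrow> x = y"
  by (metis aut_cancel(2))

lemma aut_id: "aut id"
  by (simp add: aut_def ghom_id)

definition dt :: "(gen fg \<Rightarrow> gen fg) \<Rightarrow> int" where
  "dt f = ea (f ga) * eb (f gb) - ea (f gb) * eb (f ga)"

definition tr :: "(gen fg \<Rightarrow> gen fg) \<Rightarrow> int" where
  "tr f = ea (f ga) + eb (f gb)"

lemma dt_comp:
  assumes "ghom f" "ghom g"
  shows "dt (f \<circ> g) = dt f * dt g"
  unfolding dt_def comp_apply exponent_hom[OF assms(1), of "g ga"] exponent_hom[OF assms(1), of "g gb"]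
  by (simp add: algebra_simps)

lemma tr_square:
  assumes "ghom f"
  shows "tr (f \<circ> f) = (tr f)\<^sup>2 - 2 * dt f"
  unfolding tr_def dt_def comp_apply exponent_hom[OF assms, of "f ga"] exponent_hom[OF assms, of "f gb"]
  by (simp add: algebra_simps power2_eq_square)

lemma aut_dt_inv:
  assumes f: "aut f"
  shows "dt f * dt (finv f) = 1"
proof -
  have "f \<circ> finv f = id" using f by (simp add: fun_eq_iff)
  then have "dt f * dt (finv f) = dt id" using dt_comp aut_ghom f aut_inv by metis
  then show ?thesis by (simp add: dt_def)
qed

lemma aut_dt: "aut f \<Longrightarrow> dt f = 1 \<or> dt f = - 1"
  using aut_dt_inv[of f] by (auto simp: zmult_eq_1_iff)

lemma same_exponents_inner:
  assumes f: "aut f" and g: "aut g"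
    and e: "ea (f ga) = ea (g ga)" "eb (f ga) = eb (g ga)" "ea (f gb) = ea (g gb)" "eb (f gb) = eb (g gb)"
  shows "\<exists>h. f = conj h \<circ> g"
proof -
  have same: "ea (f x) = ea (g x)" "eb (f x) = eb (g x)" for x
    using aut_exponent[OF f, of x] aut_exponent[OF g, of x] e by simp_all
  have "aut (f \<circ> finv g)" using f g by (simp add: aut_comp aut_inv)
  then obtain h where "f \<circ> finv g = conj h"
    using aut_IA_inner[of "f \<circ> finv g"] same g by auto
  then have "f (finv g x) = conj h x" for x by (metis comp_apply)
  then have "f x = conj h (g x)" for x using g by (metis aut_cancel(2))
  then show ?thesis by (auto simp: fun_eq_iff)
qed

text \<open>A non-abelian fixed subgroup. The property passes to powers and to conjugates of f,
  which is what permits squaring f and changing the basis.\<close>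

definition nafix :: "('a :: group_add \<Rightarrow> 'a) \<Rightarrow> bool" where
  "nafix f \<longleftrightarrow> (\<exists>u v. f u = u \<and> f v = v \<and> u + v \<noteq> v + u)"

lemma nafix_transfer:
  assumes "nafix f" "aut h" "\<And>x. g (h x) = h (f x)"
  shows "nafix g"
proof -
  obtain u v where "f u = u" "f v = v" "u + v \<noteq> v + u" using assms(1) by (auto simp: nafix_def)
  then have "g (h u) = h u" "g (h v) = h v" "h u + h v \<noteq> h v + h u"
    using assms(2,3) by (auto simp: ghom_plus[OF aut_ghom, symmetric] aut_inj)
  then show ?thesis unfolding nafix_def by blast
qed

lemma nafix_comp: "nafix f \<Longrightarrow> nafix (f \<circ> f)" "nafix f \<Longrightarrow> nafix (f \<circ> (f \<circ> f))"
  unfolding nafix_def comp_apply by metis+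

text \<open>The fixed elements form the centraliser of g, which is abelian unless g
  vanishes.\<close>

lemma nafix_inner:
  assumes "nafix (conj g :: 'g fg \<Rightarrow> _)"
  shows "g = 0"
  using assms commute_trans[of g] unfolding nafix_def conj_eq_iff by blast

lemma nafix_IA:
  assumes "nafix f" "aut f" "ea (f ga) = 1" "eb (f ga) = 0" "ea (f gb) = 0" "eb (f gb) = 1"
  shows "f = id"
proof -
  obtain g where "f = conj g" using aut_IA_inner assms(2-) by blast
  then have "g = 0" using nafix_inner assms(1) by blast
  then show ?thesis by (simp add: \<open>f = conj g\<close> fun_eq_iff)
qed

section \<open>Involutions permuting the letters\<close>

locale letter_involution =
  fixes \<pi> :: "gen letter \<Rightarrow> gen letter"
  assumes invol [simp]: "\<pi> (\<pi> l) = l" and inv [simp]: "\<pi> (letter_inv l) = letter_inv (\<pi> l)"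
begin

definition \<psi> :: "gen fg \<Rightarrow> gen fg" where
  "\<psi> x = elt (map \<pi> (wd x))"

lemma \<pi>_eq: "\<pi> x = \<pi> y \<longleftrightarrow> x = y"
  by (metis invol)

lemma reduced_map [simp]: "reduced (map \<pi> w) = reduced w"
  by (induction w rule: reduced.induct) (auto simp: \<pi>_eq simp flip: inv)

lemma wd_\<psi>: "wd (\<psi> x) = map \<pi> (wd x)"
  by (simp add: \<psi>_def elt_reduced_wd)

lemma reduce_map: "reduce (map \<pi> w) = map \<pi> (reduce w)"
proof (induction w)
  case (Cons l w)
  have "red_cons (\<pi> l) (map \<pi> v) = map \<pi> (red_cons l v)" for v
    by (cases v) (auto simp: \<pi>_eq simp flip: inv)
  then show ?case using Cons by (simp add: reduce_def)
qed (simp add: reduce_def)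

lemma \<psi>_elt: "\<psi> (elt w) = elt (map \<pi> w)"
  by (simp add: \<psi>_def wd_elt elt_def reduce_map[symmetric] reduced_reduce reduce_reduced)

lemma ghom_\<psi>: "ghom \<psi>"
proof -
  have "\<psi> (elt u + elt v) = \<psi> (elt u) + \<psi> (elt v)" for u v
    unfolding \<psi>_elt by (simp only: elt_append[symmetric] \<psi>_elt map_append)
  from this[of "wd _" "wd _"] show ?thesis by (simp add: ghom_def)
qed

lemmas \<psi>_simps = ghom_simps[OF ghom_\<psi>]

lemma \<psi>_\<psi> [simp]: "\<psi> (\<psi> x) = x"
  unfolding \<psi>_def[of x] \<psi>_elt by (simp add: o_def)

lemma aut_\<psi>: "aut \<psi>"
  by (rule autI[of _ \<psi>]) (simp_all add: ghom_\<psi>)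

text \<open>The map sending x to \<open>elt [s] + \<psi> x\<close> exchanges the ends 0 and
  \<open>elt [s]\<close> of an edge of the Cayley tree and fixes only its midpoint. Left translation
  by u commutes with this map, hence preserves the edge, and a free action without inversions leaves
  only u = 0. The proof extracts this from the first and last letters of the word.\<close>

lemma fix_edge_inversion:
  assumes s: "\<pi> s = letter_inv s" and u: "elt [s] + \<psi> u = u + elt [s]"
  shows "u = 0"
proof (rule ccontr)
  assume "u \<noteq> 0"
  define w where "w = wd u"
  have w: "reduced w" "w \<noteq> []" "u = elt w" using \<open>u \<noteq> 0\<close> by (simp_all add: w_def)
  have s': "\<pi> (letter_inv s) = s" using s by simp
  have eq: "elt (s # map \<pi> w) = elt (w @ [s])"
    using u w(3) by (simp add: elt_append elt_Cons[of s "map \<pi> w"] \<psi>_elt)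
  have rs: "reduced (s # map \<pi> w)" if "reduced w" "w \<noteq> []" "hd w \<noteq> s" for w
  proof (cases w)
    case (Cons x v)
    then have "\<pi> x \<noteq> letter_inv s" using that(3) s' by (metis invol list.sel(1))
    then show ?thesis using reduced_map[of w] that(1) Cons by (simp del: reduced_map)
  qed (use that in simp)
  have hd1: "hd w = s" if "reduced (w @ [s])"
  proof (rule ccontr)
    assume "hd w \<noteq> s"
    then have "reduced (s # map \<pi> w)" using w rs by blast
    then have "s # map \<pi> w = w @ [s]" using eq that elt_reduced_wd by metis
    then show False using \<open>hd w \<noteq> s\<close> w(2) by (cases w) auto
  qed
  show False
  proof (cases "last w = letter_inv s")
    case False
    then have r: "reduced (w @ [s])" using w by (simp add: reduced_append) (metis letter_inv_letter_inv)
    obtain w1 where w1: "w = s # w1" using hd1[OF r] w(2) by (cases w) auto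
    have "elt (s # map \<pi> w) = elt (map \<pi> w1)"
    proof -
      have "elt (s # map \<pi> w) = elt [s] + (elt [letter_inv s] + elt (map \<pi> w1))"
        using w1 s by (metis elt_Cons list.simps(9))
      then show ?thesis by (simp add: elt_letter_inv)
    qed
    then have "wd (elt (map \<pi> w1)) = w @ [s]" using eq r elt_reduced_wd by metis
    moreover have "reduced w1" using w(1) w1 reduced_tl by blast
    ultimately have "map \<pi> w1 = w @ [s]" by (simp add: elt_reduced_wd)
    then have "length w1 = Suc (length w)" by (metis length_append_singleton length_map)
    then show False using w1 by simp
  next
    case True
    then obtain w0 where w0: "w = w0 @ [letter_inv s]" using w(2) by (metis append_butlast_last_id)
    have "elt (w @ [s]) = elt w0"
      using w0 by (simp add: elt_append elt_letter_inv elt_Cons[of "letter_inv s" "[s]"])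
    then have "wd (elt (s # map \<pi> w)) = w0" using eq w0 w(1) by (simp add: elt_reduced_wd reduced_append)
    moreover have "hd w = s"
    proof (rule ccontr)
      assume "hd w \<noteq> s"
      then have "reduced (s # map \<pi> w)" using w rs by blast
      then have "s # map \<pi> w = w0" using calculation elt_reduced_wd by metis
      then have "length w0 = Suc (length w)" by (metis length_Cons length_map)
      then show False using w0 by simp
    qed
    ultimately obtain v where v: "w = s # v @ [letter_inv s]"
      using w0 w(2) by (cases w0) auto
    have "v \<noteq> []" using w(1) v by auto
    then have rv: "reduced v" "v \<noteq> []" "hd v \<noteq> letter_inv s" "last v \<noteq> s"
      using w(1) v reduced_append[of "[s]" "v @ [letter_inv s]"] reduced_append[of v "[letter_inv s]"]
      by auto
    have "elt (s # v) = elt (w @ [s])"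
      using v by (simp add: elt_append elt_letter_inv elt_Cons[of s v] elt_Cons[of s "v @ _"]
          elt_Cons[of "letter_inv s" "[s]"] add.assoc)
    also have "\<dots> = elt (map \<pi> v @ [s])"
      using eq v s s' by (simp add: elt_append elt_letter_inv elt_Cons[of s "letter_inv s # _"]
          elt_Cons[of "letter_inv s" "_ @ _"] add.assoc[symmetric])
    finally have "elt (s # v) = elt (map \<pi> v @ [s])" .
    moreover have "reduced (s # v)" using rv by (cases v) auto
    moreover have "reduced (map \<pi> v @ [s])"
      using rv s' by (auto simp: reduced_append last_map)
    ultimately have "s # v = map \<pi> v @ [s]" using elt_reduced_wd by metis
    from arg_cong[OF this, of hd] have "\<pi> (hd v) = s" using rv(2) by (simp add: hd_append hd_map)
    then show False using rv(3) s by (metis invol)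
  qed
qed

text \<open>The square of f is conjugation by \<open>g + \<psi> g\<close>, which therefore vanishes,
  so \<pi> carries the word of g to its inverse. Conjugating by the first half of that word turns f
  into \<psi> if its length is even, and into an inversion of the middle edge, with trivial fixed
  subgroup, if it is odd.\<close>

lemma nafix_letter_involution:
  assumes f: "aut f" "nafix f"
    and e: "ea (f ga) = ea (\<psi> ga)" "eb (f ga) = eb (\<psi> ga)" "ea (f gb) = ea (\<psi> gb)" "eb (f gb) = eb (\<psi> gb)"
  shows "nafix \<psi>"
proof -
  obtain g where fg: "f = conj g \<circ> \<psi>" using same_exponents_inner[OF f(1) aut_\<psi> e] by blast
  have ff: "f \<circ> f = conj (g + \<psi> g)"
    by (simp add: fun_eq_iff fg conj_def \<psi>_simps group_simps del: add_uminus_conv_diff)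
  then have "g + \<psi> g = 0" using nafix_inner nafix_comp(1)[OF f(2)] by metis
  then have "\<psi> g = - g" using minus_unique[of g "\<psi> g"] by simp
  then have w: "map \<pi> (wd g) = winv (wd g)" by (metis wd_\<psi> wd_uminus)
  define w where "w = wd g"
  define k where "k = length w div 2"
  define Y where "Y = take k w"
  define y where "y = elt Y"
  have wpi: "map \<pi> w = winv w" using w by (simp add: w_def)
  \<comment> \<open>Twisted conjugacy: conjugating f by y replaces g by
    \<open>- y + g + \<psi> y\<close>.\<close>
  have conjf: "f (conj y u) = conj y (conj (- y + g + \<psi> y) (\<psi> u))" for u
    by (simp add: fg conj_def \<psi>_simps group_simps del: add_uminus_conv_diff)
  show ?thesis
  proof (cases "even (length w)")
    case True
    then have k: "length w = k + k" by (simp add: k_def) presburger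
    have "map \<pi> (drop k w) = winv Y"
      using arg_cong[OF wpi, of "drop k"] k by (simp add: drop_map drop_rev Y_def take_map)
    then have "\<psi> (elt (drop k w)) = - y" by (simp add: \<psi>_elt elt_winv y_def)
    then have "elt (drop k w) = - \<psi> y" by (metis \<psi>_\<psi> \<psi>_simps(3))
    moreover have "g = y + elt (drop k w)"
      by (metis Y_def append_take_drop_id elt_append elt_wd w_def y_def)
    ultimately have "- y + g + \<psi> y = 0" by (simp add: group_simps del: add_uminus_conv_diff)
    then have "f (conj y u) = conj y (\<psi> u)" for u using conjf by simp
    then have "\<psi> (conj (- y) u) = conj (- y) (f u)" for u
      by (metis conj_inverse)
    then show ?thesis by (rule nafix_transfer[OF f(2) aut_conj])
  next
    case False
    then have k: "length w = Suc (k + k)" by (simp add: k_def) presburger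
    define s where "s = w ! k"
    define Z where "Z = drop (Suc k) w"
    have wdec: "w = Y @ s # Z" using k by (simp add: Y_def Z_def s_def id_take_nth_drop)
    have lYZ: "length Y = k" "length Z = k" using k by (simp_all add: Y_def Z_def)
    have "map \<pi> Y @ \<pi> s # map \<pi> Z = winv Z @ letter_inv s # winv Y"
      using wpi wdec by simp
    then have sZ: "\<pi> s = letter_inv s" "map \<pi> Z = winv Y" using lYZ by auto
    then have "\<psi> (elt Z) = - y" by (simp add: \<psi>_elt elt_winv y_def)
    then have "elt Z = - \<psi> y" by (metis \<psi>_\<psi> \<psi>_simps(3))
    moreover have "g = y + (elt [s] + elt Z)"
      by (metis wdec elt_append elt_Cons elt_wd w_def y_def)
    ultimately have "- y + g + \<psi> y = elt [s]" by (simp add: group_simps del: add_uminus_conv_diff)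
    then have cf: "f (conj y u) = conj y (conj (elt [s]) (\<psi> u))" for u using conjf by simp
    have "u = 0" if "f u = u" for u
    proof -
      have "conj (elt [s]) (\<psi> (conj (- y) u)) = conj (- y) u"
        using cf[of "conj (- y) u"] that by (metis conj_inverse)
      then have "conj (- y) u = 0"
        by (intro fix_edge_inversion[OF sZ(1)]) (simp add: conj_def diff_eq_eq)
      then show ?thesis by (metis conj_inverse(1) conj_simps(2))
    qed
    then show ?thesis using f(2) unfolding nafix_def by (metis add.left_neutral add.right_neutral)
  qed
qed

end

section \<open>Three involutions of the letters\<close>

lemma nafix_minus_identity:
  assumes "aut f" "nafix f" "ea (f ga) = - 1" "eb (f ga) = 0" "ea (f gb) = 0" "eb (f gb) = - 1"
  shows False
proof -
  interpret letter_involution letter_inv by standard simp_all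
  have *: "\<psi> (gen i) = - gen i" for i by (simp add: gen_def \<psi>_elt elt_letter_inv)
  have "nafix \<psi>" by (rule nafix_letter_involution) (use assms * in simp_all)
  moreover have "u = 0" if "\<psi> u = u" for u
  proof -
    have "map letter_inv (wd u) = wd u" using that by (metis wd_\<psi>)
    then have "wd u = []" by (cases "wd u") auto
    then show ?thesis by simp
  qed
  ultimately show False by (auto simp: nafix_def)
qed

lemma nafix_swap:
  assumes "aut f" "nafix f" "ea (f ga) = 0" "eb (f ga) = 1" "ea (f gb) = 1" "eb (f gb) = 0"
  shows False
proof -
  define \<sigma> :: "gen letter \<Rightarrow> gen letter" where
    "\<sigma> l = (case fst l of Gen_a \<Rightarrow> Gen_b | Gen_b \<Rightarrow> Gen_a, snd l)" for l
  interpret letter_involution \<sigma>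
    by standard (auto simp: \<sigma>_def letter_inv_def prod_eq_iff split: gen.splits)
  have *: "\<psi> ga = gb" "\<psi> gb = ga" by (simp_all add: gen_def \<psi>_elt \<sigma>_def)
  have "nafix \<psi>" by (rule nafix_letter_involution) (use assms * in simp_all)
  moreover have "u = 0" if "\<psi> u = u" for u
  proof -
    have "map \<sigma> (wd u) = wd u" using that by (metis wd_\<psi>)
    then have "wd u = []" by (cases "wd u") (auto simp: \<sigma>_def prod_eq_iff split: gen.splits)
    then show ?thesis by simp
  qed
  ultimately show False by (auto simp: nafix_def)
qed

lemma elt_only_a:
  "(\<forall>l\<in>set w. fst l = Gen_a) \<Longrightarrow> \<exists>k. elt w = zmul k ga"
proof (induction w)
  case (Cons l w)
  then obtain k where "elt w = zmul k ga" by auto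
  then have "elt (l # w) = (if snd l then zmul (k + 1) ga else zmul (k - 1) ga)"
    using Cons.prems elt_Cons[of l w] by (cases l) (simp add: elt_single zmul_succ zmul_pred)
  then show ?case by auto
qed (auto intro: exI[of _ 0])

lemma nafix_reflection:
  assumes "aut f" "nafix f" "ea (f ga) = 1" "eb (f ga) = 0" "ea (f gb) = 0" "eb (f gb) = - 1"
  shows False
proof -
  define \<sigma> :: "gen letter \<Rightarrow> gen letter" where
    "\<sigma> l = (fst l, if fst l = Gen_a then snd l else \<not> snd l)" for l
  interpret letter_involution \<sigma>
    by standard (auto simp: \<sigma>_def letter_inv_def prod_eq_iff)
  have *: "\<psi> ga = ga" "\<psi> gb = - gb"
    by (simp_all add: gen_def \<psi>_elt \<sigma>_def elt_single[of _ False, unfolded gen_def])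
  have "nafix \<psi>" by (rule nafix_letter_involution) (use assms * in simp_all)
  moreover have "\<exists>k. u = zmul k ga" if "\<psi> u = u" for u
  proof -
    have "map \<sigma> (wd u) = wd u" using that by (metis wd_\<psi>)
    then have "\<sigma> l = l" if "l \<in> set (wd u)" for l using that by (metis map_idI map_eq_conv list.map_ident)
    moreover have "fst l = Gen_a" if "\<sigma> l = l" for l
      using that by (auto simp: \<sigma>_def prod_eq_iff split: if_splits)
    ultimately have "\<forall>l\<in>set (wd u). fst l = Gen_a" by blast
    then show ?thesis using elt_only_a[of "wd u"] by simp
  qed
  ultimately show False unfolding nafix_def by (metis zmul_commute)
qed

section \<open>Changing the basis\<close>

lemma aut_elementary2: "aut (sub (ga + zmul k gb) gb)"
  by (rule aut_sub_inverse[of _ _ "ga + zmul (- k) gb" gb])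
    (simp_all add: sub_simps ghom_zmul[OF ghom_sub] add.assoc zmul_uminus del: add_uminus_conv_diff)

text \<open>Primitive rows extend to invertible matrices, and these lift to automorphisms.\<close>

lemma aut_with_row:
  assumes "coprime l (m :: int)"
  shows "\<exists>f. aut f \<and> (\<forall>u. eb (f u) = l * ea u + m * eb u)"
  using assms
proof (induction "nat (\<bar>l\<bar> + \<bar>m\<bar>)" arbitrary: l m rule: less_induct)
  case less
  consider "m = 0" | "l = 0" | "m \<noteq> 0" "l \<noteq> 0" "\<bar>m\<bar> \<le> \<bar>l\<bar>" | "m \<noteq> 0" "l \<noteq> 0" "\<bar>l\<bar> \<le> \<bar>m\<bar>" by linarith
  then show ?case
  proof cases
    case 1
    then have l: "l = 1 \<or> l = - 1" using less.prems by (simp add: abs_if split: if_splits)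
    have "aut (sub (zmul l gb) ga)"
      by (rule aut_sub_inverse[of _ _ gb "zmul l ga"])
        (use l in \<open>auto simp: ghom_zmul[OF ghom_sub] zmul_mult[symmetric] sub_simps\<close>)
    then show ?thesis using 1
      by (intro exI[of _ "sub (zmul l gb) ga"]) (simp add: exponent_hom(2)[OF ghom_sub])
  next
    case 2
    then have m: "m = 1 \<or> m = - 1" using less.prems by (simp add: abs_if split: if_splits)
    have "aut (sub ga (zmul m gb))"
      by (rule aut_sub_inverse[of _ _ ga "zmul m gb"])
        (use m in \<open>auto simp: ghom_zmul[OF ghom_sub] zmul_mult[symmetric] sub_simps\<close>)
    then show ?thesis using 2
      by (intro exI[of _ "sub ga (zmul m gb)"]) (simp add: exponent_hom(2)[OF ghom_sub])
  next
    case 3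
    define k where "k = sgn l * sgn m"
    have "nat (\<bar>l - k * m\<bar> + \<bar>m\<bar>) < nat (\<bar>l\<bar> + \<bar>m\<bar>)"
      using 3 by (auto simp: k_def sgn_if abs_if)
    moreover have "coprime (l - k * m) m" using less.prems
      by (metis add.commute add_diff_cancel_left' coprime_iff_gcd_eq_1 diff_add_cancel gcd_add_mult gcd.commute)
    ultimately obtain f where f: "aut f" "\<And>u. eb (f u) = (l - k * m) * ea u + m * eb u"
      using less.hyps[of "l - k * m" m] by auto
    show ?thesis
      by (intro exI[of _ "f \<circ> sub (ga + zmul k gb) gb"])
        (simp add: aut_comp f aut_elementary2 exponent_hom[OF ghom_sub] algebra_simps)
  next
    case 4
    define k where "k = sgn l * sgn m"
    have "nat (\<bar>l\<bar> + \<bar>m - k * l\<bar>) < nat (\<bar>l\<bar> + \<bar>m\<bar>)"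
      using 4 by (auto simp: k_def sgn_if abs_if)
    moreover have "coprime l (m - k * l)" using less.prems
      by (metis add.commute add_diff_cancel_left' coprime_iff_gcd_eq_1 diff_add_cancel gcd_add_mult)
    ultimately obtain f where f: "aut f" "\<And>u. eb (f u) = l * ea u + (m - k * l) * eb u"
      using less.hyps[of l "m - k * l"] by auto
    show ?thesis
      by (intro exI[of _ "f \<circ> sub ga (gb + zmul k ga)"])
        (simp add: aut_comp f aut_elementary exponent_hom[OF ghom_sub] algebra_simps)
  qed
qed

text \<open>Eigenvectors come with integer entries that may have a common factor; d is that
  factor.\<close>

lemma aut_with_row_multiple:
  assumes "x \<noteq> 0 \<or> y \<noteq> (0 :: int)"
  shows "\<exists>f d. aut f \<and> d \<noteq> 0 \<and> (\<forall>u. d * eb (f u) = x * ea u + y * eb u)"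
proof -
  obtain l m where lm: "x = gcd x y * l" "y = gcd x y * m" "coprime l m"
    using assms gcd_coprime_exists[of x y] by (metis gcd_eq_0_iff mult.commute)
  then obtain f where "aut f" "\<And>u. eb (f u) = l * ea u + m * eb u" using aut_with_row by blast
  then have "gcd x y * eb (f u) = x * ea u + y * eb u" for u
    using lm(1,2) by (metis distrib_left mult.assoc)
  then show ?thesis using \<open>aut f\<close> assms by (metis gcd_eq_0_iff)
qed

text \<open>Taking a row eigenvector for -1 as the new exponent of b makes the matrix triangular
  with diagonal 1, -1. Conjugation by shears changes the remaining entry by even numbers: if it is
  even the matrix becomes a reflection, if it is odd an exchange of two basis elements.\<close>

lemma nafix_det_minus_one:
  assumes f: "aut f" "nafix f" and d: "dt f = - 1" "tr f = 0"
  shows False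
proof -
  define p q r where "p = ea (f ga)" and "q = ea (f gb)" and "r = eb (f ga)"
  have s: "eb (f gb) = - p" using d(2) by (simp add: tr_def p_def)
  have pq: "p * p + q * r = 1"
    using d(1) s by (simp add: dt_def p_def[symmetric] q_def[symmetric] r_def[symmetric])
  \<comment> \<open>The row vector (x, y) is an eigenvector for -1. The generic solution (r, - (p +
    1)) degenerates when r = 0 and p = -1.\<close>
  obtain x y where xy: "x \<noteq> 0 \<or> y \<noteq> 0" "x * p + y * r = - x" "x * q + y * - p = - y"
  proof (cases "r = 0 \<and> p = - 1")
    case True
    then show ?thesis using that[of 2 "- q"] by simp
  next
    case False
    have "r * q + - (p + 1) * - p = p + 1" using pq by (simp add: algebra_simps)
    then show ?thesis using that[of r "- (p + 1)"] False by (auto simp: algebra_simps)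
  qed
  obtain h d where h: "aut h" "d \<noteq> 0" "\<And>u. d * eb (h u) = x * ea u + y * eb u"
    using aut_with_row_multiple[OF xy(1)] by blast
  define f1 where "f1 = h \<circ> f \<circ> finv h"
  have f1: "aut f1" "nafix f1"
    using f h by (auto simp: f1_def aut_comp aut_inv intro: nafix_transfer[of f h])
  have ef1: "eb (f1 u) = - eb u" for u
  proof -
    define v where "v = finv h u"
    have "d * eb (f1 u) = x * (ea v * p + eb v * q) + y * (ea v * r + eb v * - p)"
      by (simp add: f1_def h(3) v_def[symmetric] aut_exponent[OF f(1), of v] p_def[symmetric]
          q_def[symmetric] r_def[symmetric] s)
    also have "\<dots> = ea v * (x * p + y * r) + eb v * (x * q + y * - p)" by (simp add: algebra_simps)
    also have "\<dots> = - (d * eb (h v))" unfolding xy(2,3) h(3) by (simp add: algebra_simps)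
    finally have "d * eb (f1 u) = d * - eb u" using h(1) by (simp add: v_def)
    then show ?thesis using h(2) by (simp only: mult_cancel_left) simp
  qed
  have "dt f1 = dt h * dt f * dt (finv h)"
    unfolding f1_def using h(1) f(1) by (simp add: dt_comp aut_ghom aut_comp aut_inv)
  moreover have "dt h * dt (finv h) = 1" by (rule aut_dt_inv[OF h(1)])
  ultimately have "dt f1 = - 1" using d(1) by (simp add: mult.commute mult.left_commute)
  then have p1: "ea (f1 ga) = 1" by (simp add: dt_def ef1)
  \<comment> \<open>Conjugating by \<open>e k\<close> subtracts 2k from the entry above the
    diagonal, leaving 0 or 1.\<close>
  define k where "k = ea (f1 gb) div 2"
  define e where "e k = sub ga (gb + zmul k ga)" for k
  have e: "aut (e k)" for k by (simp add: e_def aut_elementary)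
  have ee: "e k (e (- k) u) = u" for k u
  proof -
    have "e k \<circ> e (- k) = id"
      by (rule ghom_ext2) (simp_all add: e_def ghom_comp ghom_sub ghom_id sub_simps
        ghom_zmul[OF ghom_sub] zmul_uminus add.assoc del: add_uminus_conv_diff)
    then show ?thesis by (metis comp_apply id_apply)
  qed
  define f2 where "f2 = e k \<circ> f1 \<circ> e (- k)"
  have f2: "aut f2" "nafix f2"
    using f1 e ee[of "- k"] by (auto simp: f2_def aut_comp intro: nafix_transfer[of f1 "e k"])
  have ex: "ea (e k u) = ea u + k * eb u" "eb (e k u) = eb u" for k u
    by (simp_all add: e_def exponent_hom[OF ghom_sub])
  have f2e: "ea (f2 ga) = 1" "eb (f2 ga) = 0" "ea (f2 gb) = ea (f1 gb) - 2 * k" "eb (f2 gb) = - 1"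
    by (simp_all add: f2_def ex ef1 aut_exponent[OF f1(1), of "e (- k) _"] p1)
  have "ea (f1 gb) - 2 * k = 0 \<or> ea (f1 gb) - 2 * k = 1" by (simp add: k_def) presburger
  then show False
  proof
    assume "ea (f1 gb) - 2 * k = 0"
    then show False using nafix_reflection[OF f2] f2e by simp
  next
    assume q1: "ea (f1 gb) - 2 * k = 1"
    \<comment> \<open>On the abelianisation \<open>f2\<close> exchanges b and a - b; this is the
      basis to which \<beta> passes.\<close>
    define \<beta> \<gamma> where "\<beta> = sub gb (ga - gb)" and "\<gamma> = sub (gb + ga) ga"
    have "aut \<gamma>" unfolding \<gamma>_def
      by (rule aut_sub_inverse[of _ _ gb "ga - gb"]) (simp_all add: sub_simps)
    have gb: "\<gamma> (\<beta> u) = u" "\<beta> (\<gamma> u) = u" for u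
    proof -
      have "\<gamma> \<circ> \<beta> = id" "\<beta> \<circ> \<gamma> = id"
        by (rule ghom_ext2; simp add: \<beta>_def \<gamma>_def ghom_comp ghom_sub ghom_id sub_simps)+
      then show "\<gamma> (\<beta> u) = u" "\<beta> (\<gamma> u) = u" by (metis comp_apply id_apply)+
    qed
    have "aut \<beta>" by (rule autI[of _ \<gamma>]) (simp_all add: gb, simp add: \<beta>_def ghom_sub)
    define f3 where "f3 = \<gamma> \<circ> f2 \<circ> \<beta>"
    have f3: "aut f3" "nafix f3"
      using f2 \<open>aut \<gamma>\<close> \<open>aut \<beta>\<close> gb by (auto simp: f3_def aut_comp intro: nafix_transfer[of f2 \<gamma>])
    have ex: "ea (\<gamma> u) = ea u + eb u" "eb (\<gamma> u) = ea u" for u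
      by (simp_all add: \<gamma>_def exponent_hom[OF ghom_sub])
    show False
      by (rule nafix_swap[OF f3])
        (simp_all add: f3_def ex \<beta>_def aut_exponent[OF f2(1), of "ga - gb"] f2e q1)
  qed
qed


section \<open>Automorphisms of order three on the abelianisation\<close>

text \<open>Sanov's representation: the congruence subgroup generated by
  \<open>[[1, 2], [0, 1]]\<close> and \<open>[[1, 0], [-2, 1]]\<close> is normalised by an element of order three
  of \<open>SL\<^sub>2(\<int>)\<close>, so that a fixed element commutes with a non-scalar matrix up to sign.\<close>

type_synonym mat = "int \<times> int \<times> int \<times> int"

fun mm :: "mat \<Rightarrow> mat \<Rightarrow> mat" where
  "mm (a, b, c, d) (a', b', c', d') = (a * a' + b * c', a * b' + b * d', c * a' + d * c', c * b' + d * d')"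

fun smul :: "int \<Rightarrow> mat \<Rightarrow> mat" where
  "smul k (a, b, c, d) = (k * a, k * b, k * c, k * d)"

fun mv :: "mat \<Rightarrow> int \<times> int \<Rightarrow> int \<times> int" where
  "mv (a, b, c, d) (x, y) = (a * x + b * y, c * x + d * y)"

lemma mm_assoc: "mm (mm X Y) Z = mm X (mm Y Z)"
  by (cases X; cases Y; cases Z) (simp add: algebra_simps)

lemma mm_smul: "mm (smul k X) Y = smul k (mm X Y)" "mm X (smul k Y) = smul k (mm X Y)"
  by (cases X; cases Y; simp add: algebra_simps)+

lemma smul_smul: "smul k (smul l X) = smul (k * l) X" "smul 1 X = X"
  by (cases X; simp add: algebra_simps)+

lemma mm_one [simp]: "mm (1, 0, 0, 1) X = X" "mm X (1, 0, 0, 1) = X"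
  by (cases X; simp)+

lemma mv_mm: "mv (mm X Y) v = mv X (mv Y v)"
  by (cases X; cases Y; cases v) (simp add: algebra_simps)

text \<open>The commutant of a non-scalar 2 by 2 matrix is spanned by it and the identity. With x3
  as denominator, the two off-diagonal entries and the difference of the diagonal entries of Y, and
  likewise of Z, are proportional to those of X.\<close>

lemma commutant_abelian:
  assumes "mm Y X = mm X Y" "mm Z X = mm X Z" "fst (snd (snd X)) \<noteq> 0"
  shows "mm Y Z = mm Z Y"
proof -
  obtain x1 x2 x3 x4 y1 y2 y3 y4 z1 z2 z3 z4 where
    m: "X = (x1, x2, x3, x4)" "Y = (y1, y2, y3, y4)" "Z = (z1, z2, z3, z4)"
    by (metis prod_cases4)
  have x3: "x3 \<noteq> 0" using assms(3) m by simp
  have *: "v2 * x3 = x2 * v3 \<and> (v4 - v1) * x3 = (x4 - x1) * v3"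
    if "mm (v1, v2, v3, v4) X = mm X (v1, v2, v3, v4)" for v1 v2 v3 v4
  proof -
    from that have "v1 * x1 + v2 * x3 = x1 * v1 + x2 * v3" "v3 * x1 + v4 * x3 = x3 * v1 + x4 * v3"
      unfolding m mm.simps prod.inject by blast+
    then show ?thesis
      using mult.commute[of v1 x1] mult.commute[of v1 x3] mult.commute[of v3 x1]
      by (simp only: left_diff_distrib) linarith
  qed
  have y: "y2 * x3 = x2 * y3" "(y4 - y1) * x3 = (x4 - x1) * y3"
    and z: "z2 * x3 = x2 * z3" "(z4 - z1) * x3 = (x4 - x1) * z3"
    using *[of y1 y2 y3 y4] *[of z1 z2 z3 z4] assms(1,2) unfolding m by blast+
  have "(y2 * z3) * x3 = (y2 * x3) * z3" by (simp only: mult.assoc mult.commute mult.left_commute)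
  also have "\<dots> = (x2 * y3) * z3" by (simp only: y)
  also have "\<dots> = (x2 * z3) * y3" by (simp only: mult.assoc mult.commute mult.left_commute)
  also have "\<dots> = (z2 * x3) * y3" by (simp only: z)
  also have "\<dots> = (y3 * z2) * x3" by (simp only: mult.assoc mult.commute mult.left_commute)
  finally have 1: "y2 * z3 = y3 * z2" using x3 by simp
  have "((y4 - y1) * z3) * x3 = ((y4 - y1) * x3) * z3" by (simp only: mult.assoc mult.commute mult.left_commute)
  also have "\<dots> = ((x4 - x1) * y3) * z3" by (simp only: y)
  also have "\<dots> = ((x4 - x1) * z3) * y3" by (simp only: mult.assoc mult.commute mult.left_commute)
  also have "\<dots> = ((z4 - z1) * x3) * y3" by (simp only: z)
  also have "\<dots> = ((z4 - z1) * y3) * x3" by (simp only: mult.assoc mult.commute mult.left_commute)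
  finally have 2: "(y4 - y1) * z3 = (z4 - z1) * y3" using x3 by simp
  have "((y4 - y1) * z2) * (x3 * x3) = ((y4 - y1) * x3) * (z2 * x3)" by (simp only: mult.assoc mult.commute mult.left_commute)
  also have "\<dots> = ((x4 - x1) * y3) * (x2 * z3)" by (simp only: y z)
  also have "\<dots> = ((x4 - x1) * z3) * (x2 * y3)" by (simp only: mult.assoc mult.commute mult.left_commute)
  also have "\<dots> = ((z4 - z1) * x3) * (y2 * x3)" by (simp only: y z)
  also have "\<dots> = ((z4 - z1) * y2) * (x3 * x3)" by (simp only: mult.assoc mult.commute mult.left_commute)
  finally have 3: "(y4 - y1) * z2 = (z4 - z1) * y2" using x3 by simp
  show ?thesis using 1 2 3 by (simp add: m algebra_simps)
qed

section \<open>Sanov's matrices and the ping-pong argument\<close>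

fun sanov_letter :: "gen letter \<Rightarrow> mat" where
  "sanov_letter (Gen_a, True) = (1, 2, 0, 1)"
| "sanov_letter (Gen_a, False) = (1, -2, 0, 1)"
| "sanov_letter (Gen_b, True) = (1, 0, -2, 1)"
| "sanov_letter (Gen_b, False) = (1, 0, 2, 1)"

definition sanov :: "gen fg \<Rightarrow> mat" where
  "sanov u = foldr (\<lambda>l. mm (sanov_letter l)) (wd u) (1, 0, 0, 1)"

lemma sanov_plus: "sanov (u + v) = mm (sanov u) (sanov v)"
proof -
  have *: "mm (sanov_letter (letter_inv l)) (mm (sanov_letter l) s) = s" for l s
    by (cases l rule: sanov_letter.cases; cases s) (simp_all add: letter_inv_def)
  have "foldr (\<lambda>l. mm (sanov_letter l)) w s = mm (foldr (\<lambda>l. mm (sanov_letter l)) w (1, 0, 0, 1)) s" for w s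
    by (induction w) (simp_all add: mm_assoc)
  then show ?thesis
    unfolding sanov_def using foldr_wd_plus[of "\<lambda>l. mm (sanov_letter l)", OF *] by metis
qed

lemma sanov_zero [simp]: "sanov 0 = (1, 0, 0, 1)"
  by (simp add: sanov_def)

lemma sanov_gen [simp]: "sanov ga = (1, 2, 0, 1)" "sanov (- ga) = (1, -2, 0, 1)"
  "sanov gb = (1, 0, -2, 1)" "sanov (- gb) = (1, 0, 2, 1)"
  by (simp_all add: sanov_def)

lemma sanov_parity:
  "\<exists>a b c d. sanov u = (2 * a + 1, 2 * b, 2 * c, 2 * d + 1)"
proof -
  have "\<exists>a b c d. sanov (h + u) = (2 * a + 1, 2 * b, 2 * c, 2 * d + 1)"
    if h: "h \<in> {ga, - ga, gb, - gb}" and u: "\<exists>a b c d. sanov u = (2 * a + 1, 2 * b, 2 * c, 2 * d + 1)" for h u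
  proof -
    obtain a b c d where "sanov u = (2 * a + 1, 2 * b, 2 * c, 2 * d + 1)" using u by blast
    then have "sanov (ga + u) = (2 * (a + 2 * c) + 1, 2 * (b + 2 * d + 1), 2 * c, 2 * d + 1)"
      "sanov (- ga + u) = (2 * (a - 2 * c) + 1, 2 * (b - 2 * d - 1), 2 * c, 2 * d + 1)"
      "sanov (gb + u) = (2 * a + 1, 2 * b, 2 * (c - 2 * a - 1), 2 * (d - 2 * b) + 1)"
      "sanov (- gb + u) = (2 * a + 1, 2 * b, 2 * (c + 2 * a + 1), 2 * (d + 2 * b) + 1)"
      by (simp_all add: sanov_plus)
    then show ?thesis using h by blast
  qed
  moreover have "gen i \<in> {ga, - ga, gb, - gb}" "- gen i \<in> {ga, - ga, gb, - gb}" for i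
    by (cases i; simp)+
  ultimately show ?thesis
    by (induction u rule: fg_induct) (auto intro!: exI[of _ 0])
qed

text \<open>Ping-pong domains: four disjoint double cones in the plane. The matrix of a letter sends
  every cone except that of the inverse letter into the cone of the letter.\<close>

fun region :: "gen letter \<Rightarrow> int \<times> int \<Rightarrow> bool" where
  "region (Gen_a, True) (x, y) \<longleftrightarrow> 0 < y \<and> y < x \<or> x < y \<and> y < 0"
| "region (Gen_a, False) (x, y) \<longleftrightarrow> 0 < y \<and> x < - y \<or> y < 0 \<and> - y < x"
| "region (Gen_b, True) (x, y) \<longleftrightarrow> 0 < x \<and> y < - x \<or> x < 0 \<and> - x < y"
| "region (Gen_b, False) (x, y) \<longleftrightarrow> 0 < x \<and> x < y \<or> y < x \<and> x < 0"

lemma region_step: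
  "region k v \<Longrightarrow> k \<noteq> letter_inv l \<Longrightarrow> region l (mv (sanov_letter l) v)"
  by (cases k rule: sanov_letter.cases; cases l rule: sanov_letter.cases; cases v)
    (auto simp: letter_inv_def)

lemma region_disjoint: "region k v \<Longrightarrow> region l v \<Longrightarrow> k = l"
  by (cases k rule: sanov_letter.cases; cases l rule: sanov_letter.cases; cases v) auto

lemma region_word:
  assumes "reduced w" "w \<noteq> []" "region k v" "k \<noteq> letter_inv (last w)"
  shows "region (hd w) (mv (foldr (\<lambda>l. mm (sanov_letter l)) w (1, 0, 0, 1)) v)"
  using assms(1,2,4)
proof (induction w rule: reduced.induct)
  case (2 l)
  then show ?case using region_step[OF assms(3), of l] by simp
next
  case (3 l m w)
  then have "region m (mv (foldr (\<lambda>l. mm (sanov_letter l)) (m # w) (1, 0, 0, 1)) v)" by simp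
  from region_step[OF this, of l] 3 show ?case by (simp add: mv_mm)
qed simp

text \<open>Start in a cone that belongs neither to the first letter nor to the inverse of the last
  one; two letters can always be avoided. The word moves a point of it into the cone of the first
  letter, which the identity matrix cannot do.\<close>

lemma sanov_faithful:
  assumes "sanov u = (1, 0, 0, 1)"
  shows "u = 0"
proof (rule ccontr)
  assume "u \<noteq> 0"
  define w where "w = wd u"
  have w: "reduced w" "w \<noteq> []" using \<open>u \<noteq> 0\<close> by (simp_all add: w_def)
  have "\<exists>k. k \<noteq> m \<and> k \<noteq> n" for m n :: "gen letter"
  proof -
    have "card {m, n} \<le> 2" by (simp add: card_insert_if)
    moreover have "card {(Gen_a, True), (Gen_a, False), (Gen_b, True)} = 3" by simp
    ultimately have "\<not> {(Gen_a, True), (Gen_a, False), (Gen_b, True)} \<subseteq> {m, n}"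
      using card_mono[of "{m, n}" "{(Gen_a, True), (Gen_a, False), (Gen_b, True)}"] by auto
    then show ?thesis by blast
  qed
  then obtain k where k: "k \<noteq> letter_inv (last w)" "k \<noteq> hd w" by blast
  have "\<exists>v. region k v"
  proof -
    have "region (Gen_a, True) (2, 1)" "region (Gen_a, False) (- 2, 1)"
      "region (Gen_b, True) (- 1, 2)" "region (Gen_b, False) (1, 2)" by simp_all
    then show ?thesis by (cases k rule: sanov_letter.cases) blast+
  qed
  then obtain v where v: "region k v" by blast
  have "region (hd w) (mv (1, 0, 0, 1) v)"
    using region_word[OF w v k(1)] assms by (simp add: sanov_def w_def)
  moreover have "mv (1, 0, 0, 1) v = v" by (cases v) simp
  ultimately show False using region_disjoint[OF v] k(2) by simp
qed

lemma sanov_inject: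
  assumes "sanov u = sanov v"
  shows "u = v"
proof -
  have "sanov (- v + u) = (1, 0, 0, 1)"
    by (metis assms left_minus sanov_plus sanov_zero)
  then show ?thesis by (metis sanov_faithful add_minus_cancel add.right_neutral)
qed

text \<open>An automorphism of order three, permuting a, b and - b - a cyclically.\<close>

definition rot :: "gen fg \<Rightarrow> gen fg" where
  "rot = sub gb (- gb - ga)"

lemma aut_rot: "aut rot"
  unfolding rot_def
  by (rule aut_sub_inverse[of _ _ "- gb - ga" ga])
    (simp_all add: sub_simps group_simps del: add_uminus_conv_diff)

text \<open>Modulo signs, conjugation by an element of order three of SL_2(Z) realises
  \<open>rot\<close>. The sign is unavoidable: this conjugation takes the matrix of b to minus the
  matrix of - b - a.\<close>

lemma sanov_rot:
  "\<exists>e. e * e = 1 \<and> mm (sanov (rot u)) (0, -1, 1, -1) = smul e (mm (0, -1, 1, -1) (sanov u))"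
proof -
  let ?S = "(0, -1, 1, -1) :: mat"
  let ?P = "\<lambda>u. \<exists>e. e * e = 1 \<and> mm (sanov (rot u)) ?S = smul e (mm ?S (sanov u))"
  have step: "?P (h + u)" if hu: "?P h" "?P u" for h u
  proof -
    obtain e e' where e: "e * e = 1" "mm (sanov (rot h)) ?S = smul e (mm ?S (sanov h))"
      "e' * e' = 1" "mm (sanov (rot u)) ?S = smul e' (mm ?S (sanov u))" using hu by blast
    have "mm (sanov (rot (h + u))) ?S = mm (sanov (rot h)) (mm (sanov (rot u)) ?S)"
      by (simp add: ghom_plus[OF aut_ghom[OF aut_rot]] sanov_plus mm_assoc)
    also have "\<dots> = smul e' (mm (mm (sanov (rot h)) ?S) (sanov u))"
      unfolding e(4) mm_smul by (simp only: mm_assoc)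
    also have "\<dots> = smul (e' * e) (mm ?S (sanov (h + u)))"
      unfolding e(2) mm_smul smul_smul sanov_plus by (simp only: mm_assoc)
    finally show ?thesis using e(1,3) by (intro exI[of _ "e' * e"]) (simp add: algebra_simps)
  qed
  have r: "rot ga = gb" "rot gb = - gb - ga" "rot (- ga) = - gb" "rot (- gb) = ga + gb"
    by (simp_all add: rot_def sub_simps)
  have "?P ga" "?P (- ga)" by (intro exI[of _ 1]; simp add: r)+
  moreover have "?P gb" by (intro exI[of _ "- 1"]) (simp add: r sanov_plus diff_conv_add_uminus del: add_uminus_conv_diff)
  moreover have "?P (- gb)" by (intro exI[of _ "- 1"]) (simp add: r sanov_plus)
  ultimately have "?P (gen i)" "?P (- gen i)" for i by (cases i; blast)+
  moreover have "?P 0" by (intro exI[of _ 1]) (simp add: ghom_zero[OF aut_ghom[OF aut_rot]])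
  ultimately show ?thesis by (induction u rule: fg_induct) (blast intro: step)+
qed

lemma nafix_rot_exponents:
  assumes f: "aut f" "nafix f" and e: "ea (f ga) = 0" "eb (f ga) = 1" "ea (f gb) = - 1" "eb (f gb) = - 1"
  shows False
proof -
  let ?S = "(0, -1, 1, -1) :: mat"
  have "ea (rot ga) = 0" "eb (rot ga) = 1" "ea (rot gb) = - 1" "eb (rot gb) = - 1"
    by (simp_all add: rot_def)
  then obtain g where g: "f = conj g \<circ> rot" using same_exponents_inner[OF f(1) aut_rot] e by auto
  define X where "X = mm (sanov g) ?S"
  \<comment> \<open>This entry of X equals the lower right entry of \<open>sanov g\<close>, which is
    odd.\<close>
  have X: "fst (snd (snd X)) \<noteq> 0"
    using sanov_parity[of g] by (auto simp: X_def) presburger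
  \<comment> \<open>Passing to \<open>u + u\<close> squares the sign away.\<close>
  have comm: "mm (sanov (u + u)) X = mm X (sanov (u + u))" if u: "f u = u" for u
  proof -
    obtain e where e: "e * e = 1" "mm (sanov (rot u)) ?S = smul e (mm ?S (sanov u))"
      using sanov_rot by blast
    have "u + g = g + rot u" using u by (simp add: g conj_def diff_eq_eq)
    then have "mm (sanov u) (sanov g) = mm (sanov g) (sanov (rot u))" by (metis sanov_plus)
    then have "mm (sanov u) X = mm (sanov g) (mm (sanov (rot u)) ?S)"
      by (simp only: X_def mm_assoc[symmetric])
    also have "\<dots> = smul e (mm X (sanov u))" by (simp only: e(2) mm_smul X_def mm_assoc)
    finally have *: "mm (sanov u) X = smul e (mm X (sanov u))" .
    have "mm (sanov (u + u)) X = mm (sanov u) (smul e (mm X (sanov u)))"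
      by (simp only: sanov_plus mm_assoc *)
    also have "\<dots> = smul e (mm (smul e (mm X (sanov u))) (sanov u))"
      by (simp only: mm_smul mm_assoc[symmetric] *)
    also have "\<dots> = mm X (sanov (u + u))"
      by (simp only: mm_smul smul_smul e(1) sanov_plus mm_assoc)
    finally show ?thesis .
  qed
  obtain u v where uv: "f u = u" "f v = v" "u + v \<noteq> v + u" using f(2) by (auto simp: nafix_def)
  have "mm (sanov (u + u)) (sanov (v + v)) = mm (sanov (v + v)) (sanov (u + u))"
    by (rule commutant_abelian[OF comm comm X]) (use uv in auto)
  then have c: "(u + u) + (v + v) = (v + v) + (u + u)"
    by (metis sanov_inject sanov_plus)
  have nz: "u + u \<noteq> 0" "v + v \<noteq> 0"
    using uv(3) zmul_eq_0[of 2 u] zmul_eq_0[of 2 v] zmul_add[of 1 1 u] zmul_add[of 1 1 v] by auto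
  have "u + (v + v) = (v + v) + u"
    by (rule commute_trans[OF nz(1)]) (simp_all add: add.assoc c[unfolded add.assoc])
  then have "u + v = v + u"
    by (intro commute_trans[OF nz(2), of u v]) (simp_all add: add.assoc)
  then show False using uv(3) by simp
qed

text \<open>As in the reduction of quadratic forms of discriminant -3, elementary conjugations add
  multiples of q or r to p and so decrease the absolute value of 2p + 1. From - 4qr = (2p + 1)^2 +
  3, once neither q nor r is smaller in absolute value than 2p + 1, that value is 1. Four matrices
  remain, and exchanging or inverting letters turns each into the matrix of
  \<open>rot\<close>.\<close>

lemma nafix_trace_minus_one:
  assumes "aut f" "nafix f" "dt f = 1" "tr f = - 1"
  shows False
  using assms
proof (induction "nat \<bar>2 * ea (f ga) + 1\<bar>" arbitrary: f rule: less_induct)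
  case less
  note f = less.prems(1,2)
  define p q r where "p = ea (f ga)" and "q = ea (f gb)" and "r = eb (f ga)"
  have s: "eb (f gb) = - 1 - p" using less.prems(4) by (simp add: tr_def p_def)
  have pqr: "p * p + p + 1 + q * r = 0"
    using less.prems(3) s by (simp add: dt_def p_def[symmetric] q_def[symmetric] r_def[symmetric] algebra_simps)
  have conj_step: "dt (h \<circ> f \<circ> h') = 1 \<and> tr (h \<circ> f \<circ> h') = - 1 \<and> aut (h \<circ> f \<circ> h') \<and> nafix (h \<circ> f \<circ> h')"
    if h: "aut h" "aut h'" "\<And>x. h' (h x) = x" "\<And>x. h (h' x) = x" "tr (h \<circ> f \<circ> h') = - 1" for h h'
  proof -
    have "dt (h' \<circ> h) = 1" using h(3) by (simp add: dt_def)
    then have "dt h' * dt h = 1" using dt_comp aut_ghom h by metis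
    moreover have "dt (h \<circ> f \<circ> h') = dt h * dt f * dt h'"
      using h f by (simp add: dt_comp aut_ghom aut_comp)
    ultimately have "dt (h \<circ> f \<circ> h') = 1" using less.prems(3) by (simp add: mult.commute)
    moreover have "nafix (h \<circ> f \<circ> h')" by (rule nafix_transfer[OF f(2) h(1)]) (simp add: h(3))
    ultimately show ?thesis using h f by (simp add: aut_comp)
  qed
  define e1 e2 where "e1 k = sub ga (gb + zmul k ga)" and "e2 k = sub (ga + zmul k gb) gb" for k
  have e: "aut (e1 k)" "aut (e2 k)" for k by (simp_all add: e1_def e2_def aut_elementary aut_elementary2)
  have ee: "e1 k (e1 (- k) u) = u" "e2 k (e2 (- k) u) = u" for k u
  proof -
    have "e1 k \<circ> e1 (- k) = id" "e2 k \<circ> e2 (- k) = id"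
      by (rule ghom_ext2; simp add: e1_def e2_def ghom_comp ghom_sub ghom_id sub_simps
        ghom_zmul[OF ghom_sub] zmul_uminus add.assoc del: add_uminus_conv_diff)+
    then show "e1 k (e1 (- k) u) = u" "e2 k (e2 (- k) u) = u" by (metis comp_apply id_apply)+
  qed
  have ex: "ea (e1 k u) = ea u + k * eb u" "eb (e1 k u) = eb u"
    "eb (e2 k u) = eb u + k * ea u" "ea (e2 k u) = ea u" for k u
    by (simp_all add: e1_def e2_def exponent_hom[OF ghom_sub])
  have fx: "ea (f u) = ea u * p + eb u * q" "eb (f u) = ea u * r + eb u * (- 1 - p)" for u
    using aut_exponent[OF f(1), of u] s by (simp_all add: p_def q_def r_def)
  have qr: "q \<noteq> 0" "r \<noteq> 0"
  proof -
    have "p * p + p + 1 \<noteq> 0"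
    proof
      assume "p * p + p + 1 = 0"
      then have "p * (p + 1) = - 1" by (simp add: algebra_simps)
      then have "even (- 1 :: int)" by (metis even_mult_iff even_plus_one_iff)
      then show False by simp
    qed
    then show "q \<noteq> 0" "r \<noteq> 0" using pqr by auto
  qed
  have dec: "\<exists>k. nat \<bar>2 * (p + k * z) + 1\<bar> < nat \<bar>2 * p + 1\<bar>" if "z \<noteq> 0" "\<bar>z\<bar> < \<bar>2 * p + 1\<bar>" for z
  proof (cases "(0 < z) = (0 < 2 * p + 1)")
    case True
    then show ?thesis using that by (intro exI[of _ "- 1"]) (auto simp: abs_if split: if_splits)
  next
    case False
    then show ?thesis using that by (intro exI[of _ 1]) (auto simp: abs_if split: if_splits)
  qed
  consider "\<bar>r\<bar> < \<bar>2 * p + 1\<bar>" | "\<bar>q\<bar> < \<bar>2 * p + 1\<bar>" | "\<bar>2 * p + 1\<bar> \<le> \<bar>r\<bar>" "\<bar>2 * p + 1\<bar> \<le> \<bar>q\<bar>" by linarith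
  then show False
  proof cases
    case 1
    then obtain k where k: "nat \<bar>2 * (p + k * r) + 1\<bar> < nat \<bar>2 * p + 1\<bar>" using dec qr by blast
    define F where "F = e1 k \<circ> f \<circ> e1 (- k)"
    have "tr F = - 1" by (simp add: tr_def F_def ex fx algebra_simps)
    then have F: "dt F = 1 \<and> tr F = - 1 \<and> aut F \<and> nafix F"
      unfolding F_def using e ee[of "- k"] ee[of k] by (intro conj_step) simp_all
    have "ea (F ga) = p + k * r" by (simp add: F_def ex fx)
    then show False using less.hyps[of F] k F by (simp add: p_def)
  next
    case 2
    then obtain k where k: "nat \<bar>2 * (p + k * q) + 1\<bar> < nat \<bar>2 * p + 1\<bar>" using dec qr by blast
    define F where "F = e2 (- k) \<circ> f \<circ> e2 k"
    have "tr F = - 1" by (simp add: tr_def F_def ex fx algebra_simps)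
    then have F: "dt F = 1 \<and> tr F = - 1 \<and> aut F \<and> nafix F"
      unfolding F_def using e ee[of "- k"] ee[of k] by (intro conj_step) simp_all
    have "ea (F ga) = p + k * q" by (simp add: F_def ex fx)
    then show False using less.hyps[of F] k F by (simp add: p_def)
  next
    case 3
    define t where "t = \<bar>2 * p + 1\<bar>"
    have t: "1 \<le> t" unfolding t_def by presburger
    have "\<bar>q\<bar> * \<bar>r\<bar> \<ge> t * t" using 3 t by (intro mult_mono) (simp_all add: t_def)
    moreover have "q * r < 0"
    proof -
      have "0 \<le> 4 * (p * p) + 4 * p + 1"
        using zero_le_square[of "2 * p + 1"] by (simp add: algebra_simps)
      then have "0 < p * p + p + 1" by linarith
      then show ?thesis using pqr by linarith
    qed
    ultimately have "t * t \<le> - (q * r)" by (simp add: abs_mult[symmetric])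
    moreover have "4 * (- (q * r)) = t * t + 3"
      using pqr by (simp add: t_def abs_mult_self_eq algebra_simps)
    ultimately have tt: "t * t \<le> 1" "4 * (- (q * r)) = t * t + 3" by linarith+
    then have "t = 1" using t mult_mono[of 2 t 2 t] by (cases "t \<ge> 2") auto
    then have p: "p = 0 \<or> p = - 1" and "q * r = - 1" using tt(2) by (auto simp: t_def)
    then have qr1: "q = 1 \<and> r = - 1 \<or> q = - 1 \<and> r = 1"
      using zmult_eq_1_iff[of q "- r"] by auto
    define sw ng where "sw = sub gb ga" and "ng = sub ga (- gb)"
    have sn: "aut sw" "aut ng" "sw (sw u) = u" "ng (ng u) = u" for u
    proof -
      have "sw \<circ> sw = id" "ng \<circ> ng = id"
        by (rule ghom_ext2; simp add: sw_def ng_def ghom_comp ghom_sub ghom_id sub_simps)+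
      then show "sw (sw u) = u" "ng (ng u) = u" by (metis comp_apply id_apply)+
    qed (simp_all add: sw_def ng_def aut_elementary)
    have snx: "ea (sw u) = eb u" "eb (sw u) = ea u" "ea (ng u) = ea u" "eb (ng u) = - eb u" for u
      by (simp_all add: sw_def ng_def exponent_hom[OF ghom_sub])
    have *: "aut (h \<circ> f \<circ> h)" "nafix (h \<circ> f \<circ> h)" if "aut h" "\<And>u. h (h u) = u" for h
      using that f by (auto simp: aut_comp intro: nafix_transfer[OF f(2) that(1)])
    have **: "aut (ng \<circ> (sw \<circ> f \<circ> sw) \<circ> ng)" "nafix (ng \<circ> (sw \<circ> f \<circ> sw) \<circ> ng)"
      using *[OF sn(1,3)] sn by (auto simp: aut_comp intro: nafix_transfer[OF *(2)[OF sn(1,3)] sn(2)])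
    consider "p = 0" "q = - 1" "r = 1" | "p = 0" "q = 1" "r = - 1" | "p = - 1" "q = 1" "r = - 1" | "p = - 1" "q = - 1" "r = 1"
      using p qr1 by blast
    then show False
    proof cases
      case 1
      then show False using nafix_rot_exponents[OF f] s by (simp add: p_def q_def r_def)
    next
      case 2
      then show False using nafix_rot_exponents[OF *[OF sn(2,4)]] by (simp add: snx fx)
    next
      case 3
      then show False using nafix_rot_exponents[OF *[OF sn(1,3)]] by (simp add: snx fx)
    next
      case 4
      then show False using nafix_rot_exponents[OF **] by (simp add: snx fx)
    qed
  qed
qed


section \<open>The commutator subgroup as a free group on the lattice\<close>

text \<open>A word in \<open>a\<close>, \<open>b\<close> is a path in the grid \<open>\<int>\<^sup>2\<close>, and the commutator subgroup is the fundamental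
  group of the grid. It is free on the unit squares joined to the origin along the comb formed by the
  horizontal axis and all vertical lines.\<close>

definition corner :: "int \<times> int \<Rightarrow> gen fg" where
  "corner v = zmul (fst v) ga + zmul (snd v) gb"

definition square :: "int \<times> int \<Rightarrow> gen fg" where
  "square v = conj (corner v) (com ga gb)"

definition squares :: "(int \<times> int) fg \<Rightarrow> gen fg" where
  "squares = lift square"

primrec edge_up :: "int \<Rightarrow> nat \<Rightarrow> (int \<times> int) fg" where
  "edge_up i 0 = 0"
| "edge_up i (Suc n) = - gen (i, int n) + edge_up i n"

primrec edge_down :: "int \<Rightarrow> nat \<Rightarrow> (int \<times> int) fg" where
  "edge_down i 0 = 0"
| "edge_down i (Suc n) = gen (i, - int n - 1) + edge_down i n"

text \<open>The class of the horizontal edge from (i, j) to (i + 1, j), closed up along the comb, as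
  a product of the squares between it and the axis. Edges of the comb itself contribute
  nothing.\<close>

definition edge :: "int \<Rightarrow> int \<Rightarrow> (int \<times> int) fg" where
  "edge i j = (if 0 \<le> j then edge_up i (nat j) else edge_down i (nat (- j)))"

lemma edge_0 [simp]: "edge i 0 = 0"
  by (simp add: edge_def)

lemma edge_step: "gen (i, j) = edge i j - edge i (j + 1)"
proof (cases "0 \<le> j")
  case True
  then have "edge i (j + 1) = - gen (i, j) + edge i j"
    by (simp add: edge_def nat_add_distrib)
  then show ?thesis by (simp add: group_simps del: add_uminus_conv_diff)
next
  case False
  then obtain n where n: "j = - int (Suc n)"
    using False by (cases j rule: int_cases) auto
  have "nat (- j) = Suc n" "nat (- (j + 1)) = n" using n by simp_all
  then have *: "edge i j = edge_down i (Suc n)" "edge i (j + 1) = edge_down i n"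
    using n by (cases "n = 0"; simp add: edge_def)+
  have "- int n - 1 = j" using n by simp
  moreover have "edge i j = gen (i, - int n - 1) + edge i (j + 1)"
    by (simp only: * edge_down.simps)
  ultimately have "edge i j = gen (i, j) + edge i (j + 1)" by (simp only:)
  then show ?thesis by (simp add: group_simps del: add_uminus_conv_diff)
qed

lemma ghom_squares: "ghom squares"
  by (simp add: squares_def ghom_lift)

lemmas squares_simps = ghom_simps[OF ghom_squares]

lemma squares_gen [simp]: "squares (gen v) = square v"
  by (simp add: squares_def)

lemma corner_up: "corner (i, j + 1) = corner (i, j) + gb"
  using zmul_add[of j 1 gb] by (simp add: corner_def add.assoc)

lemma corner_axis: "corner (i + 1, 0) = corner (i, 0) + ga"
  using zmul_add[of i 1 ga] by (simp add: corner_def)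

lemma squares_edge_Suc:
  "squares (edge i j) = corner (i, j) + ga - corner (i + 1, j) \<longleftrightarrow>
    squares (edge i (j + 1)) = corner (i, j + 1) + ga - corner (i + 1, j + 1)"
proof -
  have "square (i, j) = (corner (i, j) + ga - corner (i + 1, j)) - (corner (i, j + 1) + ga - corner (i + 1, j + 1))"
    by (simp add: square_def conj_def com_def corner_up group_simps del: add_uminus_conv_diff)
  moreover have "square (i, j) = squares (edge i j) - squares (edge i (j + 1))"
    by (metis edge_step squares_gen squares_simps(4))
  ultimately have "squares (edge i j) - squares (edge i (j + 1)) =
    (corner (i, j) + ga - corner (i + 1, j)) - (corner (i, j + 1) + ga - corner (i + 1, j + 1))" by simp
  moreover have "x - y = x' - y' \<Longrightarrow> (x = x') = (y = y')" for x y x' y' :: "gen fg"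
    by (metis diff_add_cancel diff_eq_eq eq_diff_eq right_minus_eq add_left_cancel diff_conv_add_uminus neg_equal_iff_equal)
  ultimately show ?thesis by blast
qed

lemma squares_edge: "squares (edge i j) = corner (i, j) + ga - corner (i + 1, j)"
proof (induction j rule: int_induct[of _ 0])
  case base
  show ?case by (simp add: corner_axis squares_simps)
next
  case (step1 j)
  then show ?case using squares_edge_Suc by blast
next
  case (step2 j)
  then show ?case using squares_edge_Suc[of i "j - 1"] by simp
qed

section \<open>Rewriting a word while walking along its path\<close>

type_synonym path_state = "(int \<times> int) fg \<times> int \<times> int"

fun read_letter :: "gen letter \<Rightarrow> path_state \<Rightarrow> path_state" where
  "read_letter (Gen_a, True) (X, i, j) = (X + edge i j, i + 1, j)"
| "read_letter (Gen_a, False) (X, i, j) = (X - edge (i - 1) j, i - 1, j)"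
| "read_letter (Gen_b, True) (X, i, j) = (X, i, j + 1)"
| "read_letter (Gen_b, False) (X, i, j) = (X, i, j - 1)"

text \<open>Since \<open>foldr\<close> starts with the last letter, running it on the inverse with
  inverted letters reads x from left to right and keeps \<open>foldr_wd_plus\<close>
  applicable.\<close>

definition read :: "gen fg \<Rightarrow> path_state \<Rightarrow> path_state" where
  "read x s = foldr (\<lambda>l. read_letter (letter_inv l)) (wd (- x)) s"

lemma read_plus: "read (x + y) s = read y (read x s)"
proof -
  have *: "read_letter (letter_inv (letter_inv l)) (read_letter (letter_inv l) s) = s" for l s
    by (cases l rule: sanov_letter.cases; cases s) (simp_all add: letter_inv_def)
  show ?thesis
    unfolding read_def minus_add
    by (rule foldr_wd_plus[of "\<lambda>l. read_letter (letter_inv l)", OF *])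
qed

lemma read_zero [simp]: "read 0 s = s"
  by (simp add: read_def)

lemma read_gen [simp]: "read ga s = read_letter (Gen_a, True) s" "read (- ga) s = read_letter (Gen_a, False) s"
  "read gb s = read_letter (Gen_b, True) s" "read (- gb) s = read_letter (Gen_b, False) s"
  by (simp_all add: read_def letter_inv_def)

lemma read_induct:
  assumes "\<And>s. P 0 s" "\<And>l x s. l \<in> {ga, - ga, gb, - gb} \<Longrightarrow> P x (read l s) \<Longrightarrow> P (l + x) s"
  shows "P x s"
proof (induction x arbitrary: s rule: fg_induct)
  case (gen i x)
  have "gen i \<in> {ga, - ga, gb, - gb}" by (cases i) simp_all
  then show ?case using assms(2) gen by blast
next
  case (neg i x)
  have "- gen i \<in> {ga, - ga, gb, - gb}" by (cases i) simp_all
  then show ?case using assms(2) neg by blast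
qed (rule assms(1))

lemma read_position: "snd (read x (X, i, j)) = (i + ea x, j + eb x)"
proof -
  have "snd (read x s) = (fst (snd s) + ea x, snd (snd s) + eb x)" for s
    by (induction x s rule: read_induct) (auto simp: read_plus split_paired_all)
  then show ?thesis by simp
qed

lemma read_translate: "fst (read x (X, p)) = X + fst (read x (0, p))"
proof -
  have "fst (read x (Y + fst s, snd s)) = Y + fst (read x s)" for s Y
  proof (induction x s rule: read_induct)
    case (2 l x s)
    obtain X i j where s: "s = (X, i, j)" by (cases s) auto
    have "read l (Y + fst s, snd s) = (Y + fst (read l s), snd (read l s))"
      using 2(1) by (auto simp: s add.assoc diff_conv_add_uminus simp del: add_uminus_conv_diff)
    then show ?case using 2(2) by (simp add: read_plus)
  qed simp
  from this[of X "(0, p)"] show ?thesis by simp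
qed

text \<open>The invariant of the walk: the squares recorded so far, followed by the comb path to the
  current position, spell what has been read.\<close>

lemma read_squares:
  "squares (fst (read x s)) + corner (snd (read x s)) = squares (fst s) + corner (snd s) + x"
proof (induction x s rule: read_induct)
  case (2 l x s)
  obtain X i j where s: "s = (X, i, j)" by (cases s) auto
  have "corner (i, j) = corner (i, j - 1) + gb" using corner_up[of i "j - 1"] by simp
  then have "squares (fst (read l s)) + corner (snd (read l s)) = squares (fst s) + corner (snd s) + l"
    using 2(1) corner_up[of i j] squares_edge[of "i - 1" j]
    by (auto simp: s squares_simps squares_edge group_simps simp del: add_uminus_conv_diff)
  then show ?case using 2(2) by (simp add: read_plus add.assoc)
qed simp

definition lattice_word :: "gen fg \<Rightarrow> (int \<times> int) fg" where
  "lattice_word x = fst (read x (0, 0, 0))"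

definition commutator_subgroup :: "gen fg set" where
  "commutator_subgroup = {x. ea x = 0 \<and> eb x = 0}"

lemma squares_lattice_word: "x \<in> commutator_subgroup \<Longrightarrow> squares (lattice_word x) = x"
  using read_squares[of x "(0, 0, 0)"] read_position[of x 0 0 0]
  by (simp add: lattice_word_def commutator_subgroup_def squares_simps corner_def)

lemma lattice_word_plus:
  assumes "x \<in> commutator_subgroup"
  shows "lattice_word (x + y) = lattice_word x + lattice_word y"
proof -
  have "read x (0, 0, 0) = (lattice_word x, 0, 0)"
    using read_position[of x 0 0 0] assms
    by (simp add: lattice_word_def commutator_subgroup_def prod_eq_iff)
  then show ?thesis
    using read_translate[of y "lattice_word x" "(0, 0)"]
    by (simp add: lattice_word_def read_plus)
qed

lemma lattice_word_zero [simp]: "lattice_word 0 = 0"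
  by (simp add: lattice_word_def)

lemma commutator_subgroup_closed:
  "0 \<in> commutator_subgroup" "x \<in> commutator_subgroup \<Longrightarrow> y \<in> commutator_subgroup \<Longrightarrow> x + y \<in> commutator_subgroup"
  "x \<in> commutator_subgroup \<Longrightarrow> - x \<in> commutator_subgroup" "x \<in> commutator_subgroup \<Longrightarrow> conj g x \<in> commutator_subgroup"
  by (simp_all add: commutator_subgroup_def)

lemma lattice_word_uminus:
  assumes "x \<in> commutator_subgroup"
  shows "lattice_word (- x) = - lattice_word x"
  using lattice_word_plus[of "- x" x] assms commutator_subgroup_closed(3)[OF assms]
  by (simp add: eq_neg_iff_add_eq_0)

lemma square_in_commutator_subgroup: "square v \<in> commutator_subgroup"
  by (simp add: commutator_subgroup_def square_def com_def)

lemma squares_in_commutator_subgroup: "squares X \<in> commutator_subgroup"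
  by (induction X rule: fg_induct)
    (simp_all add: squares_simps commutator_subgroup_closed square_in_commutator_subgroup
      del: add_uminus_conv_diff)

text \<open>The word of a square runs along the comb except for its two horizontal sides, whose
  edges differ by exactly one generator. Together with \<open>squares_lattice_word\<close> this
  shows that the squares are a free basis of the commutator subgroup.\<close>

lemma lattice_word_square: "lattice_word (square v) = gen v"
proof -
  obtain i j where v: "v = (i, j)" by (cases v)
  have axis: "read (zmul k ga) (X, m, 0) = (X, m + k, 0)" for k X m
  proof (induction k arbitrary: m rule: int_induct[of _ 0])
    case (step1 k)
    then show ?case by (simp add: zmul_succ read_plus)
  next
    case (step2 k)
    then show ?case by (simp add: zmul_pred read_plus del: add_uminus_conv_diff)
  qed simp
  have up: "read (zmul k gb) (X, m, n) = (X, m, n + k)" for k X m n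
  proof (induction k arbitrary: n rule: int_induct[of _ 0])
    case (step1 k)
    then show ?case by (simp add: zmul_succ read_plus)
  next
    case (step2 k)
    then show ?case by (simp add: zmul_pred read_plus del: add_uminus_conv_diff)
  qed simp
  have "square v = zmul i ga + (zmul j gb + (ga + (gb + (- ga + (- gb + (zmul (- j) gb + zmul (- i) ga))))))"
    by (simp add: square_def v corner_def conj_def com_def zmul_uminus group_simps del: add_uminus_conv_diff)
  then show ?thesis
    by (simp add: lattice_word_def read_plus axis up v edge_step[of i j] del: add_uminus_conv_diff)
qed

lemma lift_cong: "(\<And>l. l \<in> set (wd x) \<Longrightarrow> h (fst l) = h' (fst l)) \<Longrightarrow> lift h x = lift h' x"
  unfolding lift_def by (intro foldr_cong) auto

lemma lift_gen_id: "lift gen = id"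
  by (rule ghom_ext) (simp_all add: ghom_lift ghom_id)

lemma lift_in_sgp: "(\<And>l. l \<in> set (wd x) \<Longrightarrow> h (fst l) \<in> sgp Z) \<Longrightarrow> lift h x \<in> sgp Z"
proof -
  have "(\<And>l. l \<in> set w \<Longrightarrow> h (fst l) \<in> sgp Z) \<Longrightarrow>
    foldr (\<lambda>l s. (if snd l then h (fst l) else - h (fst l)) + s) w 0 \<in> sgp Z" for w
    by (induction w) (auto intro!: sgp.zero sgp_add sgp_uminus simp del: add_uminus_conv_diff)
  then show "(\<And>l. l \<in> set (wd x) \<Longrightarrow> h (fst l) \<in> sgp Z) \<Longrightarrow> lift h x \<in> sgp Z"
    by (simp add: lift_def)
qed

section \<open>Hyperbolic automorphisms\<close>

text \<open>Where the absolute value of d attains its maximum M, the recurrence gives t M \<le> 2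
  M.\<close>

lemma hyperbolic_periodic:
  fixes d :: "nat \<Rightarrow> int"
  assumes rec: "\<And>n. d (Suc (Suc n)) + d n = t * d (Suc n)" and t: "3 \<le> t"
    and per: "\<And>n. d (n + k) = d n" and k: "0 < k"
  shows "d n = 0"
proof -
  define M where "M = Max ((\<lambda>i. \<bar>d i\<bar>) ` {..<k})"
  have bound: "\<bar>d i\<bar> \<le> M" for i
  proof -
    have "d i = d (i mod k)"
    proof (induction i rule: less_induct)
      case (less i)
      show ?case
      proof (cases "i < k")
        case False
        then show ?thesis using less[of "i - k"] per[of "i - k"] k by (simp add: le_mod_geq)
      qed simp
    qed
    then show ?thesis using k unfolding M_def by (intro Max_ge) auto
  qed
  have "M \<in> (\<lambda>i. \<bar>d i\<bar>) ` {..<k}" unfolding M_def by (intro Max_in) (use k in auto)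
  then obtain i where i: "M = \<bar>d i\<bar>" by auto
  have "\<bar>d (i + k)\<bar> = M" using per i by simp
  moreover obtain m where m: "i + k = Suc m" using k by (cases "i + k") auto
  ultimately have "t * M = \<bar>d (Suc (Suc m)) + d m\<bar>" using rec[of m] t by (simp add: abs_mult)
  also have "\<dots> \<le> 2 * M" using bound[of "Suc (Suc m)"] bound[of m] by linarith
  finally have "t * M \<le> 2 * M" .
  moreover have "3 * M \<le> t * M" using t bound[of 0] by (intro mult_right_mono) auto
  ultimately have "M \<le> 0" by linarith
  then show ?thesis using bound[of n] by simp
qed

text \<open>Without a fixed vector in Z^2, fixed elements lie in the commutator subgroup, where f
  permutes the squares by an affine map up to sign and conjugation. Some power of f moves every
  square occurring in two given fixed elements out of a finite set, apart from at most one fixed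
  square. Killing the generators outside this set retains both elements but leaves them in one
  cyclic group.\<close>

lemma nafix_hyperbolic:
  assumes f: "aut f" "nafix f" and d: "dt f = 1" and t: "3 \<le> tr f"
  shows False
proof -
  define p q r s where "p = ea (f ga)" and "q = ea (f gb)" and "r = eb (f ga)" and "s = eb (f gb)"
  have det: "p * s - q * r = 1" using d by (simp add: dt_def p_def q_def r_def s_def)
  have trc: "3 \<le> p + s" using t by (simp add: tr_def p_def s_def)
  have fx: "ea (f u) = p * ea u + q * eb u" "eb (f u) = r * ea u + s * eb u" for u
    using aut_exponent[OF f(1), of u] by (simp_all add: p_def q_def r_def s_def mult.commute)
  \<comment> \<open>The determinant of the matrix minus the identity is 2 minus the trace, hence not
    zero.\<close>
  have nofix: "x = 0 \<and> y = 0" if "p * x + q * y = x" "r * x + s * y = y" for x y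
  proof -
    have "(p - 1) * x + q * y = 0" "r * x + (s - 1) * y = 0" using that by (simp_all add: algebra_simps)
    then have "(s - 1) * ((p - 1) * x + q * y) - q * (r * x + (s - 1) * y) = 0"
      "(p - 1) * (r * x + (s - 1) * y) - r * ((p - 1) * x + q * y) = 0" by simp_all
    then have "(p * s - q * r - (p + s) + 1) * x = 0" "(p * s - q * r - (p + s) + 1) * y = 0"
      by (simp_all add: algebra_simps)
    moreover have "p * s - q * r - (p + s) + 1 = 2 - (p + s)" using det by simp
    ultimately have "(2 - (p + s)) * x = 0" "(2 - (p + s)) * y = 0" by simp_all
    then show ?thesis using trc by auto
  qed
  obtain g0 where g0: "f (com ga gb) = conj g0 (com ga gb) \<or> f (com ga gb) = conj g0 (- com ga gb)"
    using aut_com[OF f(1)] by blast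
  \<comment> \<open>The affine action of f on the positions of squares: its matrix, followed by the
    translation caused by the conjugator \<open>g0\<close>.\<close>
  define \<sigma> where "\<sigma> v = (p * fst v + q * snd v + ea g0, r * fst v + s * snd v + eb g0)" for v
  have fsq: "\<exists>h\<in>commutator_subgroup. f (square v) = conj h (square (\<sigma> v)) \<or> f (square v) = conj h (- square (\<sigma> v))" for v
  proof -
    define h where "h = f (corner v) + g0 - corner (\<sigma> v)"
    have "h \<in> commutator_subgroup"
      by (simp add: h_def commutator_subgroup_def fx corner_def \<sigma>_def)
    moreover have "f (square v) = conj (f (corner v)) (f (com ga gb))"
      by (simp add: square_def conj_def ghom_simps[OF aut_ghom[OF f(1)]])
    moreover have "conj (f (corner v)) (conj g0 z) = conj h (conj (corner (\<sigma> v)) z)" for z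
      by (simp add: conj_add[symmetric] h_def)
    ultimately show ?thesis using g0 by (intro bexI[of _ h]) (auto simp: square_def conj_simps)
  qed
  have f_comm: "f x \<in> commutator_subgroup" if "x \<in> commutator_subgroup" for x
    using that by (simp add: commutator_subgroup_def fx)
  have fsq_iter: "\<exists>h\<in>commutator_subgroup. (f ^^ n) (square v) = conj h (square ((\<sigma> ^^ n) v)) \<or>
      (f ^^ n) (square v) = conj h (- square ((\<sigma> ^^ n) v))" for n v
  proof (induction n)
    case 0
    show ?case by (intro bexI[of _ 0]) (simp_all add: commutator_subgroup_closed)
  next
    case (Suc n)
    then obtain h where h: "h \<in> commutator_subgroup" "(f ^^ n) (square v) = conj h (square ((\<sigma> ^^ n) v)) \<or>
      (f ^^ n) (square v) = conj h (- square ((\<sigma> ^^ n) v))" by blast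
    obtain h' where h': "h' \<in> commutator_subgroup" "f (square ((\<sigma> ^^ n) v)) = conj h' (square (\<sigma> ((\<sigma> ^^ n) v))) \<or>
      f (square ((\<sigma> ^^ n) v)) = conj h' (- square (\<sigma> ((\<sigma> ^^ n) v)))" using fsq by blast
    have "f (conj h z) = conj (f h) (f z)" for z
      by (simp add: conj_def ghom_simps[OF aut_ghom[OF f(1)]])
    then have "(f ^^ Suc n) (square v) = conj (f h + h') (square ((\<sigma> ^^ Suc n) v)) \<or>
      (f ^^ Suc n) (square v) = conj (f h + h') (- square ((\<sigma> ^^ Suc n) v))"
      using h(2) h'(2) by (auto simp: conj_add conj_simps ghom_simps[OF aut_ghom[OF f(1)]])
    moreover have "f h + h' \<in> commutator_subgroup" using h h' f_comm commutator_subgroup_closed(2) by blast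
    ultimately show ?case by blast
  qed
  have \<sigma>_diff: "\<sigma> v = \<sigma> w \<Longrightarrow> v = w" for v w
  proof -
    assume "\<sigma> v = \<sigma> w"
    then have 1: "p * (fst v - fst w) + q * (snd v - snd w) = 0" "r * (fst v - fst w) + s * (snd v - snd w) = 0"
      by (simp_all add: \<sigma>_def right_diff_distrib)
    define x y where "x = fst v - fst w" and "y = snd v - snd w"
    have "s * (p * x + q * y) - q * (r * x + s * y) = 0" "p * (r * x + s * y) - r * (p * x + q * y) = 0"
      using 1 by (simp_all add: x_def y_def)
    then have "(p * s - q * r) * x = 0" "(p * s - q * r) * y = 0" by (simp_all add: algebra_simps)
    then show "v = w" using det by (simp add: x_def y_def prod_eq_iff)
  qed
  have inj: "inj (\<lambda>n. (\<sigma> ^^ n) v)" if nf: "\<sigma> v \<noteq> v" for v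
  proof (rule linorder_injI)
    fix m n :: nat assume "m < n"
    show "(\<sigma> ^^ m) v \<noteq> (\<sigma> ^^ n) v"
    proof
      assume eq: "(\<sigma> ^^ m) v = (\<sigma> ^^ n) v"
      have pw: "(\<sigma> ^^ m) x = (\<sigma> ^^ m) y \<Longrightarrow> x = y" for m x y
        by (induction m) (auto dest: \<sigma>_diff)
      define k where "k = n - m"
      have "(\<sigma> ^^ m) ((\<sigma> ^^ k) v) = (\<sigma> ^^ n) v"
        using \<open>m < n\<close> by (simp add: k_def funpow_add[symmetric, THEN fun_cong, unfolded comp_apply])
      then have per: "(\<sigma> ^^ k) v = v" using eq pw by metis
      have k: "0 < k" using \<open>m < n\<close> by (simp add: k_def)
      have per': "(\<sigma> ^^ (i + k)) v = (\<sigma> ^^ i) v" for i by (simp add: funpow_add per)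
      \<comment> \<open>Differences of consecutive orbit points satisfy the recurrence of the
        characteristic polynomial, so a periodic orbit is constant.\<close>
      define x y where "x i = fst ((\<sigma> ^^ Suc i) v) - fst ((\<sigma> ^^ i) v)"
        and "y i = snd ((\<sigma> ^^ Suc i) v) - snd ((\<sigma> ^^ i) v)" for i
      have xs: "x (Suc i) = p * x i + q * y i" "y (Suc i) = r * x i + s * y i" for i
        by (simp_all add: x_def y_def \<sigma>_def algebra_simps)
      have "x (Suc (Suc i)) + x i = (p + s) * x (Suc i)" for i
      proof -
        have "x (Suc (Suc i)) + (p * s - q * r) * x i = (p + s) * x (Suc i)"
          by (simp add: xs algebra_simps)
        then show ?thesis using det by simp
      qed
      moreover have "y (Suc (Suc i)) + y i = (p + s) * y (Suc i)" for i
      proof -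
        have "y (Suc (Suc i)) + (p * s - q * r) * y i = (p + s) * y (Suc i)"
          by (simp add: xs algebra_simps)
        then show ?thesis using det by simp
      qed
      moreover have "x (i + k) = x i" "y (i + k) = y i" for i
        using per'[of i] per'[of "Suc i"] by (simp_all add: x_def y_def)
      ultimately have "x 0 = 0" "y 0 = 0"
        using hyperbolic_periodic[of x "p + s" k] hyperbolic_periodic[of y "p + s" k] trc k by blast+
      then show False using nf by (simp add: x_def y_def prod_eq_iff)
    qed
  qed
  have fixed_unique: "v = w" if "\<sigma> v = v" "\<sigma> w = w" for v w
  proof -
    have "fst v - fst w = 0 \<and> snd v - snd w = 0"
      by (rule nofix) (use that in \<open>simp_all add: \<sigma>_def prod_eq_iff algebra_simps\<close>)
    then show ?thesis by (simp add: prod_eq_iff)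
  qed
  obtain u v where uv: "f u = u" "f v = v" "u + v \<noteq> v + u" using f(2) by (auto simp: nafix_def)
  have "x \<in> commutator_subgroup" if "f x = x" for x
    using nofix[of "ea x" "eb x"] fx[of x] that by (simp add: commutator_subgroup_def)
  then have uvc: "u \<in> commutator_subgroup" "v \<in> commutator_subgroup" using uv by blast+
  define V where "V = fst ` (set (wd (lattice_word u)) \<union> set (wd (lattice_word v)))"
  have "finite V" by (simp add: V_def)
  \<comment> \<open>Orbits of moving positions are injective, so each returns to V only finitely
    often; a time n without any return exists.\<close>
  have "finite (\<Union>w\<in>{w\<in>V. \<sigma> w \<noteq> w}. {n. (\<sigma> ^^ n) w \<in> V})"
    using \<open>finite V\<close> inj finite_vimageI[of V] by (auto simp: vimage_def)
  then obtain n where n: "n \<notin> (\<Union>w\<in>{w\<in>V. \<sigma> w \<noteq> w}. {n. (\<sigma> ^^ n) w \<in> V})"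
    using ex_new_if_finite infinite_UNIV_nat by blast
  \<comment> \<open>K retracts onto the generators in V. The map \<chi> rewrites a product of
    squares after n applications of f and then retracts, so it fixes the words of u and v but kills
    every moving generator in V.\<close>
  define K where "K = lift (\<lambda>w. if w \<in> V then gen w else (0 :: (int \<times> int) fg))"
  define \<chi> where "\<chi> X = K (lattice_word ((f ^^ n) (squares X)))" for X
  have fn: "(f ^^ n) (x + y) = (f ^^ n) x + (f ^^ n) y" for x y
    by (induction n) (simp_all add: ghom_plus[OF aut_ghom[OF f(1)]])
  have fn_comm: "(f ^^ n) x \<in> commutator_subgroup" if "x \<in> commutator_subgroup" for x
    using that by (induction n) (simp_all add: f_comm)
  have hom: "ghom \<chi>"
    unfolding ghom_def \<chi>_def
    by (simp add: squares_simps fn lattice_word_plus fn_comm squares_in_commutator_subgroup K_def lift_simps)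
  have kill: "\<chi> (gen w) = 0" if w: "w \<in> V" "\<sigma> w \<noteq> w" for w
  proof -
    obtain h where h: "h \<in> commutator_subgroup" "(f ^^ n) (square w) = conj h (square ((\<sigma> ^^ n) w)) \<or>
      (f ^^ n) (square w) = conj h (- square ((\<sigma> ^^ n) w))" using fsq_iter by blast
    have nV: "(\<sigma> ^^ n) w \<notin> V" using n w by blast
    have lw: "lattice_word (conj h z) = conj (lattice_word h) (lattice_word z)" if "z \<in> commutator_subgroup" for z
      using that h(1) lattice_word_plus[of "h + z" "- h"]
      by (simp add: conj_def diff_conv_add_uminus lattice_word_plus lattice_word_uminus
          commutator_subgroup_closed del: add_uminus_conv_diff)
    have "K (gen ((\<sigma> ^^ n) w)) = 0" using nV by (simp add: K_def)
    then have K: "K (conj y (gen ((\<sigma> ^^ n) w))) = 0" "K (conj y (- gen ((\<sigma> ^^ n) w))) = 0" for y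
      by (simp_all add: conj_def K_def lift_simps)
    have l: "lattice_word (conj h (square v)) = conj (lattice_word h) (gen v)"
      "lattice_word (conj h (- square v)) = conj (lattice_word h) (- gen v)" for v
      by (simp_all only: lw square_in_commutator_subgroup commutator_subgroup_closed(3)
          lattice_word_square lattice_word_uminus)
    have "lattice_word ((f ^^ n) (square w)) \<in> {conj (lattice_word h) (gen ((\<sigma> ^^ n) w)),
        conj (lattice_word h) (- gen ((\<sigma> ^^ n) w))}"
      using h(2) by (elim disjE) (simp_all add: l)
    then show ?thesis using K by (auto simp only: \<chi>_def squares_gen)
  qed
  have fix_\<chi>: "\<chi> (lattice_word x) = lattice_word x"
    if x: "f x = x" "x \<in> commutator_subgroup" "fst ` set (wd (lattice_word x)) \<subseteq> V" for x
  proof -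
    have "(f ^^ n) x = x" using x(1) by (induction n) simp_all
    then have "\<chi> (lattice_word x) = K (lattice_word x)"
      using x(2) by (simp add: \<chi>_def squares_lattice_word)
    also have "\<dots> = lift gen (lattice_word x)"
      unfolding K_def by (rule lift_cong) (use x(3) in auto)
    finally show ?thesis by (simp add: lift_gen_id)
  qed
  obtain z where z: "\<And>w. w \<in> V \<Longrightarrow> \<chi> (gen w) \<in> sgp {z}"
  proof (cases "\<exists>w\<in>V. \<sigma> w = w")
    case True
    then obtain w0 where "w0 \<in> V" "\<sigma> w0 = w0" by blast
    then show ?thesis using that[of "\<chi> (gen w0)"] fixed_unique kill by (metis sgp.zero sgp_base singletonI)
  next
    case False
    then show ?thesis using that[of 0] kill by (metis sgp.zero)
  qed
  have "\<chi> = lift (\<lambda>w. \<chi> (gen w))" by (rule ghom_ext) (simp_all add: hom ghom_lift)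
  then have "\<chi> X \<in> sgp {z}" if "fst ` set (wd X) \<subseteq> V" for X
    using lift_in_sgp[of X "\<lambda>w. \<chi> (gen w)" "{z}"] z that by (metis image_subset_iff)
  then have "lattice_word u \<in> sgp {z}" "lattice_word v \<in> sgp {z}"
    using fix_\<chi>[OF uv(1) uvc(1)] fix_\<chi>[OF uv(2) uvc(2)] by (metis V_def image_Un sup_ge1, metis V_def image_Un sup_ge2)
  then obtain i j where ij: "lattice_word u = zmul i z" "lattice_word v = zmul j z" by (auto simp: sgp_single)
  have "u = squares (zmul i z)" "v = squares (zmul j z)"
    using ij uvc squares_lattice_word by metis+
  then have "u + v = v + u" by (metis squares_simps(1) zmul_commute)
  then show False using uv(3) by simp
qed


section \<open>Parabolic automorphisms\<close>

abbreviation lb :: "gen fg \<Rightarrow> nat" where "lb \<equiv> wlen (\<lambda>i. i = Gen_b)"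
abbreviation gpb :: "gen fg \<Rightarrow> gen fg \<Rightarrow> nat" where "gpb \<equiv> wgp (\<lambda>i. i = Gen_b)"

definition shear :: "int \<Rightarrow> gen fg \<Rightarrow> gen fg" where
  "shear m = sub ga (gb + zmul m ga)"

lemma ghom_shear: "ghom (shear m)"
  by (simp add: shear_def ghom_sub)

lemmas shear_simps = ghom_simps[OF ghom_shear] ghom_zmul[OF ghom_shear]

lemma shear_gen [simp]: "shear m ga = ga" "shear m gb = gb + zmul m ga"
  by (simp_all add: shear_def)

lemma shear_inverse [simp]: "shear m (shear (- m) x) = x" "shear (- m) (shear m x) = x"
proof -
  have *: "shear m \<circ> shear (- m) = id" for m
    by (rule ghom_ext2) (simp_all add: ghom_comp ghom_shear ghom_id shear_simps zmul_uminus
      add.assoc del: add_uminus_conv_diff)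
  show "shear m (shear (- m) x) = x" "shear (- m) (shear m x) = x"
    using fun_cong[OF *[of m], of x] fun_cong[OF *[of "- m"], of x] by simp_all
qed

lemma aut_shear: "aut (shear m)"
  by (rule autI[of _ "shear (- m)"]) (simp_all add: ghom_shear)

lemma shear_exponents [simp]: "ea (shear m x) = ea x + m * eb x" "eb (shear m x) = eb x"
  by (simp_all add: shear_def exponent_hom[OF ghom_sub])

lemma lb_gen [simp]: "lb ga = 0" "lb gb = 1"
  by (simp_all add: wlen_gen)

lemma lb_zmul [simp]: "lb (zmul k ga) = 0"
proof (induction k rule: int_induct[of _ 0])
  case (step1 k)
  then show ?case using wlen_plus_le[of "\<lambda>i. i = Gen_b" ga "zmul k ga"] by (simp add: zmul_succ)
next
  case (step2 k)
  then show ?case using wlen_plus_le[of "\<lambda>i. i = Gen_b" "- ga" "zmul k ga"] by (simp add: zmul_pred)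
qed simp

lemma not_Gen_b: "i \<noteq> Gen_b \<longleftrightarrow> i = Gen_a"
  by (cases i) auto

lemma lb_0_iff: "lb x = 0 \<longleftrightarrow> (\<exists>k. x = zmul k ga)"
proof
  assume "lb x = 0"
  then have "\<forall>l\<in>set (wd x). fst l = Gen_a"
    by (simp add: wlen_def cnt_def filter_empty_conv not_Gen_b)
  then show "\<exists>k. x = zmul k ga" using elt_only_a[of "wd x"] by simp
qed auto

lemma lb_zmul_plus [simp]: "lb (zmul k ga + x) = lb x" "lb (x + zmul k ga) = lb x"
  using wlen_plus_le[of "\<lambda>i. i = Gen_b" "zmul k ga" x] wlen_plus_le[of "\<lambda>i. i = Gen_b" "zmul (- k) ga" "zmul k ga + x"]
    wlen_plus_le[of "\<lambda>i. i = Gen_b" x "zmul k ga"] wlen_plus_le[of "\<lambda>i. i = Gen_b" "x + zmul k ga" "zmul (- k) ga"]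
  by (simp_all add: zmul_uminus[symmetric] add.assoc[symmetric] zmul_add[symmetric])
    (simp_all add: add.assoc zmul_add[symmetric])

lemma lb_shear [simp]: "lb (shear m x) = lb x"
proof -
  have le: "lb (shear m (elt w)) \<le> cnt (\<lambda>i. i = Gen_b) w" for m w
  proof (induction w)
    case (Cons l w)
    have "lb (shear m (elt [l])) = cnt (\<lambda>i. i = Gen_b) [l]"
    proof (cases l)
      case (Pair i s)
      then show ?thesis
        by (cases i) (simp_all add: elt_single shear_simps minus_add zmul_uminus[symmetric] del: add_uminus_conv_diff)
    qed
    then show ?case
      using Cons wlen_plus_le[of "\<lambda>i. i = Gen_b" "shear m (elt [l])" "shear m (elt w)"]
      by (simp add: elt_Cons[of l w] shear_simps split: if_splits)
  qed (simp add: shear_simps)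
  have le': "lb (shear m x) \<le> lb x" for m x
    using le[of m "wd x"] by (simp add: wlen_def)
  show ?thesis using le'[of m x] le'[of "- m" "shear m x"] by simp
qed

lemma gpb_isometry:
  assumes "ghom f" "\<And>x. lb (f x) = lb x"
  shows "gpb (f x) (f y) = gpb x y"
proof -
  have "lb (- f x + f y) = lb (- x + y)"
    using assms by (metis ghom_plus ghom_uminus)
  then show ?thesis
    using wlen_diff[of "\<lambda>i. i = Gen_b" "f x" "f y"] wlen_diff[of "\<lambda>i. i = Gen_b" x y] assms(2)[of x] assms(2)[of y]
    by linarith
qed

lemma eb_parity: "even (eb x + int (lb x))"
proof -
  have "even (eb (elt w) + int (cnt (\<lambda>i. i = Gen_b) w))" for w
  proof (induction w)
    case (Cons l w)
    then show ?case
    proof (cases l)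
      case (Pair i s)
      then show ?thesis using Cons elt_Cons[of l w] by (cases i; cases s) (simp_all add: elt_single)
    qed
  qed simp
  from this[of "wd x"] show ?thesis by (simp add: wlen_def)
qed

lemma weighted_prefix_exists:
  assumes "h \<le> wlen P x"
  obtains p where "wlen P p = h" "wgp P p x = h"
proof
  have *: "\<exists>s. w = bpre P h w @ s" for w :: "'a word"
    by (induction P h w rule: bpre.induct) auto
  have c: "h \<le> cnt P w \<Longrightarrow> cnt P (bpre P h w) = h" for w :: "'a word"
    by (induction P h w rule: bpre.induct) (auto split: if_splits)
  obtain s where s: "wd x = bpre P h (wd x) @ s" using * by blast
  then have "reduced (bpre P h (wd x))" by (metis reduced_append reduced_wd)
  then have p: "wd (elt (bpre P h (wd x))) = bpre P h (wd x)" by (rule elt_reduced_wd)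
  show "wlen P (elt (bpre P h (wd x))) = h" using assms c by (simp add: wlen_def p)
  have lcp: "longest_common_prefix u (u @ v) = u" for u v :: "'a word"
    by (induction u) auto
  show "wgp P (elt (bpre P h (wd x))) x = h"
    using c[of "wd x"] assms lcp[of "bpre P h (wd x)" s] s by (simp add: wgp_def wlen_def p)
qed

text \<open>If no twisted conjugate of \<open>g\<close> fixes a vertex of the Bass-Serre tree, then the fixed elements
  translate along an axis.\<close>

lemma parabolic_has_fixed_vertex:
  assumes na: "nafix (conj g \<circ> shear m)"
    and minimal: "\<And>h. lb g \<le> lb (- h + g + shear m h)"
  shows "lb g = 0"
proof (rule ccontr)
  assume "lb g \<noteq> 0"
  define r where "r = lb g"
  have r: "0 < r" using \<open>lb g \<noteq> 0\<close> by (simp add: r_def)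
  let ?P = "\<lambda>i. i = Gen_b"
  let ?\<theta> = "shear m"
  have no_cancel: "gpb (- g) (?\<theta> g) = 0"
  proof (rule ccontr)
    assume c: "gpb (- g) (?\<theta> g) \<noteq> 0"
    show False
    proof (cases "r = 1")
      case True
      \<comment> \<open>All letters b cancel, so the exponent of b in
        \<open>g + ?\<theta> g\<close>, twice that of g, is zero; but a single letter b makes
        \<open>eb g\<close> odd.\<close>
      then have "lb (g + ?\<theta> g) = 0"
        using wlen_plus[of ?P g "?\<theta> g"] c by (simp add: r_def)
      then obtain k where "g + ?\<theta> g = zmul k ga" unfolding lb_0_iff by blast
      from arg_cong[OF this, of eb] have "eb g = 0" by simp
      then show False using eb_parity[of g] True by (simp add: r_def)
    next
      case False
      obtain p where p: "lb p = 1" "gpb p (?\<theta> g) = 1"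
        using weighted_prefix_exists[of 1 ?P "?\<theta> g"] r by (auto simp: r_def)
      \<comment> \<open>The beginning p of \<open>?\<theta> g\<close> is the image of a beginning h
        of g. Twisted conjugation by h removes one letter b at each end of g, against
        minimality.\<close>
      define h where "h = shear (- m) p"
      have h: "lb h = 1" "?\<theta> h = p" by (simp_all add: h_def p)
      have "gpb h g = 1"
        using gpb_isometry[OF ghom_shear, of m h g] p h by simp
      then have l1: "lb (- h + g) + 1 = r"
        using wlen_diff[of ?P h g] h by (simp add: r_def)
      have "0 < gpb (- g) p"
        using wgp_ultra[of ?P "- g" "?\<theta> g" p] c p by (simp add: wgp_commute)
      moreover have "0 < gpb (- (- h + g)) (- g)"
        using wlen_diff[of ?P "- (- h + g)" "- g"] l1 h(1) False r
        by (simp add: r_def group_simps del: add_uminus_conv_diff)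
      ultimately have "0 < gpb (- (- h + g)) p"
        using wgp_ultra[of ?P "- (- h + g)" "- g" p] by simp
      then have "lb (- h + g + p) < r"
        using wlen_plus[of ?P "- h + g" p] l1 p by simp
      then show False using minimal[of h] h(2) by (simp add: r_def)
    qed
  qed
  define \<Theta> where "\<Theta> n = ?\<theta> ^^ n" for n :: nat
  have \<Theta>: "ghom (\<Theta> n)" "lb (\<Theta> n x) = lb x" for n x
    unfolding \<Theta>_def by (induction n) (simp_all add: ghom_def shear_simps)
  \<comment> \<open>The image of 0 under the n-th iterate of the map sending x to
    \<open>g + ?\<theta> x\<close>. Its b-length grows by r each time, so these points lie along an
    axis of the tree.\<close>
  define G where "G = rec_nat 0 (\<lambda>n z. z + \<Theta> n g)"
  have G: "G 0 = 0" "G (Suc n) = G n + \<Theta> n g" for n by (simp_all add: G_def)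
  have lG: "lb (G n) = n * r \<and> gpb (- G n) (\<Theta> n g) = 0" for n
  proof (induction n)
    case 0
    have "gpb 0 x = 0" for x using wgp_le(1)[of ?P 0 x] by simp
    then show ?case by (simp add: G)
  next
    case (Suc n)
    have l: "lb (G (Suc n)) = Suc n * r"
      using wlen_plus[of ?P "G n" "\<Theta> n g"] Suc \<Theta>(2)[of n g] by (simp add: G r_def)
    have e: "- (- \<Theta> n g) + - G (Suc n) = - G n"
      by (simp add: G group_simps del: add_uminus_conv_diff)
    have "gpb (- \<Theta> n g) (- G (Suc n)) = r"
      using wlen_diff[of ?P "- \<Theta> n g" "- G (Suc n)"] l Suc \<Theta>(2)[of n g]
      unfolding e by (simp add: r_def)
    moreover have "gpb (\<Theta> (Suc n) g) (- \<Theta> n g) = 0"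
    proof -
      have "\<Theta> (Suc n) g = \<Theta> n (?\<theta> g)" by (simp add: \<Theta>_def funpow_swap1)
      then have "gpb (\<Theta> (Suc n) g) (- \<Theta> n g) = gpb (\<Theta> n (?\<theta> g)) (\<Theta> n (- g))"
        using ghom_uminus[OF \<Theta>(1), of n g] by simp
      then show ?thesis using gpb_isometry[OF \<Theta>] no_cancel by (simp add: wgp_commute)
    qed
    ultimately have "gpb (\<Theta> (Suc n) g) (- G (Suc n)) = 0"
      using gp_transfer[of ?P "\<Theta> (Suc n) g" "- \<Theta> n g" "- G (Suc n)"] r by simp
    then show ?case using l by (simp add: wgp_commute)
  qed
  \<comment> \<open>The twisted image \<open>\<Theta> n u\<close> has the same b-length as u
    whatever n is, so \<open>stabilisers_commute\<close> applies for large n.\<close>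
  have shift: "u + G n = G n + \<Theta> n u" if u: "(conj g \<circ> ?\<theta>) u = u" for u n
  proof (induction n)
    case (Suc n)
    have "g + ?\<theta> u = u + g" using u by (simp add: conj_def diff_eq_eq)
    then have "\<Theta> n u + \<Theta> n g = \<Theta> n g + \<Theta> n (?\<theta> u)" by (metis ghom_plus[OF \<Theta>(1)])
    moreover have "\<Theta> (Suc n) u = \<Theta> n (?\<theta> u)" by (simp add: \<Theta>_def funpow_swap1)
    ultimately have "\<Theta> n u + \<Theta> n g = \<Theta> n g + \<Theta> (Suc n) u" by simp
    moreover have "u + G (Suc n) = G n + (\<Theta> n u + \<Theta> n g)"
      using Suc by (simp only: G add.assoc[symmetric])
    ultimately show ?case by (simp only: G add.assoc)
  qed (simp add: G \<Theta>_def)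
  obtain u v where uv: "(conj g \<circ> ?\<theta>) u = u" "(conj g \<circ> ?\<theta>) v = v" "u + v \<noteq> v + u"
    using na unfolding nafix_def by blast
  define C where "C = max (lb u) (lb v)"
  have "6 * C < lb (G (6 * C + 1))" using lG[of "6 * C + 1"] r by (cases r) auto
  then have "u + v = v + u"
    by (intro stabilisers_commute[OF shift[OF uv(1), of "6 * C + 1"] _ _ shift[OF uv(2), of "6 * C + 1"], of ?P C])
      (simp_all add: C_def \<Theta>(2) del: One_nat_def)
  then show False using uv(3) by simp
qed

section \<open>Normal forms with respect to the letter b\<close>

lemma lb_decompose:
  assumes "0 < lb x"
  obtains n e y where "x = zmul n ga + e + y" "e \<in> {gb, - gb}" "lb x = Suc (lb y)"
proof -
  have "\<exists>l\<in>set (wd x). fst l = Gen_b"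
  proof (rule ccontr)
    assume "\<not> ?thesis"
    then have "cnt (\<lambda>i. i = Gen_b) (wd x) = 0" by (auto simp: cnt_def)
    then show False using assms by (simp add: wlen_def)
  qed
  then obtain u l v where *: "wd x = u @ l # v" "fst l = Gen_b" "\<forall>k\<in>set u. fst k \<noteq> Gen_b"
    using split_list_first_prop[of "wd x" "\<lambda>l. fst l = Gen_b"] by blast
  have "\<forall>k\<in>set u. fst k = Gen_a" using *(3) by (simp add: not_Gen_b)
  then obtain n where n: "elt u = zmul n ga" using elt_only_a by blast
  have "x = zmul n ga + elt [l] + elt v"
    by (metis *(1) n elt_wd elt_append elt_Cons add.assoc)
  moreover have "elt [l] \<in> {gb, - gb}" using *(2) by (cases l) (simp add: elt_single)
  moreover have "reduced v" using reduced_wd[of x] *(1) by (metis reduced_append reduced_tl)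
  then have "lb x = Suc (lb (elt v))"
    using * by (simp add: wlen_def elt_reduced_wd) (simp add: cnt_def filter_empty_conv)
  ultimately show ?thesis using that by blast
qed

text \<open>The first syllable \<open>zmul n ga + e\<close> is recovered as the shortest prefix with
  one letter b, and its exponents determine n and e.\<close>

lemma lb_decompose_unique:
  assumes eq: "zmul n ga + e + y = zmul n' ga + e' + y'" and e: "e \<in> {gb, - gb}" "e' \<in> {gb, - gb}"
    and l: "lb (zmul n ga + e + y) = Suc (lb y)" "lb y = lb y'"
  shows "n = n' \<and> e = e' \<and> y = y'"
proof -
  let ?P = "\<lambda>i. i = Gen_b"
  define x where "x = zmul n ga + e + y"
  have pre: "elt (bpre ?P 1 (wd x)) = zmul k ga + d"
    if "x = zmul k ga + d + z" "d \<in> {gb, - gb}" "lb x = Suc (lb z)" for k d z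
  proof -
    note dd = that(2)
    have "lb (zmul k ga + d) = 1" using that(2) by auto
    then have "gpb (zmul k ga + d) x = 1"
      using wlen_diff[of ?P "zmul k ga + d" x] that(3) unfolding that(1) minus_add_cancel by simp
    then have "bpre ?P 1 (wd x) = bpre ?P 1 (wd (zmul k ga + d))"
      by (intro bpre_agree[symmetric]) simp
    moreover have "bpre ?P 1 (wd (zmul k ga + d)) = wd (zmul k ga + d)"
    proof -
      define l where "l = hd (wd d)"
      have d: "wd d = [l]" "fst l = Gen_b" unfolding l_def using dd by (elim insertE emptyE; simp)+
      have A: "\<forall>k\<in>set (wd (zmul k ga)). fst k \<noteq> Gen_b"
        using lb_zmul[of k] by (simp add: wlen_def cnt_def filter_empty_conv)
      then have c: "cnt ?P (wd (zmul k ga)) = 0" by (simp add: cnt_def filter_empty_conv)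
      have "reduced (wd (zmul k ga) @ [l])"
        using A d(2) by (auto simp: reduced_append)
      then have "wd (zmul k ga + d) = wd (zmul k ga) @ [l]" by (simp add: wd_plus d reduce_reduced)
      then show ?thesis using bpre_append2[of 1 ?P "wd (zmul k ga)" "[l]"] c d(2) by simp
    qed
    ultimately show ?thesis by simp
  qed
  have "zmul n ga + e = zmul n' ga + e'"
    using pre[of n e y] pre[of n' e' y'] eq e l by (simp add: x_def)
  moreover from arg_cong[OF this, of eb] have "e = e'" using e by auto
  moreover from arg_cong[OF calculation(1), of ea] have "n = n'" using e by auto
  ultimately show ?thesis using eq by simp
qed

text \<open>The model of the non-abelian proper fixed subgroups: every nontrivial shear has exactly
  this fixed subgroup, by \<open>fixed_shear\<close>.\<close>

definition K0 :: "gen fg set" where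
  "K0 = sgp {ga, conj gb ga}"

lemma K0_zmul: "zmul k ga \<in> K0" "gb + zmul k ga - gb \<in> K0"
proof -
  show "zmul k ga \<in> K0" unfolding K0_def by (intro zmul_in_sgp sgp_base) simp
  have "conj gb (zmul k ga) = zmul k (conj gb ga)" by (rule ghom_zmul[OF ghom_conj])
  moreover have "zmul k (conj gb ga) \<in> K0" unfolding K0_def by (intro zmul_in_sgp sgp_base) simp
  ultimately show "gb + zmul k ga - gb \<in> K0" by (simp add: conj_def)
qed

lemma shear_fixes_K0: "x \<in> K0 \<Longrightarrow> shear m x = x"
  unfolding K0_def
proof (induction rule: sgp.induct)
  case (plus u x)
  then show ?case
    by (auto simp: shear_simps conj_def group_simps zmul_commute[of m 1, simplified] simp del: add_uminus_conv_diff)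
      (metis add.assoc add_minus_cancel zmul_1 zmul_commute)
next
  case (minus u x)
  then show ?case
    by (auto simp: shear_simps conj_def group_simps simp del: add_uminus_conv_diff)
      (metis add.assoc add_minus_cancel zmul_1 zmul_commute zmul_uminus)
qed (simp add: shear_simps)

text \<open>A shear multiplies b by \<open>zmul m ga\<close> on the right, so a leading inverse of b
  would change the exponent of a before it. Hence the first such syllable is b itself. The exponent
  of a following it is then shifted by m, and only a subsequent inverse of b shifts it back.
  Splitting off this generator of \<open>K0\<close> shortens the element.\<close>

lemma shear_fixed_in_K0:
  assumes m: "m \<noteq> 0" and "shear m u = u"
  shows "u \<in> K0"
  using assms(2)
proof (induction "lb u" arbitrary: u rule: less_induct)
  case less
  show ?case
  proof (cases "lb u = 0")
    case True
    then show ?thesis using K0_zmul by (auto simp: lb_0_iff)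
  next
    case False
    then obtain n e u' where u: "u = zmul n ga + e + u'" "e \<in> {gb, - gb}" "lb u = Suc (lb u')"
      using lb_decompose[of u] by blast
    have e: "e = gb"
    proof (rule ccontr)
      assume "e \<noteq> gb"
      then have e: "e = - gb" using u by simp
      have "shear m u = zmul n ga + (- zmul m ga + (- gb + shear m u'))"
        by (simp add: u(1) e shear_simps minus_add add.assoc del: add_uminus_conv_diff)
      moreover have "zmul (n - m) ga + e + shear m u' = zmul n ga + (- zmul m ga + (- gb + shear m u'))"
        unfolding zmul_diff e by (simp only: diff_conv_add_uminus add.assoc)
      ultimately have "zmul n ga + e + u' = zmul (n - m) ga + e + shear m u'"
        using less.prems u(1) by metis
      from lb_decompose_unique[OF this u(2,2)] have "n = n - m" using u(1,3) by (metis lb_shear)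
      then show False using m by simp
    qed
    have "shear m u = zmul n ga + gb + (zmul m ga + shear m u')"
      by (simp add: u(1) e shear_simps add.assoc)
    then have "zmul n ga + gb + u' = zmul n ga + gb + (zmul m ga + shear m u')"
      using less.prems u(1) e by metis
    then have u': "u' = zmul m ga + shear m u'" by simp
    have "lb u' \<noteq> 0"
    proof
      assume "lb u' = 0"
      then obtain k where "u' = zmul k ga" by (auto simp: lb_0_iff)
      then have "zmul m ga + shear m u' = zmul (m + k) ga" by (simp add: shear_simps zmul_add)
      then have "zmul k ga = zmul (m + k) ga" using u' \<open>u' = zmul k ga\<close> by metis
      from arg_cong[OF this, of ea] show False using m by simp
    qed
    then obtain n' e' u'' where v: "u' = zmul n' ga + e' + u''" "e' \<in> {gb, - gb}" "lb u' = Suc (lb u'')"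
      using lb_decompose[of u'] by blast
    have e': "e' = - gb"
    proof (rule ccontr)
      assume "e' \<noteq> - gb"
      then have e': "e' = gb" using v by simp
      have "zmul m ga + shear m u' = zmul (m + n') ga + e' + (zmul m ga + shear m u'')"
        by (simp add: v(1) e' shear_simps zmul_add add.assoc)
      then have "zmul n' ga + e' + u'' = zmul (m + n') ga + e' + (zmul m ga + shear m u'')"
        using u' v(1) by metis
      from lb_decompose_unique[OF this v(2,2)] have "n' = m + n'"
        using v(1,3) by (metis lb_shear lb_zmul_plus(1))
      then show False using m by simp
    qed
    have "zmul m ga + shear m u' = zmul m ga + (zmul n' ga + (- zmul m ga + (- gb + shear m u'')))"
      by (simp add: v(1) e' shear_simps minus_add add.assoc del: add_uminus_conv_diff)
    also have "\<dots> = zmul n' ga + - gb + shear m u''"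
      by (simp add: zmul_uminus[symmetric] add.assoc[symmetric] zmul_add[symmetric] del: add_uminus_conv_diff)
    finally have "zmul n' ga + - gb + u'' = zmul n' ga + - gb + shear m u''"
      using u' v(1) e' by metis
    then have "shear m u'' = u''" by (metis add_left_cancel)
    then have "u'' \<in> K0" using less.hyps[of u''] u(3) v(3) by simp
    moreover have "u = zmul n ga + ((gb + zmul n' ga - gb) + u'')"
      using u(1) v(1) e e' by (simp add: group_simps del: add_uminus_conv_diff)
    ultimately show ?thesis using K0_zmul unfolding K0_def by (metis sgp_add)
  qed
qed

lemma fixed_shear: "m \<noteq> 0 \<Longrightarrow> {x. shear m x = x} = K0"
  using shear_fixed_in_K0 shear_fixes_K0 by blast

lemma fixed_conjugate:
  assumes "\<And>x. h' (h x) = x" "\<And>x. h (h' x) = x"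
  shows "{x. f x = x} = h ` {x. h' (f (h x)) = x}"
proof -
  have "x \<in> h ` {x. h' (f (h x)) = x}" if "f x = x" for x
    using that assms by (intro image_eqI[of _ h "h' x"]) auto
  then show ?thesis using assms by auto metis
qed

text \<open>A twisted conjugate of g with fewest letters b is a power \<open>zmul j ga\<close>. The
  resulting map sends b to \<open>zmul j ga + gb + zmul (m - j) ga\<close>; a fixed element
  involving b forces j = 0 or j = m, and then the map is a shear, directly or after inverting
  b.\<close>

lemma fixed_parabolic:
  assumes f: "aut f" "nafix f" and e: "ea (f ga) = 1" "eb (f ga) = 0" "eb (f gb) = 1"
    and m: "ea (f gb) \<noteq> 0"
  shows "\<exists>h. aut h \<and> {x. f x = x} = h ` K0"
proof -
  define m where "m = ea (f gb)"
  have m0: "m \<noteq> 0" using m by (simp add: m_def)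
  have "\<exists>g. f = conj g \<circ> shear m"
    by (rule same_exponents_inner[OF f(1) aut_shear]) (simp_all add: e m_def)
  then obtain g where g: "f = conj g \<circ> shear m" by blast
  obtain h where h: "\<And>h'. lb (- h + g + shear m h) \<le> lb (- h' + g + shear m h')"
    using ex_has_least_nat[of "\<lambda>_. True" _ "\<lambda>h. lb (- h + g + shear m h)"] by blast
  define g' where "g' = - h + g + shear m h"
  have conj: "conj (- h) (f (conj h x)) = conj g' (shear m x)" for x
    by (simp add: g g'_def conj_def shear_simps group_simps del: add_uminus_conv_diff)
  have na: "nafix (conj g' \<circ> shear m)"
    by (rule nafix_transfer[OF f(2) aut_conj[of "- h"]]) (simp add: conj[symmetric])
  have "lb g' = 0"
  proof (rule parabolic_has_fixed_vertex[OF na])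
    fix k
    have "- k + g' + shear m k = - (h + k) + g + shear m (h + k)"
      by (simp add: g'_def shear_simps group_simps del: add_uminus_conv_diff)
    then show "lb g' \<le> lb (- k + g' + shear m k)" using h[of "h + k"] by (simp add: g'_def)
  qed
  then obtain j where j: "g' = zmul j ga" by (auto simp: lb_0_iff)
  define f' where "f' = conj g' \<circ> shear m"
  have f'gb: "f' gb = zmul j ga + gb + zmul (m - j) ga"
    unfolding zmul_diff by (simp add: f'_def j conj_def group_simps del: add_uminus_conv_diff)
  have f'z: "f' (zmul k ga) = zmul k ga" for k
    by (simp add: f'_def j shear_simps conj_eq_iff zmul_commute)
  have f'h: "ghom f'" unfolding f'_def by (intro ghom_comp ghom_conj ghom_shear)
  note f's = ghom_simps[OF f'h]
  have lbf': "lb (f' x) = lb x" for x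
    by (simp add: f'_def j conj_def diff_conv_add_uminus zmul_uminus[symmetric] del: add_uminus_conv_diff)
  have "\<exists>u. f' u = u \<and> 0 < lb u"
  proof (rule ccontr)
    assume "\<not> ?thesis"
    then have "\<exists>k. u = zmul k ga" if "f' u = u" for u using that lb_0_iff[of u] by blast
    then show False using na zmul_commute unfolding nafix_def f'_def[symmetric] by metis
  qed
  then obtain u where u: "f' u = u" "0 < lb u" by blast
  obtain n e y where d: "u = zmul n ga + e + y" "e \<in> {gb, - gb}" "lb u = Suc (lb y)"
    using lb_decompose[OF u(2)] by blast
  \<comment> \<open>The map adds j to the exponent of a in front of the first letter b if this
    letter is positive, and j - m if it is inverted; a fixed element tolerates neither change unless
    it is zero.\<close>
  have j0: "j = 0 \<or> j = m"
  proof (cases "e = gb")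
    case True
    have "f' u = zmul n ga + ((zmul j ga + gb + zmul (m - j) ga) + f' y)"
      by (simp only: d(1) True f's f'gb f'z add.assoc)
    then have "zmul n ga + e + y = zmul (n + j) ga + gb + (zmul (m - j) ga + f' y)"
      using u(1) d(1) by (simp add: zmul_add add.assoc)
    from lb_decompose_unique[OF this d(2)] have "n = n + j"
      using d(1,3) lbf' by (metis insertI1 lb_zmul_plus(1))
    then show ?thesis by simp
  next
    case False
    then have e: "e = - gb" using d by simp
    have "f' u = zmul n ga + (- (zmul j ga + gb + zmul (m - j) ga) + f' y)"
      by (simp only: d(1) e f's f'gb f'z add.assoc)
    then have "zmul n ga + e + y = zmul (n + (j - m)) ga + (- gb) + (zmul (- j) ga + f' y)"
      using u(1) d(1) unfolding zmul_add zmul_uminus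
      by (simp only: minus_add add.assoc zmul_uminus[symmetric] minus_diff_eq)
    from lb_decompose_unique[OF this d(2)] have "n = n + (j - m)"
      using d(1,3) lbf' by (metis insertI1 insertI2 lb_zmul_plus(1))
    then show ?thesis by simp
  qed
  have "\<exists>k. aut k \<and> {x. f' x = x} = k ` K0"
  proof (cases "j = 0")
    case True
    then have "f' = shear m" by (simp add: f'_def j fun_eq_iff)
    then show ?thesis using fixed_shear[OF m0] by (intro exI[of _ id]) (simp add: aut_id)
  next
    case False
    then have "j = m" using j0 by simp
    define \<eta> where "\<eta> = sub ga (- gb)"
    have "\<eta> \<circ> \<eta> = id" by (rule ghom_ext2) (simp_all add: \<eta>_def ghom_comp ghom_sub ghom_id sub_simps)
    then have \<eta>: "\<eta> (\<eta> x) = x" for x by (metis comp_apply id_apply)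
    have "\<eta> \<circ> f' \<circ> \<eta> = shear (- m)"
      by (rule ghom_ext2) (use f'gb f'z[of 1] \<open>j = m\<close> in \<open>simp_all add: \<eta>_def ghom_comp ghom_sub f'h
        ghom_shear sub_simps f's ghom_zmul[OF ghom_sub] zmul_uminus minus_add del: add_uminus_conv_diff\<close>)
    then have "\<eta> (f' (\<eta> x)) = shear (- m) x" for x by (metis comp_apply)
    then have "{x. f' x = x} = \<eta> ` {x. shear (- m) x = x}"
      using fixed_conjugate[of \<eta> \<eta> f', OF \<eta> \<eta>] by simp
    then show ?thesis using fixed_shear[of "- m"] m0 aut_elementary(4) by (auto simp: \<eta>_def)
  qed
  then obtain k where k: "aut k" "{x. f' x = x} = k ` K0" by blast
  have "{x. f x = x} = conj h ` {x. conj (- h) (f (conj h x)) = x}"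
    by (rule fixed_conjugate) simp_all
  also have "\<dots> = (conj h \<circ> k) ` K0" using k(2) by (simp add: conj f'_def image_comp)
  finally show ?thesis using k(1) aut_conj aut_comp by blast
qed

section \<open>Non-abelian fixed subgroups\<close>

text \<open>A row eigenvector for 1 becomes the exponent of b in a new basis, which leaves a
  unipotent triangular matrix. It is not the identity matrix, since an inner automorphism with
  non-abelian fixed subgroup is trivial.\<close>

lemma fixed_trace_two:
  assumes f: "aut f" "nafix f" "f \<noteq> id" and d: "dt f = 1" "tr f = 2"
  shows "\<exists>h. aut h \<and> {x. f x = x} = h ` K0"
proof -
  define p q r s where "p = ea (f ga)" and "q = ea (f gb)" and "r = eb (f ga)" and "s = eb (f gb)"
  have s: "s = 2 - p" and det: "p * s - q * r = 1"
    using d by (simp_all add: tr_def dt_def p_def q_def r_def s_def)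
  have fx: "ea (f u) = ea u * p + eb u * q" "eb (f u) = ea u * r + eb u * s" for u
    using aut_exponent[OF f(1), of u] by (simp_all add: p_def q_def r_def s_def)
  obtain x y where xy: "x \<noteq> 0 \<or> y \<noteq> 0" "x * p + y * r = x" "x * q + y * s = y"
  proof (cases "r = 0 \<and> p = 1")
    case True
    then show ?thesis using that[of 0 1] s by simp
  next
    case False
    have "p * (2 - p) - q * r = 1" using det s by simp
    then show ?thesis using that[of r "1 - p"] False s by (auto simp: algebra_simps)
  qed
  obtain h d where h: "aut h" "d \<noteq> 0" "\<And>u. d * eb (h u) = x * ea u + y * eb u"
    using aut_with_row_multiple[OF xy(1)] by blast
  define f1 where "f1 = h \<circ> f \<circ> finv h"
  have f1: "aut f1" "nafix f1"
    using f h by (auto simp: f1_def aut_comp aut_inv intro: nafix_transfer[of f h])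
  have ef1: "eb (f1 u) = eb u" for u
  proof -
    define v where "v = finv h u"
    have "d * eb (f1 u) = x * (ea v * p + eb v * q) + y * (ea v * r + eb v * s)"
      by (simp add: f1_def h(3) v_def[symmetric] fx)
    also have "\<dots> = ea v * (x * p + y * r) + eb v * (x * q + y * s)" by (simp add: algebra_simps)
    also have "\<dots> = d * eb (h v)" unfolding xy(2,3) h(3) by (simp add: algebra_simps)
    finally have "d * eb (f1 u) = d * eb u" using h(1) by (simp add: v_def)
    then show ?thesis using h(2) by simp
  qed
  have "dt f1 = dt h * dt f * dt (finv h)"
    unfolding f1_def using h(1) f(1) by (simp add: dt_comp aut_ghom aut_comp aut_inv)
  then have "dt f1 = 1" using d(1) aut_dt_inv[OF h(1)] by (simp add: mult.commute)
  then have p1: "ea (f1 ga) = 1" by (simp add: dt_def ef1)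
  have m0: "ea (f1 gb) \<noteq> 0"
  proof
    assume "ea (f1 gb) = 0"
    then have "f1 = id" using nafix_IA[OF f1(2,1)] p1 ef1 by simp
    then have "h (f (finv h x)) = x" for x by (metis comp_apply f1_def id_apply)
    then have "f (finv h x) = finv h x" for x using h(1) by (metis aut_cancel(2))
    then have "f y = y" for y using h(1) by (metis aut_cancel(2))
    then show False using f(3) by (auto simp: fun_eq_iff)
  qed
  obtain k where k: "aut k" "{x. f1 x = x} = k ` K0"
    using fixed_parabolic[OF f1 p1 _ _ m0] ef1 by auto
  have "{x. f x = x} = finv h ` {x. h (f (finv h x)) = x}"
    by (rule fixed_conjugate) (simp_all add: h(1))
  also have "\<dots> = (finv h \<circ> k) ` K0" using k(2) by (simp add: f1_def image_comp)
  finally show ?thesis using k(1) h(1) aut_inv aut_comp by blast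
qed

text \<open>An integer matrix of square 1 has trace 0 and determinant -1, or is the identity or its
  negative.\<close>

lemma nafix_involution:
  fixes f :: "gen fg \<Rightarrow> gen fg"
  assumes f: "aut f" "nafix f" and ff: "\<And>x. f (f x) = x"
  shows "f = id"
proof -
  define p q r s where "p = ea (f ga)" and "q = ea (f gb)" and "r = eb (f ga)" and "s = eb (f gb)"
  have fx: "ea (f u) = ea u * p + eb u * q" "eb (f u) = ea u * r + eb u * s" for u
    using aut_exponent[OF f(1), of u] by (simp_all add: p_def q_def r_def s_def)
  have M: "p * p + r * q = 1" "q * p + s * q = 0" "p * r + r * s = 0" "q * r + s * s = 1"
    using fx[of "f ga"] fx[of "f gb"] ff by (simp_all add: p_def q_def r_def s_def)
  have d: "dt f = p * s - q * r" "tr f = p + s" by (simp_all add: dt_def tr_def p_def q_def r_def s_def)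
  show ?thesis
  proof (cases "p + s = 0")
    case True
    then have "s = - p" by simp
    then have "dt f = - 1" using d M(1) by (simp add: mult.commute)
    then show ?thesis using nafix_det_minus_one[OF f] d True by simp
  next
    case False
    have "q * (p + s) = 0" "r * (p + s) = 0" using M by (simp_all add: algebra_simps)
    then have qr: "q = 0" "r = 0" using False by auto
    then have "p = 1 \<or> p = - 1" "s = 1 \<or> s = - 1" using M zmult_eq_1_iff by auto
    then have "p = 1 \<and> s = 1 \<or> p = - 1 \<and> s = - 1" using False by auto
    then show ?thesis
      using nafix_IA[OF f(2,1)] nafix_minus_identity[OF f] qr by (auto simp: p_def q_def r_def s_def)
  qed
qed

text \<open>Identifies \<open>K0\<close> with a free group of rank two, so that an automorphism
  preserving an image of \<open>K0\<close> restricts to an automorphism to which the same results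
  apply.\<close>

definition \<kappa> :: "gen fg \<Rightarrow> gen fg" where
  "\<kappa> = sub ga (conj gb ga)"

lemma ghom_\<kappa>: "ghom \<kappa>"
  by (simp add: \<kappa>_def ghom_sub)

lemma range_\<kappa>: "range \<kappa> = K0"
  using sgp_image[OF ghom_\<kappa>, of "{ga, gb}"] by (simp add: sgp_gens K0_def \<kappa>_def)

text \<open>The images of the letters have length one or three, and between images of successive
  letters of a reduced word at most one letter cancels, namely the b between two conjugates. So the
  middle letters survive and \<open>lc\<close> holds.\<close>

lemma \<kappa>_eq_0:
  assumes "\<kappa> x = 0"
  shows "x = 0"
proof (rule ccontr)
  assume "x \<noteq> 0"
  define y where "y = conj gb ga"
  define F where "F l = \<kappa> (elt [l])" for l
  have F: "F (Gen_a, True) = ga" "F (Gen_a, False) = - ga" "F (Gen_b, True) = y" "F (Gen_b, False) = - y"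
    by (simp_all add: F_def elt_single \<kappa>_def sub_simps y_def)
  have "y = elt [(Gen_b, True), (Gen_a, True), (Gen_b, False)]"
    by (simp add: y_def conj_def elt_Cons[of _ "_ # _"] elt_single add.assoc diff_conv_add_uminus del: add_uminus_conv_diff)
  then have wy: "wd y = [(Gen_b, True), (Gen_a, True), (Gen_b, False)]"
    by (simp add: elt_reduced_wd letter_inv_def)
  have wF: "wd (F l) = (if fst l = Gen_a then [l] else [(Gen_b, True), (Gen_a, snd l), (Gen_b, False)])" for l
    by (cases l rule: sanov_letter.cases) (simp_all add: F wy wd_uminus letter_inv_def)
  have wF': "wd (- F l) = (if fst l = Gen_a then [letter_inv l] else [(Gen_b, True), (Gen_a, \<not> snd l), (Gen_b, False)])" for l
    by (cases l rule: sanov_letter.cases) (simp_all add: F wy wd_uminus letter_inv_def)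
  have gpF: "gp (- F l) (F k) = (if fst l = Gen_b \<and> fst k = Gen_b then 1 else 0)" if "k \<noteq> letter_inv l" for k l
    using that by (cases l rule: sanov_letter.cases; cases k rule: sanov_letter.cases)
      (simp_all add: wgp_def wF wF' letter_inv_def)
  have lenF: "len (F l) = (if fst l = Gen_a then 1 else 3)" for l by (simp add: len_def wF)
  have lenFF: "2 \<le> len (F l + F k)" if "k \<noteq> letter_inv l" for k l
    using wlen_plus[of "\<lambda>_. True" "F l" "F k"] gpF[OF that] lenF[of l] lenF[of k]
    by (cases "fst l"; cases "fst k") simp_all
  have nz: "F l \<noteq> 0" for l using lenF[of l] by (metis len_eq_0 one_neq_zero zero_neq_numeral)
  have lcF: "lc (map F w)" if "reduced w" for w
    using that
  proof (induction w rule: reduced.induct)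
    case (3 l k w)
    then have lk: "k \<noteq> letter_inv l" by simp
    have "gp (- F l) (F k) + gp (- F k) (hd (map F w)) < len (F k)" if "w \<noteq> []"
    proof -
      obtain n w' where w: "w = n # w'" using \<open>w \<noteq> []\<close> by (cases w) auto
      then have "n \<noteq> letter_inv k" using 3(2) by simp
      then show ?thesis using gpF[OF lk] gpF[of n k] lenF[of k] w by (cases "fst k") simp_all
    qed
    moreover have "2 * gp (- F l) (F k) \<le> len (F l)" "2 * gp (- F l) (F k) \<le> len (F k)"
      using gpF[OF lk] lenF[of l] lenF[of k] by auto
    ultimately show ?case using 3 lenFF[OF lk] by simp
  qed (simp_all add: nz)
  have "\<kappa> (elt w) = sum_list (map F w)" for w
  proof (induction w)
    case (Cons l w)
    then show ?case using elt_Cons[of l w] by (simp add: ghom_simps[OF ghom_\<kappa>] F_def)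
  qed (simp add: ghom_simps[OF ghom_\<kappa>])
  then have "\<kappa> x = sum_list (map F (wd x))" by (metis elt_wd)
  moreover have "sum_list (map F (wd x)) \<noteq> 0"
    using lc_sum[OF lcF[OF reduced_wd[of x]]] \<open>x \<noteq> 0\<close> by simp
  ultimately show False using assms by simp
qed

lemma \<kappa>_inject: "\<kappa> x = \<kappa> y \<Longrightarrow> x = y"
  using \<kappa>_eq_0[of "x - y"] ghom_diff[OF ghom_\<kappa>, of x y] by simp

text \<open>The square has trace 2, so its fixed subgroup is an image of \<open>K0\<close>, free of
  rank two. On it f restricts to an involution with non-abelian fixed subgroup, that is, to the
  identity. Then f fixes \<open>h ga\<close>, whose exponents must vanish because 1 is not an
  eigenvalue, and h cannot be invertible.\<close>

lemma nafix_trace_minus_two: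
  assumes f: "aut f" "nafix f" and d: "dt f = 1" "tr f = - 2"
  shows False
proof -
  define p q r s where "p = ea (f ga)" and "q = ea (f gb)" and "r = eb (f ga)" and "s = eb (f gb)"
  have fx: "ea (f u) = ea u * p + eb u * q" "eb (f u) = ea u * r + eb u * s" for u
    using aut_exponent[OF f(1), of u] by (simp_all add: p_def q_def r_def s_def)
  have det: "p * s - q * r = 1" and trc: "p + s = - 2"
    using d by (simp_all add: dt_def tr_def p_def q_def r_def s_def)
  have f_neq: "f \<noteq> id"
  proof
    assume "f = id"
    then show False using d(2) by (simp add: tr_def)
  qed
  have "f \<circ> f \<noteq> id"
  proof
    assume "f \<circ> f = id"
    then have "f = id" using nafix_involution[OF f] by (metis comp_apply id_apply)
    then show False using f_neq by simp
  qed
  moreover have "dt (f \<circ> f) = 1" "tr (f \<circ> f) = 2"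
    using d dt_comp[OF aut_ghom aut_ghom, OF f(1) f(1)] tr_square[OF aut_ghom[OF f(1)]] by simp_all
  ultimately obtain h where h: "aut h" "{x. (f \<circ> f) x = x} = h ` K0"
    using fixed_trace_two[of "f \<circ> f"] f aut_comp nafix_comp(1) by blast
  define j where "j = h \<circ> \<kappa>"
  have jr: "{x. f (f x) = x} = range j"
    using h(2) by (simp add: j_def range_\<kappa>[symmetric] image_comp)
  have j: "ghom j" "inj j"
    using h(1) \<kappa>_inject by (auto simp: j_def ghom_comp aut_ghom ghom_\<kappa> inj_def aut_inj)
  define F where "F x = the_inv j (f (j x))" for x
  have jF: "j (F x) = f (j x)" for x
  proof -
    have "f (f (j x)) = j x" using jr by blast
    then have "f (j x) \<in> range j" using jr by (metis (mono_tags, lifting) mem_Collect_eq)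
    then show ?thesis unfolding F_def using j(2) f_the_inv_into_f by metis
  qed
  have FF: "F (F x) = x" for x
  proof -
    have "j (F (F x)) = j x" using jr by (simp add: jF) blast
    then show ?thesis using j(2) by (simp add: inj_def)
  qed
  have "F (x + y) = F x + F y" for x y
    by (rule injD[OF j(2)]) (simp add: jF ghom_plus[OF j(1)] ghom_plus[OF aut_ghom[OF f(1)]])
  then have "aut F" by (intro autI[of F F]) (simp_all add: ghom_def FF)
  moreover have "nafix F"
  proof -
    obtain u v where uv: "f u = u" "f v = v" "u + v \<noteq> v + u" using f(2) by (auto simp: nafix_def)
    then have "u \<in> range j" "v \<in> range j" using jr by auto
    then obtain u0 v0 where 0: "u = j u0" "v = j v0" by blast
    have "F u0 = u0" "F v0 = v0" by (rule injD[OF j(2)]; use jF uv 0 in simp)+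
    moreover have "u0 + v0 \<noteq> v0 + u0" using uv(3) 0 by (metis ghom_plus[OF j(1)])
    ultimately show ?thesis unfolding nafix_def by blast
  qed
  ultimately have "F = id" using nafix_involution FF by blast
  then have "f (j x) = j x" for x using jF[of x] by simp
  from this[of ga] have fh: "f (h ga) = h ga" by (simp add: j_def \<kappa>_def)
  define x y where "x = ea (h ga)" and "y = eb (h ga)"
  have "x * p + y * q = x" "x * r + y * s = y" using fx[of "h ga"] fh by (simp_all add: x_def y_def)
  then have "(s - 1) * (x * p + y * q - x) - q * (x * r + y * s - y) = 0"
    "(p - 1) * (x * r + y * s - y) - r * (x * p + y * q - x) = 0" by simp_all
  then have "(p * s - q * r - (p + s) + 1) * x = 0" "(p * s - q * r - (p + s) + 1) * y = 0"
    by (simp_all add: algebra_simps)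
  then have "x = 0" "y = 0" using det trc by simp_all
  then have "dt h = 0" by (simp add: dt_def x_def y_def)
  then show False using aut_dt[OF h(1)] by simp
qed

text \<open>Squaring sends trace 1 to -1 and trace 0 to -2, and makes the trace at least 3 both for
  traces beyond 2 in absolute value and for determinant -1 with nonzero trace.\<close>

theorem fixed_nonabelian:
  assumes f: "aut f" "nafix f" "f \<noteq> id"
  shows "\<exists>h. aut h \<and> {x. f x = x} = h ` K0"
proof -
  note ff = aut_comp[OF f(1) f(1)] nafix_comp(1)[OF f(2)]
  have dff: "dt (f \<circ> f) = 1"
    using dt_comp[OF aut_ghom aut_ghom, OF f(1) f(1)] aut_dt[OF f(1)] by auto
  note tff = tr_square[OF aut_ghom[OF f(1)]]
  have small: "\<bar>t\<bar> < 3" if "t\<^sup>2 < 9" for t :: int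
    using that power_mono[of 3 "\<bar>t\<bar>" 2] by (cases "3 \<le> \<bar>t\<bar>") auto
  show ?thesis
  proof (cases "dt f = 1")
    case True
    have "\<not> 3 \<le> tr (f \<circ> f)" using nafix_hyperbolic[OF ff dff] by blast
    then have "(tr f)\<^sup>2 < 5" using tff True by simp
    then have "\<bar>tr f\<bar> < 3" using small by simp
    then consider "tr f = 2" | "tr f = 1" | "tr f = 0" | "tr f = - 1" | "tr f = - 2" by linarith
    then show ?thesis
    proof cases
      case 1
      then show ?thesis using fixed_trace_two f True by blast
    next
      case 2
      have "tr (f \<circ> f) = - 1" using tff True 2 by simp
      then show ?thesis using nafix_trace_minus_one[OF ff dff] by blast
    next
      case 3
      have "tr (f \<circ> f) = - 2" using tff True 3 by simp
      then show ?thesis using nafix_trace_minus_two[OF ff dff] by blast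
    next
      case 4
      then show ?thesis using nafix_trace_minus_one[OF f(1,2) True] by blast
    next
      case 5
      then show ?thesis using nafix_trace_minus_two[OF f(1,2) True] by blast
    qed
  next
    case False
    then have d: "dt f = - 1" using aut_dt[OF f(1)] by auto
    show ?thesis
    proof (cases "tr f = 0")
      case True
      then show ?thesis using nafix_det_minus_one[OF f(1,2) d] by blast
    next
      case False
      then have "1 \<le> (tr f)\<^sup>2" by (simp add: int_one_le_iff_zero_less)
      then have "3 \<le> tr (f \<circ> f)" using tff d by simp
      then show ?thesis using nafix_hyperbolic[OF ff dff] by blast
    qed
  qed
qed


section \<open>Fixed subgroups and certificates\<close>

definition fixgroup :: "gen fg set \<Rightarrow> bool" where
  "fixgroup H \<longleftrightarrow> (\<exists>f. aut f \<and> H = {x. f x = x})"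

lemma fixgroup_UNIV: "fixgroup UNIV"
  unfolding fixgroup_def by (intro exI[of _ id]) (simp add: aut_id)

lemma fixgroup_zero: "fixgroup {0}"
proof -
  interpret letter_involution letter_inv by standard simp_all
  have "u = 0" if "\<psi> u = u" for u
  proof -
    have "map letter_inv (wd u) = wd u" using that by (metis wd_\<psi>)
    then have "wd u = []" by (cases "wd u") auto
    then show ?thesis by simp
  qed
  then have "{0} = {x. \<psi> x = x}" by (auto simp: \<psi>_simps)
  then show ?thesis using aut_\<psi> unfolding fixgroup_def by blast
qed

lemma fixgroup_image_K0:
  assumes "aut h"
  shows "fixgroup (h ` K0)"
  unfolding fixgroup_def
proof (intro exI conjI)
  show "aut (h \<circ> shear 1 \<circ> finv h)" using assms by (simp add: aut_comp aut_inv aut_shear)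
  have "{x. (h \<circ> shear 1 \<circ> finv h) x = x} = h ` {x. shear 1 x = x}"
    using fixed_conjugate[of "finv h" h "h \<circ> shear 1 \<circ> finv h"] assms by simp
  then show "h ` K0 = {x. (h \<circ> shear 1 \<circ> finv h) x = x}" using fixed_shear[of 1] by simp
qed

lemma fixgroup_aut_image: "aut h \<Longrightarrow> fixgroup (h ` H) \<Longrightarrow> fixgroup H"
proof -
  assume h: "aut h" and "fixgroup (h ` H)"
  then obtain f where f: "aut f" "h ` H = {x. f x = x}" by (auto simp: fixgroup_def)
  have "H = finv h ` (h ` H)" using h by (simp add: image_comp o_def)
  also have "\<dots> = finv h ` {x. h (finv h (f (h (finv h x)))) = x}" using f(2) h by simp
  also have "\<dots> = {x. finv h (f (h x)) = x}"
    using fixed_conjugate[of h "finv h" "\<lambda>x. finv h (f (h x))"] h by simp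
  finally have "H = {x. (finv h \<circ> f \<circ> h) x = x}" by simp
  then show ?thesis using h f(1) unfolding fixgroup_def by (metis aut_comp aut_inv)
qed

subsection \<open>Cyclic subgroups\<close>

text \<open>Among the ways to write a nonzero member u as a multiple n of some z, the factor n is
  bounded by the length of u. For the largest n every element commuting with u is a multiple of z,
  and S becomes a subgroup of the integers.\<close>

lemma abelian_cyclic:
  fixes S :: "'g fg set"
  assumes closed: "0 \<in> S" "\<And>x y. x \<in> S \<Longrightarrow> y \<in> S \<Longrightarrow> x + y \<in> S" "\<And>x. x \<in> S \<Longrightarrow> - x \<in> S"
    and comm: "\<And>x y. x \<in> S \<Longrightarrow> y \<in> S \<Longrightarrow> x + y = y + x"
  shows "\<exists>v. S = sgp {v}"
proof (cases "S = {0}")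
  case True
  then show ?thesis by (intro exI[of _ 0]) (simp add: sgp_single)
next
  case False
  then obtain u where u: "u \<in> S" "u \<noteq> 0" using closed(1) by blast
  let ?Q = "\<lambda>n. \<exists>z. u = zmul (int n) z"
  have bound: "n \<le> len u" if "?Q n" for n
  proof -
    from that obtain z where z: "u = zmul (int n) z" by blast
    then have "z \<noteq> 0" using u(2) by auto
    then show ?thesis using len_zmul z by blast
  qed
  have "?Q 1" by (intro exI[of _ u]) simp
  then obtain n where n: "?Q n" "\<And>m. ?Q m \<Longrightarrow> m \<le> n"
    using Nat.ex_has_greatest_nat[of ?Q 1 "len u"] bound by blast
  then obtain z where z: "u = zmul (int n) z" by blast
  have n0: "n \<noteq> 0" using z u(2) by (intro notI) simp
  have sub: "S \<subseteq> sgp {z}"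
  proof
    fix w assume "w \<in> S"
    have "u + z = z + u" using zmul_commute[of "int n" z 1] z by simp
    then have "z + w = w + z" using commute_trans[OF u(2)] comm[OF u(1) \<open>w \<in> S\<close>] by blast
    then obtain t i j where t: "z = zmul i t" "w = zmul j t" using commute_root by blast
    have ut: "u = zmul (int n * i) t" using z t(1) by (simp add: zmul_mult)
    \<comment> \<open>Since z is the multiple i of t, u is a multiple of t up to sign by n times the
      absolute value of i; maximality of n makes that value 1.\<close>
    have "?Q (n * nat \<bar>i\<bar>)"
    proof (cases "0 \<le> i")
      case True
      then show ?thesis using ut by auto
    next
      case False
      then have "u = zmul (int (n * nat \<bar>i\<bar>)) (- t)"
        using ut zmul_mult[of "int n * - i" "- 1" t] zmul_uminus[of 1 t] by simp
      then show ?thesis by blast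
    qed
    then have "n * nat \<bar>i\<bar> \<le> n" by (rule n(2))
    moreover have "i \<noteq> 0" using ut u(2) by (intro notI) simp
    ultimately have "\<bar>i\<bar> = 1" using n0 by simp
    then have "i * i = 1" by (simp add: abs_if split: if_splits)
    then have "t = zmul i z" using t(1) by (metis zmul_mult zmul_1)
    then show "w \<in> sgp {z}" using t(2) by (auto simp: sgp_single simp flip: zmul_mult)
  qed
  define J where "J = {k. zmul k z \<in> S}"
  have J: "k \<in> J \<Longrightarrow> l \<in> J \<Longrightarrow> k + l \<in> J" "k \<in> J \<Longrightarrow> - k \<in> J" "0 \<in> J" for k l
    using closed by (simp_all add: J_def zmul_add zmul_uminus)
  have "int n \<in> J" using u(1) z by (simp add: J_def)
  then obtain k where k: "0 < k" "int k \<in> J" "\<And>m. 0 < m \<Longrightarrow> int m \<in> J \<Longrightarrow> k \<le> m"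
    using ex_has_least_nat[of "\<lambda>m. 0 < m \<and> int m \<in> J" n "\<lambda>m. m"] n0 by auto
  have mult: "l * int k \<in> J" for l
  proof (induction l rule: int_induct[of _ 0])
    case (step1 l)
    then show ?case using J(1)[of "l * int k" "int k"] k(2) by (simp add: algebra_simps)
  next
    case (step2 l)
    then show ?case using J(1)[of "l * int k" "- int k"] J(2)[OF k(2)] by (simp add: algebra_simps)
  qed (simp add: J)
  have dvd: "int k dvd l" if "l \<in> J" for l
  proof (rule ccontr)
    assume "\<not> int k dvd l"
    then have "l mod int k \<noteq> 0" by (simp add: dvd_eq_mod_eq_0)
    moreover have "0 \<le> l mod int k" "l mod int k < int k" using k(1) by simp_all
    ultimately have m: "0 < nat (l mod int k)" "nat (l mod int k) < k" by linarith+
    have "l mod int k = l + - (l div int k * int k)" by (simp add: minus_div_mult_eq_mod[symmetric])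
    then have "l mod int k \<in> J" using J mult that by metis
    then show False using k(3)[OF m(1)] m(2) \<open>0 \<le> l mod int k\<close> by simp
  qed
  have "S = sgp {zmul (int k) z}"
  proof
    show "S \<subseteq> sgp {zmul (int k) z}"
    proof
      fix w assume "w \<in> S"
      then obtain l where l: "w = zmul l z" using sub by (auto simp: sgp_single)
      then obtain c where "l = c * int k" using dvd \<open>w \<in> S\<close> by (metis J_def dvd_def mem_Collect_eq mult.commute)
      then show "w \<in> sgp {zmul (int k) z}" using l by (simp add: sgp_single zmul_mult)
    qed
    show "sgp {zmul (int k) z} \<subseteq> S"
      using mult by (auto simp: sgp_single J_def simp flip: zmul_mult)
  qed
  then show ?thesis by blast
qed

definition proper_power :: "'g fg \<Rightarrow> bool" where
  "proper_power v \<longleftrightarrow> (\<exists>w k. 2 \<le> k \<and> v = zmul k w)"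

lemma sgp_uminus_single: "sgp {- v} = sgp {v}"
proof (rule sgp_eqI)
  show "{- v} \<subseteq> sgp {v}" by (simp add: sgp_base sgp_uminus)
  have "- (- v) \<in> sgp {- v}" by (intro sgp_uminus sgp_base) simp
  then show "{v} \<subseteq> sgp {- v}" by simp
qed

text \<open>Conjugation by v fixes exactly the centraliser of v, which is cyclic and, as v has no
  proper root, generated by v.\<close>

lemma fixgroup_cyclic:
  assumes v: "v \<noteq> 0" "\<not> proper_power v"
  shows "fixgroup (sgp {v})"
proof -
  define S where "S = {x. conj v x = x}"
  have "\<exists>z. S = sgp {z}"
    by (rule abelian_cyclic)
      (simp_all add: S_def conj_simps, simp add: conj_eq_iff commute_trans[OF v(1)])
  then obtain z where z: "S = sgp {z}" by blast
  have "v \<in> S" by (simp add: S_def conj_eq_iff)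
  then obtain k where k: "v = zmul k z" using z by (auto simp: sgp_single)
  have "\<bar>k\<bar> = 1"
  proof (rule ccontr)
    assume "\<bar>k\<bar> \<noteq> 1"
    moreover have "k \<noteq> 0" using k v(1) by (intro notI) simp
    ultimately have "2 \<le> k \<or> 2 \<le> - k" by linarith
    moreover have "v = zmul (- k) (- z)"
      using k zmul_mult[of "- k" "- 1" z] zmul_uminus[of 1 z] by simp
    ultimately show False using v(2) k unfolding proper_power_def by blast
  qed
  then have "k = 1 \<or> k = - 1" by linarith
  then have "sgp {v} = sgp {z}"
    using k by (elim disjE) (simp_all add: zmul_uminus sgp_uminus_single)
  then show ?thesis using z aut_conj unfolding fixgroup_def S_def by metis
qed

text \<open>If f fixes \<open>zmul k w\<close>, then f w and w have the same multiple by k, so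
  uniqueness of roots makes w fixed as well.\<close>

lemma not_fixgroup_power:
  assumes "w \<noteq> 0" "2 \<le> k"
  shows "\<not> fixgroup (sgp {zmul k w})"
proof
  assume "fixgroup (sgp {zmul k w})"
  then obtain f where f: "aut f" "sgp {zmul k w} = {x. f x = x}" by (auto simp: fixgroup_def)
  then have "f (zmul k w) = zmul k w" using sgp_base[of "zmul k w" "{zmul k w}"] by auto
  then have "zmul k (f w) = zmul k w" by (simp add: ghom_zmul[OF aut_ghom[OF f(1)]])
  then have "f w = w" using zmul_inject[of k "f w" w] assms(2) by simp
  then have "w \<in> sgp {zmul k w}" using f(2) by simp
  then obtain j where "w = zmul j (zmul k w)" by (auto simp: sgp_single)
  then have "zmul (j * k - 1) w = 0" by (simp add: zmul_diff zmul_mult)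
  then have "j * k = 1" using assms(1) by (simp add: zmul_eq_0)
  then show False using assms(2) by (simp add: zmult_eq_1_iff)
qed

section \<open>Cyclically reduced elements and proper powers\<close>

definition cyc_reduced :: "'g fg \<Rightarrow> bool" where
  "cyc_reduced x \<longleftrightarrow> gp (- x) x = 0"

lemma gp_zmul:
  assumes "x \<noteq> 0"
  shows "gp (- x) (zmul (int (Suc m)) x) = gp (- x) x" "0 < gp (zmul (int (Suc m)) x) x"
proof -
  show "gp (- x) (zmul (int (Suc m)) x) = gp (- x) x"
  proof -
    define xs where "xs = replicate (Suc (Suc m)) x"
    have xs: "hd xs = x" "tl xs = replicate (Suc m) x" "hd (tl xs) = x" "tl xs \<noteq> []" "xs \<noteq> []"
      by (simp_all add: xs_def)
    have tl: "sum_list (tl xs) = zmul (int (Suc m)) x"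
      unfolding xs(2) by (rule sum_list_replicate_zmul)
    show ?thesis
      using lc_sum[OF lc_replicate[OF assms, of "Suc (Suc m)"], folded xs_def] xs(1,3-5) tl by simp
  qed
  have "0 < gp (zmul (int n) x) x" if "n = Suc m" for n
  proof (cases m)
    case 0
    have "gp x x = len x" using wlen_diff[of "\<lambda>_. True" x x] by simp
    then show ?thesis using that 0 assms by (simp add: len_pos)
  next
    case (Suc k)
    define ys where "ys = replicate n x"
    have ys: "hd ys = x" "tl ys = replicate (Suc k) x" "hd (tl ys) = x" "tl ys \<noteq> []" "ys \<noteq> []"
      using that Suc by (simp_all add: ys_def)
    have "sum_list ys = zmul (int n) x" unfolding ys_def by (rule sum_list_replicate_zmul)
    then have "gp (zmul (int n) x) x + gp (- x) x = len x"
      using lc_sum[OF lc_replicate[OF assms, of n], folded ys_def] ys(1,3-5) by simp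
    then show ?thesis using gp_uminus_self[OF assms] by linarith
  qed
  then show "0 < gp (zmul (int (Suc m)) x) x" by blast
qed

lemma wd_zmul_cyc_reduced:
  assumes "cyc_reduced x"
  shows "wd (zmul (int n) x) = concat (replicate n (wd x)) \<and> len (zmul (int n) x) = n * len x"
proof (cases "x = 0")
  case True
  then show ?thesis by (induction n) simp_all
next
  case False
  have "len (zmul (int n) x) = n * len x \<and> wd (zmul (int n) x) = concat (replicate n (wd x))"
  proof (induction n)
    case (Suc n)
    have "gp (- x) (zmul (int n) x) = 0"
    proof (cases n)
      case 0
      then show ?thesis using wgp_le(2)[of "\<lambda>_. True" "- x" 0] by simp
    next
      case (Suc m)
      then show ?thesis using gp_zmul(1)[OF False, of m] assms by (simp add: cyc_reduced_def)
    qed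
    then have "len (x + zmul (int n) x) = len x + len (zmul (int n) x)"
      using wlen_plus[of "\<lambda>_. True" x "zmul (int n) x"] by simp
    moreover from wd_plus_append[OF this]
    have "wd (x + zmul (int n) x) = wd x @ wd (zmul (int n) x)" .
    moreover have "zmul (int (Suc n)) x = x + zmul (int n) x"
      using zmul_succ[of "int n" x] by (simp add: add.commute)
    ultimately show ?case using Suc by simp
  qed simp
  then show ?thesis by blast
qed

text \<open>A multiple of x begins with the first letter of x and ends with its last one, so a
  cancellation of x with itself recurs in the multiple.\<close>

lemma cyc_reduced_root:
  assumes "cyc_reduced (zmul (int n) x)" "0 < n" "x \<noteq> 0"
  shows "cyc_reduced x"
proof (rule ccontr)
  assume "\<not> ?thesis"
  then have c: "0 < gp (- x) x" by (simp add: cyc_reduced_def)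
  obtain m where m: "n = Suc m" using assms(2) by (cases n) auto
  have g: "0 < gp (zmul (int n) y) y" if y: "y \<noteq> 0" for y :: "'a fg"
    using gp_zmul(2)[OF y, of m] m by simp
  have "zmul (int n) (- x) = - zmul (int n) x"
    by (metis mult.commute mult_minus1 zmul_1 zmul_mult zmul_uminus)
  then have "0 < gp (- zmul (int n) x) (- x)" using g[of "- x"] assms(3) by simp
  then have "0 < gp (- zmul (int n) x) x"
    using wgp_ultra[of "\<lambda>_. True" "- zmul (int n) x" "- x" x] c by simp
  moreover have "0 < gp x (zmul (int n) x)" using g[OF assms(3)] by (simp add: wgp_commute)
  ultimately have "0 < gp (- zmul (int n) x) (zmul (int n) x)"
    using wgp_ultra[of "\<lambda>_. True" "- zmul (int n) x" x "zmul (int n) x"] by simp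
  then show False using assms(1) by (simp add: cyc_reduced_def)
qed

text \<open>Multiples of a cyclically reduced element are literal repetitions of its word.
  Conversely a word equal to a proper rotation splits into two commuting parts, hence repeats one
  word. This turns the search for roots into a finite check.\<close>

lemma proper_power_iff_rotation:
  assumes "cyc_reduced x" "x \<noteq> 0"
  shows "proper_power x \<longleftrightarrow> (\<exists>d. 0 < d \<and> d < length (wd x) \<and> drop d (wd x) @ take d (wd x) = wd x)"
proof
  assume "proper_power x"
  then obtain w k where k: "2 \<le> k" "x = zmul k w" by (auto simp: proper_power_def)
  define n where "n = nat k"
  then have n: "2 \<le> n" "x = zmul (int n) w" using k by simp_all
  have w: "w \<noteq> 0" using n assms(2) by auto
  have "cyc_reduced w" using cyc_reduced_root[of n w] assms(1) n w by simp
  then have wx: "wd x = concat (replicate n (wd w))" using wd_zmul_cyc_reduced n(2) by blast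
  obtain m where m: "n = Suc (Suc m)" using n(1) by (metis add_2_eq_Suc le_Suc_ex)
  have "wd x = wd w @ concat (replicate (Suc m) (wd w))" using wx m by simp
  moreover have "concat (replicate (Suc m) (wd w)) @ wd w = wd w @ concat (replicate (Suc m) (wd w))"
    by (induction m) simp_all
  moreover have "0 < length (wd w)" using w by simp
  ultimately show "\<exists>d. 0 < d \<and> d < length (wd x) \<and> drop d (wd x) @ take d (wd x) = wd x"
    by (intro exI[of _ "length (wd w)"]) auto
next
  assume "\<exists>d. 0 < d \<and> d < length (wd x) \<and> drop d (wd x) @ take d (wd x) = wd x"
  then obtain d where d: "0 < d" "d < length (wd x)" "drop d (wd x) @ take d (wd x) = wd x" by blast
  then have "take d (wd x) @ drop d (wd x) = drop d (wd x) @ take d (wd x)" by simp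
  then obtain m n zs where z: "concat (replicate m zs) = take d (wd x)" "concat (replicate n zs) = drop d (wd x)"
    using comm_append_are_replicate by blast
  have "m \<noteq> 0"
  proof
    assume "m = 0"
    then have "take d (wd x) = []" using z(1) by simp
    then show False using d by simp
  qed
  moreover have "n \<noteq> 0"
  proof
    assume "n = 0"
    then have "drop d (wd x) = []" using z(2) by simp
    then show False using d by simp
  qed
  moreover have "x = zmul (int (m + n)) (elt zs)"
    by (metis z append_take_drop_id elt_append elt_concat_replicate elt_wd of_nat_add zmul_add)
  ultimately show "proper_power x" unfolding proper_power_def
    by (intro exI[of _ "elt zs"] exI[of _ "int (m + n)"]) simp
qed

lemma cyc_reduced_conjugate: "\<exists>g. cyc_reduced (conj g x)"
proof -
  obtain g where g: "\<And>h. len (conj g x) \<le> len (conj h x)"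
    using ex_has_least_nat[of "\<lambda>_. True" _ "\<lambda>h. len (conj h x)"] by blast
  define y where "y = conj g x"
  have "gp (- y) y = 0"
  proof (rule ccontr)
    assume c: "gp (- y) y \<noteq> 0"
    then have "y \<noteq> 0" using wgp_le(2)[of "\<lambda>_. True" "- y" y] by auto
    then have "1 \<le> len y" using len_pos[of y] by simp
    then obtain h where h: "len h = 1" "gp h y = 1" by (rule prefix_exists)
    have "len (- h + y + h) < len y"
      by (rule conj_shorter) (use h c in \<open>simp_all add: wgp_commute\<close>)
    moreover have "- h + y + h = conj (- h + g) x" by (simp add: conj_def y_def group_simps del: add_uminus_conv_diff)
    ultimately show False using g[of "- h + g"] by (simp add: y_def)
  qed
  then show ?thesis unfolding cyc_reduced_def y_def by blast
qed

subsection \<open>Conjugates of the subgroup generated by \<open>a\<close> and \<open>b a b\<inverse>\<close>\<close>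

text \<open>The Stallings graph of \<open>K0\<close> has two vertices, each carrying a loop labelled \<open>a\<close>, joined by
  an edge labelled \<open>b\<close>.\<close>

fun run :: "bool \<Rightarrow> gen word \<Rightarrow> bool option" where
  "run q [] = Some q"
| "run q ((Gen_a, s) # w) = run q w"
| "run q ((Gen_b, s) # w) = (if s \<noteq> q then run s w else None)"

text \<open>Coset representatives of the two vertices. \<open>False\<close> is the base vertex and
  \<open>True\<close> the end of the b-edge; a letter \<open>(Gen_b, s)\<close> leads to s and can
  be read only at the other vertex.\<close>

definition vertex :: "bool \<Rightarrow> gen fg" where
  "vertex q = (if q then gb else 0)"

lemma run_sound: "run q w = Some q' \<Longrightarrow> vertex q + elt w - vertex q' \<in> K0"
proof (induction q w rule: run.induct)
  case (1 q)
  then show ?case using K0_zmul(1)[of 0] by simp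
next
  case (2 q s w)
  have "vertex q + elt [(Gen_a, s)] - vertex q \<in> K0"
    using K0_zmul(1)[of 1] K0_zmul(1)[of "- 1"] K0_zmul(2)[of 1] K0_zmul(2)[of "- 1"]
    by (auto simp: vertex_def elt_single zmul_uminus)
  then have "(vertex q + elt [(Gen_a, s)] - vertex q) + (vertex q + elt w - vertex q') \<in> K0"
    using 2 unfolding K0_def by (intro sgp_add) simp_all
  then show ?case using elt_Cons[of "(Gen_a, s)" w]
    by (simp add: group_simps del: add_uminus_conv_diff)
next
  case (3 q s w)
  then have "s \<noteq> q" "run s w = Some q'" by (simp_all split: if_splits)
  then have "vertex s + elt w - vertex q' \<in> K0" using 3 by simp
  moreover have "vertex q + elt [(Gen_b, s)] = vertex s"
    using \<open>s \<noteq> q\<close> by (auto simp: vertex_def elt_single)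
  ultimately show ?case using elt_Cons[of "(Gen_b, s)" w] by (simp add: add.assoc[symmetric])
qed

lemma run_append: "run q (u @ v) = Option.bind (run q u) (\<lambda>p. run p v)"
  by (induction q u rule: run.induct) auto

lemma run_reduce: "run q w = Some q' \<Longrightarrow> run q (reduce w) = Some q'"
proof (induction q w rule: run.induct)
  case (2 q s w)
  have "run q (red_cons (Gen_a, s) v) = run q v" for v
    by (cases v) (auto simp: letter_inv_def)
  then show ?case using 2 by (simp add: reduce_def)
next
  case (3 q s w)
  then have s: "s \<noteq> q" "run s (reduce w) = Some q'" by (simp_all split: if_splits)
  have "run s v = Some q' \<Longrightarrow> run q (red_cons (Gen_b, s) v) = Some q'" for v
    using s(1) by (cases v) (auto simp: letter_inv_def split: if_splits)
  then show ?case using s(2) by (simp add: reduce_def)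
qed (simp add: reduce_def)

lemma conj_gb_ga: "conj gb ga = elt [(Gen_b, True), (Gen_a, True), (Gen_b, False)]"
  by (simp add: conj_def elt_Cons[of _ "_ # _"] elt_single add.assoc diff_conv_add_uminus del: add_uminus_conv_diff)

lemma run_complete:
  assumes "x \<in> K0"
  shows "run False (wd x) = Some False"
proof -
  have "\<exists>w. elt w = x \<and> run False w = Some False"
    using assms unfolding K0_def
  proof (induction rule: sgp.induct)
    case zero
    show ?case by (rule exI[of _ "[]"]) simp
  next
    case (plus u x)
    then obtain w where w: "elt w = x" "run False w = Some False" by blast
    obtain v where "elt v = u" "run False v = Some False"
      using plus(1) that[of "[(Gen_a, True)]"] that[of "[(Gen_b, True), (Gen_a, True), (Gen_b, False)]"]
      by (auto simp: elt_single conj_gb_ga)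
    then show ?case using w by (intro exI[of _ "v @ w"]) (simp add: elt_append run_append)
  next
    case (minus u x)
    then obtain w where w: "elt w = x" "run False w = Some False" by blast
    have "- elt [(Gen_b, True), (Gen_a, True), (Gen_b, False)] = elt [(Gen_b, True), (Gen_a, False), (Gen_b, False)]"
      by (simp add: elt_winv[symmetric] letter_inv_def)
    then obtain v where "elt v = - u" "run False v = Some False"
      using minus(1) that[of "[(Gen_a, False)]"] that[of "[(Gen_b, True), (Gen_a, False), (Gen_b, False)]"]
      by (auto simp: elt_single conj_gb_ga)
    then show ?case using w by (intro exI[of _ "v @ w"]) (simp add: elt_append run_append)
  qed
  then show ?thesis using run_reduce wd_elt by metis
qed

lemma conj_image: "conj g ` conj h ` S = conj (g + h) ` S"
  by (simp add: image_image conj_add[symmetric])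

lemma conj_image_K0: "x \<in> K0 \<Longrightarrow> conj x ` K0 = K0"
proof -
  have sub: "conj x ` K0 \<subseteq> K0" if "x \<in> K0" for x
    using that unfolding K0_def conj_def by (auto intro: sgp_closed)
  assume x: "x \<in> K0"
  then have "- x \<in> K0" unfolding K0_def by (rule sgp_uminus)
  have "K0 \<subseteq> conj x ` K0"
  proof
    fix y assume "y \<in> K0"
    then have "conj (- x) y \<in> K0" using sub[OF \<open>- x \<in> K0\<close>] by blast
    then show "y \<in> conj x ` K0" by (intro image_eqI[of _ _ "conj (- x) y"]) simp_all
  qed
  then show ?thesis using sub[OF x] by blast
qed

text \<open>A conjugate of \<open>K0\<close> containing a cyclically reduced element is based at a vertex of the
  Stallings graph, so there are only two of them.\<close>

lemma conjugate_K0_cyc_reduced: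
  assumes w: "cyc_reduced w" "w \<noteq> 0" "w \<in> conj k ` K0"
  shows "conj k ` K0 = K0 \<or> conj k ` K0 = conj (- gb) ` K0"
proof -
  define g where "g = - k"
  have gw: "conj g w \<in> K0" using w(3) by (auto simp: g_def)
  \<comment> \<open>The multiple z of w is longer than g, so g cannot cancel all of z from either
    side.\<close>
  define n where "n = len g + 1"
  define z where "z = zmul (int n) w"
  have zl: "len z = n * len w" using wd_zmul_cyc_reduced[OF w(1), of n] by (simp add: z_def)
  then have z_long: "len g < len z" using w(2) len_pos[of w] by (cases "len w") (auto simp: n_def)
  have zz: "z + z = zmul (int (2 * n)) w" by (simp add: z_def zmul_add[symmetric])
  then have "len (z + z) = 2 * len z" using wd_zmul_cyc_reduced[OF w(1), of "2 * n"] zl by simp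
  then have gz: "gp (- z) z = 0" using wlen_plus[of "\<lambda>_. True" z z] by simp
  \<comment> \<open>The word of \<open>conj g (z + z)\<close> is the concatenation of
    \<open>wd x1\<close> and \<open>wd x2\<close>. Reading it in the Stallings graph passes through
    some vertex q after x1, and since \<open>conj g z\<close> belongs to \<open>K0\<close>, g itself
    leads to q modulo \<open>K0\<close>.\<close>
  define x1 x2 where "x1 = g + z" and "x2 = z - g"
  have "0 < gp z x2"
    using wlen_diff[of "\<lambda>_. True" x2 z] wlen_plus_le[of "\<lambda>_. True" x2 g] z_long
    by (simp add: x2_def wgp_commute minus_diff_eq)
  then have "gp (- z) x2 = 0" using gp_transfer[of "\<lambda>_. True" "- z" z x2] gz by simp
  moreover have "0 < gp (- z) (- x1)"
    using wlen_diff[of "\<lambda>_. True" "- x1" "- z"] wlen_plus_le[of "\<lambda>_. True" "- g" x1] z_long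
    by (simp add: x1_def wgp_commute)
  ultimately have "gp x2 (- x1) = 0"
    using gp_transfer[of "\<lambda>_. True" x2 "- z" "- x1"] by (simp add: wgp_commute)
  then have "len (x1 + x2) = len x1 + len x2"
    using wlen_plus[of "\<lambda>_. True" x1 x2] by (simp add: wgp_commute)
  from wd_plus_append[OF this] have "wd (x1 + x2) = wd x1 @ wd x2" .
  moreover have "x1 + x2 = zmul (int (2 * n)) (conj g w)"
    unfolding ghom_zmul[OF ghom_conj, symmetric] zz[symmetric]
    by (simp add: x1_def x2_def conj_def group_simps del: add_uminus_conv_diff)
  then have "x1 + x2 \<in> K0" using gw unfolding K0_def by (simp only: zmul_in_sgp)
  ultimately obtain q where "run False (wd x1) = Some q"
    using run_complete[of "x1 + x2"] by (auto simp: run_append bind_eq_Some_conv)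
  then have "x1 - vertex q \<in> K0" using run_sound[of False "wd x1" q] by (simp add: vertex_def)
  moreover have "- conj g z \<in> K0"
    using gw unfolding z_def ghom_zmul[OF ghom_conj] K0_def by (intro sgp_uminus zmul_in_sgp)
  ultimately have "- conj g z + (x1 - vertex q) \<in> K0" unfolding K0_def by (intro sgp_add)
  then have gq: "g - vertex q \<in> K0"
    by (simp add: x1_def conj_def group_simps del: add_uminus_conv_diff)
  have "k = - vertex q + - (g - vertex q)" by (simp add: g_def group_simps del: add_uminus_conv_diff)
  then have "conj k ` K0 = conj (- vertex q) ` (conj (- (g - vertex q)) ` K0)"
    by (simp only: conj_image)
  also have "conj (- (g - vertex q)) ` K0 = K0"
    by (rule conj_image_K0) (use gq in \<open>simp only: K0_def sgp_uminus\<close>)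
  finally show ?thesis by (cases q) (simp_all add: vertex_def)
qed

section \<open>Images of the model subgroup under automorphisms\<close>

lemma image_K0_neg: "sub (- ga) gb ` K0 = K0" "sub ga (- gb) ` K0 = conj (- gb) ` K0"
proof -
  have 1: "sub (- ga) gb ` K0 = sgp {- ga, conj gb (- ga)}"
    unfolding K0_def sgp_image[OF ghom_sub] by (simp add: conj_def sub_simps)
  have "sgp {- ga, conj gb (- ga)} = K0" unfolding K0_def
  proof (rule sgp_eqI)
    show "{- ga, conj gb (- ga)} \<subseteq> sgp {ga, conj gb ga}"
      by (auto simp: conj_simps intro: sgp_closed)
    have "- (- ga) \<in> sgp {- ga, conj gb (- ga)}" "- conj gb (- ga) \<in> sgp {- ga, conj gb (- ga)}"
      by (intro sgp_uminus sgp_base; simp)+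
    then show "{ga, conj gb ga} \<subseteq> sgp {- ga, conj gb (- ga)}" by (simp add: conj_simps)
  qed
  then show "sub (- ga) gb ` K0 = K0" using 1 by simp
  have "conj (- gb) ` K0 = sgp {conj (- gb) ga, ga}"
    unfolding K0_def sgp_image[OF ghom_conj] by simp
  moreover have "sub ga (- gb) ` K0 = sgp {ga, conj (- gb) ga}"
    unfolding K0_def sgp_image[OF ghom_sub] by (simp add: conj_def sub_simps)
  ultimately show "sub ga (- gb) ` K0 = conj (- gb) ` K0" by (simp add: insert_commute)
qed

text \<open>The matrix is triangular, so up to signs f is inner composed with a shear, and shears
  fix \<open>K0\<close> pointwise. Hence among all automorphisms preserving the direction of a only
  conjugates of \<open>K0\<close> arise.\<close>

lemma aut_image_K0_horizontal:
  assumes f: "aut f" and e: "eb (f ga) = 0"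
  shows "\<exists>k. f ` K0 = conj k ` K0"
proof -
  \<comment> \<open>The second conjugate is included because inverting b exchanges \<open>K0\<close>
    with \<open>conj (- gb)\<close> applied to \<open>K0\<close>.\<close>
  have pos: "\<exists>k k'. f ` K0 = conj k ` K0 \<and> f ` (conj (- gb) ` K0) = conj k' ` K0"
    if f: "aut f" "eb (f ga) = 0" "ea (f ga) = 1" "eb (f gb) = 1" for f
  proof -
    define m where "m = ea (f gb)"
    have "\<exists>g. f = conj g \<circ> shear m"
      by (rule same_exponents_inner[OF f(1) aut_shear]) (simp_all add: f m_def)
    then obtain g where g: "f = conj g \<circ> shear m" by blast
    have fK: "f x = conj g x" if "x \<in> K0" for x using g shear_fixes_K0[OF that] by simp
    have "f (conj (- gb) x) = conj (g + - zmul m ga + - gb) x" if "x \<in> K0" for x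
      using shear_fixes_K0[OF that, of m]
      by (simp add: g conj_def shear_simps group_simps del: add_uminus_conv_diff)
    then show ?thesis using fK by (metis (no_types, lifting) image_cong image_image)
  qed
  define \<nu>1 \<nu>2 where "\<nu>1 = sub (- ga) gb" and "\<nu>2 = sub ga (- gb)"
  have \<nu>: "aut \<nu>1" "aut \<nu>2" "\<nu>1 ` K0 = K0" "\<nu>2 ` (conj (- gb) ` K0) = K0"
  proof -
    show "aut \<nu>1" "aut \<nu>2" "\<nu>1 ` K0 = K0" by (simp_all add: \<nu>1_def \<nu>2_def aut_elementary image_K0_neg)
    have "\<nu>2 \<circ> \<nu>2 = id" by (rule ghom_ext2) (simp_all add: \<nu>2_def ghom_comp ghom_sub ghom_id sub_simps)
    then have "\<nu>2 ` (\<nu>2 ` K0) = K0" by (simp add: image_comp)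
    then show "\<nu>2 ` (conj (- gb) ` K0) = K0" by (simp add: \<nu>2_def image_K0_neg)
  qed
  have neg: "\<exists>k. f ` K0 = conj k ` K0" if f: "aut f" "eb (f ga) = 0" "ea (f ga) = 1" for f
  proof -
    have "eb (f gb) = 1 \<or> eb (f gb) = - 1" using aut_dt[OF f(1)] f by (simp add: dt_def)
    then show ?thesis
    proof
      assume "eb (f gb) = - 1"
      then have "\<exists>k k'. (f \<circ> \<nu>2) ` K0 = conj k ` K0 \<and> (f \<circ> \<nu>2) ` (conj (- gb) ` K0) = conj k' ` K0"
        using f \<nu>(2) by (intro pos) (simp_all add: aut_comp \<nu>2_def ghom_simps[OF aut_ghom[OF f(1)]])
      then show ?thesis using \<nu>(4) by (metis image_comp)
    qed (use pos f in blast)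
  qed
  have "ea (f ga) = 1 \<or> ea (f ga) = - 1"
    using aut_dt[OF f] e zmult_eq_1_iff[of "ea (f ga)" "eb (f gb)"] zmult_eq_1_iff[of "ea (f ga)" "- eb (f gb)"]
    by (auto simp: dt_def)
  then show ?thesis
  proof
    assume "ea (f ga) = - 1"
    then have "\<exists>k. (f \<circ> \<nu>1) ` K0 = conj k ` K0"
      using f e \<nu>(1) by (intro neg) (simp_all add: aut_comp \<nu>1_def ghom_simps[OF aut_ghom[OF f]])
    then show ?thesis using \<nu>(3) by (metis image_comp)
  qed (use neg f e in blast)
qed

lemma exponents_of_image_K0:
  assumes "aut h" "u \<in> h ` K0" "v \<in> h ` K0"
  shows "ea u * eb v = eb u * ea v"
proof -
  have K: "eb x = 0" if "x \<in> K0" for x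
    using that unfolding K0_def by (induction rule: sgp.induct) auto
  obtain x y where "u = h x" "x \<in> K0" "v = h y" "y \<in> K0" using assms by blast
  then show ?thesis
    using aut_exponent[OF assms(1), of x] aut_exponent[OF assms(1), of y] K by simp
qed

subsection \<open>The two kinds of certificates\<close>

text \<open>The generator of a cyclic subgroup is given as a conjugate of a cyclically reduced r, on
  which being a proper power is checked by rotations.\<close>

definition yes_certificate :: "gen fg set \<Rightarrow> bool" where
  "yes_certificate H \<longleftrightarrow> H = {0} \<or> (\<exists>r g. cyc_reduced r \<and> r \<noteq> 0 \<and> \<not> proper_power r \<and> H = sgp {conj g r}) \<or>
     H = UNIV \<or> (\<exists>x y. sgp {x, y} = UNIV \<and> H = sgp {x, conj y x})"

text \<open>The kinds of evidence against \<open>H = \<langle>U\<rangle>\<close>: if \<open>H\<close> is generated by a proper power, the root is fixed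
  as well; elements of \<open>H\<close> with independent exponents are fixed only by inner automorphisms, hence only
  by the identity; otherwise a non-abelian \<open>H\<close> would have to be an image of \<open>K0\<close>, and in a basis where
  \<open>H\<close> has exponent \<open>0\<close> in \<open>b\<close>, and after a conjugation that makes an element of \<open>H\<close> cyclically reduced,
  only \<open>K0\<close> and \<open>b\<inverse> K0 b\<close> are possible.\<close>

definition no_certificate :: "gen fg set \<Rightarrow> gen fg set \<Rightarrow> bool" where
  "no_certificate U H \<longleftrightarrow> (\<exists>w k. w \<noteq> 0 \<and> 2 \<le> k \<and> H = sgp {zmul k w}) \<or>
     (\<exists>u\<in>U. \<exists>v\<in>U. ea u * eb v \<noteq> eb u * ea v \<and> H \<noteq> UNIV) \<or>
     (\<exists>u\<in>U. \<exists>v\<in>U. \<exists>x y g. \<exists>w\<in>U. u + v \<noteq> v + u \<and> sgp {x, y} = UNIV \<and> (\<forall>u\<in>U. eb (sub x y u) = 0) \<and>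
        cyc_reduced (conj g (sub x y w)) \<and> w \<noteq> 0 \<and>
        conj g ` sub x y ` H \<noteq> K0 \<and> conj g ` sub x y ` H \<noteq> conj (- gb) ` K0)"

lemma proper_power_conj: "proper_power (conj g r) \<Longrightarrow> proper_power r"
  unfolding proper_power_def by (metis conj_inverse(2) ghom_zmul[OF ghom_conj])

lemma yes_certificate_sound:
  assumes "yes_certificate H"
  shows "fixgroup H"
  using assms unfolding yes_certificate_def
proof (elim disjE exE conjE)
  fix r g assume r: "r \<noteq> 0" "\<not> proper_power r" "H = sgp {conj g r}"
  have "conj g r \<noteq> 0" using r(1) by (metis conj_inverse(2) conj_simps(2))
  then show ?thesis using fixgroup_cyclic[of "conj g r"] proper_power_conj r(2,3) by blast
next
  fix x y assume xy: "sgp {x, y} = UNIV" "H = sgp {x, conj y x}"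
  have "H = sub x y ` K0"
    unfolding K0_def sgp_image[OF ghom_sub] using xy(2) by (simp add: conj_def sub_simps)
  then show ?thesis using fixgroup_image_K0[OF aut_generators[OF xy(1)]] by simp
qed (simp_all add: fixgroup_zero fixgroup_UNIV)

lemma fixgroup_cases:
  assumes "fixgroup H" "u \<in> H" "v \<in> H" "u + v \<noteq> v + u"
  shows "H = UNIV \<or> (\<exists>h. aut h \<and> H = h ` K0)"
proof -
  obtain f where f: "aut f" "H = {x. f x = x}" using assms(1) by (auto simp: fixgroup_def)
  then have "nafix f" using assms by (auto simp: nafix_def)
  then show ?thesis using fixed_nonabelian[OF f(1)] f(2) by (cases "f = id") auto
qed

lemma no_certificate_sound:
  assumes "no_certificate U H" "H = sgp U"
  shows "\<not> fixgroup H"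
  using assms(1) unfolding no_certificate_def
proof (elim disjE exE bexE conjE)
  fix w :: "gen fg" and k :: int assume "w \<noteq> 0" "2 \<le> k" "H = sgp {zmul k w}"
  then show ?thesis using not_fixgroup_power by simp
next
  fix u v assume uv: "u \<in> U" "v \<in> U" "ea u * eb v \<noteq> eb u * ea v" "H \<noteq> UNIV"
  have "u + v \<noteq> v + u"
  proof
    assume "u + v = v + u"
    then obtain z i j where "u = zmul i z" "v = zmul j z" using commute_root by blast
    then show False using uv(3) by simp
  qed
  then show ?thesis
    using fixgroup_cases[of H u v] exponents_of_image_K0[of _ u v] uv assms(2) by (metis sgp_base)
next
  fix u v x y g w
  assume uv: "u \<in> U" "v \<in> U" "u + v \<noteq> v + u" and xy: "sgp {x, y} = UNIV" and eb0: "\<forall>u\<in>U. eb (sub x y u) = 0"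
    and w: "w \<in> U" "cyc_reduced (conj g (sub x y w))" "w \<noteq> 0"
    and neq: "conj g ` sub x y ` H \<noteq> K0" "conj g ` sub x y ` H \<noteq> conj (- gb) ` K0"
  note aut = aut_generators[OF xy]
  have eb: "eb (sub x y z) = 0" if "z \<in> H" for z
    using that unfolding assms(2) by (induction rule: sgp.induct) (auto simp: sub_simps eb0)
  show ?thesis
  proof
    assume "fixgroup H"
    then have "H = UNIV \<or> (\<exists>h. aut h \<and> H = h ` K0)"
      using fixgroup_cases[of H u v] uv assms(2) sgp_base by metis
    then show False
    proof (elim disjE exE conjE)
      assume "H = UNIV"
      then have "eb (sub x y (finv (sub x y) gb)) = 0" using eb by simp
      then show False using aut by simp
    next
      fix h assume h: "aut h" "H = h ` K0"
      have "ga \<in> K0" using K0_zmul(1)[of 1] by simp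
      then have "\<exists>k. (sub x y \<circ> h) ` K0 = conj k ` K0"
        using eb h by (intro aut_image_K0_horizontal) (simp_all add: aut_comp aut)
      then obtain k where "(sub x y \<circ> h) ` K0 = conj k ` K0" by blast
      then have "sub x y ` H = conj k ` K0" using h(2) by (simp add: image_comp)
      then have H: "conj g ` sub x y ` H = conj (g + k) ` K0" by (simp only: conj_image)
      have "w \<in> H" using w(1) assms(2) sgp_base by blast
      then have "conj g (sub x y w) \<in> conj (g + k) ` K0" using H by blast
      moreover have "conj g (sub x y w) \<noteq> 0"
        using w(3) aut_inj[OF aut_comp[OF aut_conj aut], of g w 0]
        by (simp add: ghom_zero[OF ghom_sub] conj_simps(2))
      ultimately show False using conjugate_K0_cyc_reduced[OF w(2)] neq H by metis
    qed
  qed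
qed

text \<open>Commuting generators make H cyclic. Otherwise, if H is not a fixed subgroup, either two
  generators have independent exponent vectors, or all exponent vectors lie on one line and an
  automorphism moves this line to the direction of a; the inequalities with both conjugates then
  hold because those are fixed subgroups.\<close>

lemma certificates_complete:
  assumes "finite U" "H = sgp U"
  shows "yes_certificate H \<or> no_certificate U H"
proof (cases "\<exists>u\<in>U. \<exists>v\<in>U. u + v \<noteq> v + u")
  case False
  have comm1: "u + x = x + u" if "u \<in> U" "x \<in> H" for u x
    using that(2) unfolding assms(2)
  proof (induction rule: sgp.induct)
    case (plus v x)
    then show ?case using False that(1) by (metis add.assoc)
  next
    case (minus v x)
    have "conj u v = v" using False that(1) minus(1) by (auto simp: conj_eq_iff)
    moreover have "conj u x = x" using minus by (simp add: conj_eq_iff)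
    ultimately have "conj u (- v + x) = - v + x" by (simp add: conj_simps del: add_uminus_conv_diff)
    then show ?case by (simp only: conj_eq_iff)
  qed simp
  have comm: "x + y = y + x" if "x \<in> H" "y \<in> H" for x y
    using that(1) unfolding assms(2)
  proof (induction rule: sgp.induct)
    case (plus u x)
    then show ?case using comm1[OF plus(1) that(2)] by (metis add.assoc)
  next
    case (minus u x)
    have "conj y u = u" using comm1[OF minus(1) that(2)] by (simp add: conj_eq_iff)
    moreover have "conj y x = x" using minus by (simp add: conj_eq_iff)
    ultimately have "conj y (- u + x) = - u + x" by (simp add: conj_simps del: add_uminus_conv_diff)
    then show ?case by (metis conj_eq_iff)
  qed simp
  have "\<exists>v. H = sgp {v}"
    by (rule abelian_cyclic) (use assms(2) in \<open>auto intro: sgp_closed comm\<close>)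
  then obtain v where v: "H = sgp {v}" by blast
  show ?thesis
  proof (cases "v = 0")
    case True
    then show ?thesis using v by (simp add: yes_certificate_def sgp_single)
  next
    case nz: False
    show ?thesis
    proof (cases "proper_power v")
      case True
      then obtain w k where "2 \<le> k" "v = zmul k w" by (auto simp: proper_power_def)
      then show ?thesis using v nz unfolding no_certificate_def by (metis zmul_zero)
    next
      case False
      obtain g where g: "cyc_reduced (conj g v)" using cyc_reduced_conjugate by blast
      have "conj g v \<noteq> 0" using nz by (metis conj_inverse(2) conj_simps(2))
      moreover have "\<not> proper_power (conj g v)" using False proper_power_conj by blast
      moreover have "H = sgp {conj (- g) (conj g v)}" using v by simp
      ultimately show ?thesis using g unfolding yes_certificate_def by blast
    qed
  qed
next
  case True
  then obtain u v where uv: "u \<in> U" "v \<in> U" "u + v \<noteq> v + u" by blast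
  have uvH: "u \<in> H" "v \<in> H" using uv assms(2) by (auto intro: sgp_base)
  show ?thesis
  proof (cases "fixgroup H")
    case True
    then have "H = UNIV \<or> (\<exists>h. aut h \<and> H = h ` K0)" using fixgroup_cases uvH uv(3) by blast
    moreover have "yes_certificate (h ` K0)" if h: "aut h" for h
    proof -
      have "h ` K0 = sgp {h ga, conj (h gb) (h ga)}"
        unfolding K0_def sgp_image[OF aut_ghom[OF h]] by (simp add: conj_def ghom_simps[OF aut_ghom[OF h]])
      then show ?thesis using generators_aut[OF h] unfolding yes_certificate_def by blast
    qed
    ultimately show ?thesis by (auto simp: yes_certificate_def)
  next
    case nf: False
    then have "H \<noteq> UNIV" using fixgroup_UNIV by auto
    show ?thesis
    proof (cases "\<exists>u\<in>U. \<exists>v\<in>U. ea u * eb v \<noteq> eb u * ea v")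
      case True
      then show ?thesis using \<open>H \<noteq> UNIV\<close> unfolding no_certificate_def by blast
    next
      case parallel: False
      have "\<exists>f. aut f \<and> (\<forall>u\<in>U. eb (f u) = 0)"
      proof (cases "\<exists>u\<in>U. ea u \<noteq> 0 \<or> eb u \<noteq> 0")
        case True
        then obtain w where w: "w \<in> U" "ea w \<noteq> 0 \<or> eb w \<noteq> 0" by blast
        \<comment> \<open>The linear form with coefficients \<open>eb w\<close> and
          \<open>- ea w\<close> vanishes on the exponents of w, hence on those of all
          generators.\<close>
        then obtain f d where f: "aut f" "d \<noteq> 0" "\<And>u. d * eb (f u) = eb w * ea u + - ea w * eb u"
          using aut_with_row_multiple[of "eb w" "- ea w"] by auto
        have "eb (f u) = 0" if "u \<in> U" for u
        proof -
          have "d * eb (f u) = 0" using f(3)[of u] parallel that w(1) by simp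
          then show ?thesis using f(2) by simp
        qed
        then show ?thesis using f(1) by blast
      next
        case False
        then show ?thesis by (intro exI[of _ id]) (simp add: aut_id)
      qed
      then obtain f where f: "aut f" "\<forall>u\<in>U. eb (f u) = 0" by blast
      have fs: "f = sub (f ga) (f gb)" by (rule ghom_sub_eq[OF aut_ghom[OF f(1)]])
      have "u \<noteq> 0" using uv(3) by auto
      obtain g where g: "cyc_reduced (conj g (f u))" using cyc_reduced_conjugate by blast
      have nfix: "\<not> fixgroup (conj g ` f ` H)"
        using nf f(1) aut_conj by (metis fixgroup_aut_image)
      have "conj g ` f ` H \<noteq> K0"
        using nfix fixgroup_image_K0[OF aut_id] by auto
      moreover have "conj g ` f ` H \<noteq> conj (- gb) ` K0"
        using nfix fixgroup_image_K0[OF aut_conj] by metis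
      ultimately have "no_certificate U H"
        using uv f(2) g \<open>u \<noteq> 0\<close> generators_aut[OF f(1)] fs unfolding no_certificate_def by metis
      then show ?thesis ..
    qed
  qed
qed


section \<open>Separating subgroups by permutations\<close>

text \<open>Permutations of finite support as lists of transpositions: every list denotes a
  permutation and its reversal the inverse, so the search for one has no side condition to
  check.\<close>

definition swaps :: "(nat \<times> nat) list \<Rightarrow> nat \<Rightarrow> nat" where
  "swaps s x = foldr (\<lambda>p x. if x = fst p then snd p else if x = snd p then fst p else x) s x"

lemma swaps_simps [simp]:
  "swaps [] x = x"
  "swaps (p # s) x = (if swaps s x = fst p then snd p else if swaps s x = snd p then fst p else swaps s x)"
  "swaps (s @ t) x = swaps s (swaps t x)"
  by (simp_all add: swaps_def)

lemma swaps_rev [simp]: "swaps (rev s) (swaps s x) = x" "swaps s (swaps (rev s) x) = x"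
proof -
  show 1: "swaps (rev s) (swaps s x) = x" for s x
    by (induction s) auto
  show "swaps s (swaps (rev s) x) = x" using 1[of "rev s"] by simp
qed

lemma permutation_as_swaps:
  assumes "p permutes S" "finite S"
  shows "\<exists>s. p = swaps s"
  using assms
proof (induction rule: permutes_induct)
  case id
  show ?case by (rule exI[of _ "[]"]) (simp add: fun_eq_iff)
next
  case (swap a b p)
  then obtain s where "p = swaps s" by blast
  then show ?case by (intro exI[of _ "(a, b) # s"]) (auto simp: fun_eq_iff transpose_def)
qed

text \<open>D and its image have complements of equal size in their union; a bijection between these
  complements completes p to a permutation.\<close>

lemma partial_injection_as_swaps:
  assumes "finite D" "inj_on p D"
  shows "\<exists>s. \<forall>n\<in>D. swaps s n = p n"
proof -
  define S where "S = D \<union> p ` D"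
  have "card (S - D) = card (S - p ` D)"
    using assms by (simp add: S_def card_Diff_subset card_image)
  then obtain g where g: "bij_betw g (S - D) (S - p ` D)"
    using finite_same_card_bij[of "S - D" "S - p ` D"] assms(1) by (auto simp: S_def)
  define \<pi> where "\<pi> x = (if x \<in> D then p x else if x \<in> S then g x else x)" for x
  have "bij_betw \<pi> D (p ` D)" using assms(2) by (simp add: bij_betw_def \<pi>_def inj_on_def)
  moreover have "bij_betw \<pi> (S - D) (S - p ` D)"
    using g by (subst bij_betw_cong[of _ _ g]) (auto simp: \<pi>_def)
  ultimately have "bij_betw \<pi> (D \<union> (S - D)) (p ` D \<union> (S - p ` D))"
    by (rule bij_betw_combine) auto
  moreover have "D \<union> (S - D) = S" "p ` D \<union> (S - p ` D) = S" by (auto simp: S_def)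
  ultimately have "bij_betw \<pi> S S" by simp
  then have "\<pi> permutes S" by (rule bij_imp_permutes) (auto simp: \<pi>_def S_def)
  then obtain s where "\<pi> = swaps s" using permutation_as_swaps assms(1) by (auto simp: S_def)
  then show ?thesis by (intro exI[of _ s]) (metis \<pi>_def)
qed

fun perm_letter :: "(nat \<times> nat) list \<Rightarrow> (nat \<times> nat) list \<Rightarrow> gen letter \<Rightarrow> nat \<Rightarrow> nat" where
  "perm_letter s t (Gen_a, True) = swaps s"
| "perm_letter s t (Gen_a, False) = swaps (rev s)"
| "perm_letter s t (Gen_b, True) = swaps t"
| "perm_letter s t (Gen_b, False) = swaps (rev t)"

definition perm_act :: "(nat \<times> nat) list \<Rightarrow> (nat \<times> nat) list \<Rightarrow> gen fg \<Rightarrow> nat \<Rightarrow> nat" where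
  "perm_act s t x n = foldr (perm_letter s t) (wd x) n"

lemma perm_letter_inverse: "perm_letter s t (letter_inv l) (perm_letter s t l n) = n"
  by (cases l rule: sanov_letter.cases) (simp_all add: letter_inv_def)

lemma perm_act_plus: "perm_act s t (x + y) n = perm_act s t x (perm_act s t y n)"
  unfolding perm_act_def by (rule foldr_wd_plus) (rule perm_letter_inverse)

lemma perm_act_zero [simp]: "perm_act s t 0 n = n"
  by (simp add: perm_act_def)

lemma perm_act_sgp:
  assumes "\<forall>u\<in>U. perm_act s t u n = n" "x \<in> sgp U"
  shows "perm_act s t x n = n"
  using assms(2)
proof (induction rule: sgp.induct)
  case (minus u x)
  have "perm_act s t (- u) (perm_act s t u n) = n" by (simp add: perm_act_plus[symmetric])
  then show ?case using minus assms(1) by (simp add: perm_act_plus del: add_uminus_conv_diff)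
qed (use assms(1) in \<open>simp_all add: perm_act_plus\<close>)

text \<open>The Schreier graph of the left cosets of suffixes of the generators and of \<open>x\<close> is completed
  to a permutation representation.\<close>

lemma separate_by_permutations:
  assumes "finite U" "x \<notin> sgp U"
  shows "\<exists>s t. (\<forall>u\<in>U. perm_act s t u 0 = 0) \<and> perm_act s t x 0 \<noteq> 0"
proof -
  define H where "H = sgp U"
  define cos where "cos y = (+) y ` H" for y
  have cos_eq: "cos y = H \<longleftrightarrow> y \<in> H" for y
  proof
    assume "cos y = H"
    then have "y + 0 \<in> H" using sgp.zero[of U] unfolding cos_def H_def by blast
    then show "y \<in> H" by simp
  next
    assume y: "y \<in> H"
    have "h \<in> (+) y ` H" if "h \<in> H" for h
      using y that unfolding H_def by (intro image_eqI[of _ _ "- y + h"] sgp_add sgp_uminus) simp_all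
    then show "cos y = H" using y unfolding cos_def H_def by (auto intro: sgp_add)
  qed
  have cos_plus: "(+) z ` cos y = cos (z + y)" for z y by (auto simp: cos_def image_image add.assoc)
  \<comment> \<open>The last letter of a word acts first, so the points visited from the base point
    are the cosets of its suffixes.\<close>
  define Q where "Q = (\<Union>u\<in>insert x U. (\<lambda>i. cos (elt (drop i (wd u)))) ` {..length (wd u)})"
  have "finite Q" using assms(1) by (simp add: Q_def)
  have suffix: "cos (elt s) \<in> Q" if u: "u \<in> insert x U" and s: "wd u = r @ s" for u r s
  proof -
    have "cos (elt (drop (length r) (wd u))) \<in> Q"
      unfolding Q_def using u s by (intro UN_I[of u] imageI) simp_all
    then show ?thesis using s by simp
  qed
  obtain f :: "gen fg set \<Rightarrow> nat" where f: "inj_on f Q"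
    using finite_imp_inj_to_nat_seg[OF \<open>finite Q\<close>] by blast
  \<comment> \<open>The subgroup itself gets the number 0, and the successor keeps all other cosets
    away from it.\<close>
  define \<nu> where "\<nu> q = (if q = H then 0 else Suc (f q))" for q
  have \<nu>: "inj_on \<nu> Q" using f by (auto simp: \<nu>_def inj_on_def)
  have gen_swaps: "\<exists>s. \<forall>q\<in>Q. (+) z ` q \<in> Q \<longrightarrow> swaps s (\<nu> q) = \<nu> ((+) z ` q)" for z
  proof -
    define D where "D = \<nu> ` {q \<in> Q. (+) z ` q \<in> Q}"
    define p where "p n = \<nu> ((+) z ` the_inv_into Q \<nu> n)" for n
    have p: "p (\<nu> q) = \<nu> ((+) z ` q)" if "q \<in> Q" for q
      using that by (simp add: p_def the_inv_into_f_f[OF \<nu>])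
    have "inj_on p D"
    proof (rule inj_onI)
      fix m n assume "m \<in> D" "n \<in> D" "p m = p n"
      then obtain q r where q: "m = \<nu> q" "q \<in> Q" "(+) z ` q \<in> Q" and r: "n = \<nu> r" "r \<in> Q" "(+) z ` r \<in> Q"
        unfolding D_def by blast
      then have "(+) z ` q = (+) z ` r" using \<open>p m = p n\<close> p \<nu> by (metis inj_onD)
      then have "q = r" by (simp add: inj_image_eq_iff)
      then show "m = n" using q r by simp
    qed
    moreover have "finite D" using \<open>finite Q\<close> by (simp add: D_def)
    ultimately obtain s where "\<forall>n\<in>D. swaps s n = p n" using partial_injection_as_swaps by blast
    then show ?thesis using p by (intro exI[of _ s]) (auto simp: D_def)
  qed
  obtain s where s: "\<And>q. q \<in> Q \<Longrightarrow> (+) ga ` q \<in> Q \<Longrightarrow> swaps s (\<nu> q) = \<nu> ((+) ga ` q)"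
    using gen_swaps by blast
  obtain t where t: "\<And>q. q \<in> Q \<Longrightarrow> (+) gb ` q \<in> Q \<Longrightarrow> swaps t (\<nu> q) = \<nu> ((+) gb ` q)"
    using gen_swaps by blast
  have inv: "(+) z ` ((+) (- z) ` q) = q" for z :: "gen fg" and q by (simp add: image_image)
  have step: "perm_letter s t l (\<nu> q) = \<nu> ((+) (elt [l]) ` q)" if "q \<in> Q" "(+) (elt [l]) ` q \<in> Q" for l q
  proof (cases l rule: sanov_letter.cases)
    case 1
    then show ?thesis using s that by (simp add: elt_single)
  next
    case 2
    then have "swaps s (\<nu> ((+) (- ga) ` q)) = \<nu> q"
      using s[of "(+) (- ga) ` q"] that by (simp add: elt_single inv)
    then have "swaps (rev s) (\<nu> q) = \<nu> ((+) (- ga) ` q)" by (metis swaps_rev(1))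
    then show ?thesis using 2 by (simp add: elt_single)
  next
    case 3
    then show ?thesis using t that by (simp add: elt_single)
  next
    case 4
    then have "swaps t (\<nu> ((+) (- gb) ` q)) = \<nu> q"
      using t[of "(+) (- gb) ` q"] that by (simp add: elt_single inv)
    then have "swaps (rev t) (\<nu> q) = \<nu> ((+) (- gb) ` q)" by (metis swaps_rev(1))
    then show ?thesis using 4 by (simp add: elt_single)
  qed
  have read: "foldr (perm_letter s t) w 0 = \<nu> (cos (elt w))" if "u \<in> insert x U" "wd u = r @ w" for u r w
    using that(2)
  proof (induction w arbitrary: r)
    case Nil
    have "cos 0 = H" using cos_eq[of 0] sgp.zero by (simp add: H_def)
    then show ?case by (simp add: \<nu>_def)
  next
    case (Cons l w)
    have "cos (elt w) \<in> Q" "cos (elt (l # w)) \<in> Q"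
      using suffix[OF that(1), of "r @ [l]" w] suffix[OF that(1), of r "l # w"] Cons.prems by simp_all
    moreover have "cos (elt (l # w)) = (+) (elt [l]) ` cos (elt w)"
      using elt_Cons[of l w] by (simp add: cos_plus)
    ultimately show ?case using Cons.IH[of "r @ [l]"] Cons.prems step[of "cos (elt w)" l] by simp
  qed
  have "perm_act s t u 0 = \<nu> (cos u)" if "u \<in> insert x U" for u
    using read[OF that, of "[]" "wd u"] by (simp add: perm_act_def)
  moreover have "\<nu> (cos u) = 0 \<longleftrightarrow> u \<in> H" for u by (simp add: \<nu>_def cos_eq)
  ultimately show ?thesis
    using assms(2) by (intro exI[of _ s] exI[of _ t]) (auto simp: H_def intro: sgp_base)
qed

lemma subgroups_neq_iff:
  assumes "finite U" "finite V"
  shows "sgp U \<noteq> sgp V \<longleftrightarrow>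
    (\<exists>s t. (\<forall>u\<in>U. perm_act s t u 0 = 0) \<noteq> (\<forall>v\<in>V. perm_act s t v 0 = 0))"
proof
  assume neq: "sgp U \<noteq> sgp V"
  have sep: "\<exists>s t. (\<forall>u\<in>A. perm_act s t u 0 = 0) \<and> \<not> (\<forall>v\<in>B. perm_act s t v 0 = 0)"
    if "finite A" "\<not> sgp B \<subseteq> sgp A" for A B
  proof -
    have "\<not> B \<subseteq> sgp A" using that(2) sgp_subset by blast
    then obtain v where "v \<in> B" "v \<notin> sgp A" by blast
    then show ?thesis using separate_by_permutations[OF that(1)] by metis
  qed
  consider "\<not> sgp V \<subseteq> sgp U" | "\<not> sgp U \<subseteq> sgp V" using neq by blast
  then show "\<exists>s t. (\<forall>u\<in>U. perm_act s t u 0 = 0) \<noteq> (\<forall>v\<in>V. perm_act s t v 0 = 0)"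
    by cases (use sep assms in meson)+
next
  assume "\<exists>s t. (\<forall>u\<in>U. perm_act s t u 0 = 0) \<noteq> (\<forall>v\<in>V. perm_act s t v 0 = 0)"
  then obtain s t where st: "(\<forall>u\<in>U. perm_act s t u 0 = 0) \<noteq> (\<forall>v\<in>V. perm_act s t v 0 = 0)" by blast
  have "(\<forall>u\<in>W. perm_act s t u 0 = 0) \<longleftrightarrow> (\<forall>x\<in>sgp W. perm_act s t x 0 = 0)" for W
    using perm_act_sgp[of W s t 0] sgp_base by blast
  then show "sgp U \<noteq> sgp V" using st by metis
qed


section \<open>Partial recursive functions on structured data\<close>

text \<open>The index type is free and \<open>args\<close> presents an index as an argument tuple,
  so one set of composition lemmas serves functions of one, two and three numbers as well as
  functions on coded data.\<close>

definition cp :: "('i \<Rightarrow> nat list) \<Rightarrow> ('i \<Rightarrow> nat) \<Rightarrow> bool" where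
  "cp args h \<longleftrightarrow> (\<exists>r. \<forall>i. rec_computes r (args i) (h i))"

definition c1 :: "(nat \<Rightarrow> nat) \<Rightarrow> bool" where
  "c1 f \<longleftrightarrow> cp (\<lambda>x. [x]) f"

definition c2 :: "(nat \<Rightarrow> nat \<Rightarrow> nat) \<Rightarrow> bool" where
  "c2 f \<longleftrightarrow> cp (\<lambda>p. [fst p, snd p]) (\<lambda>p. f (fst p) (snd p))"

definition c3 :: "(nat \<Rightarrow> nat \<Rightarrow> nat \<Rightarrow> nat) \<Rightarrow> bool" where
  "c3 f \<longleftrightarrow> cp (\<lambda>p. [fst p, fst (snd p), snd (snd p)]) (\<lambda>p. f (fst p) (fst (snd p)) (snd (snd p)))"

lemma cp_proj: "(\<And>i. k < length (args i)) \<Longrightarrow> (\<And>i. h i = args i ! k) \<Longrightarrow> cp args h"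
  unfolding cp_def by (intro exI[of _ "Proj k"]) (simp add: rec_computes.proj)

lemma cp_zero: "cp args (\<lambda>_. 0)"
  unfolding cp_def by (intro exI[of _ Zero]) (simp add: rec_computes.zero)

lemma c1D: "c1 f \<Longrightarrow> \<exists>r. \<forall>x. rec_computes r [x] (f x)"
  by (simp add: c1_def cp_def)

lemma c2D: "c2 f \<Longrightarrow> \<exists>r. \<forall>x y. rec_computes r [x, y] (f x y)"
  by (simp add: c2_def cp_def)

lemma c3D: "c3 f \<Longrightarrow> \<exists>r. \<forall>x y z. rec_computes r [x, y, z] (f x y z)"
  by (simp add: c3_def cp_def)

lemma cp_op1:
  assumes "c1 f" "cp args g"
  shows "cp args (\<lambda>i. f (g i))"
proof -
  obtain r s where rs: "\<And>x. rec_computes r [x] (f x)" "\<And>i. rec_computes s (args i) (g i)"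
    using c1D[OF assms(1)] assms(2) unfolding cp_def by blast
  have "rec_computes (Comp r [s]) (args i) (f (g i))" for i
    by (rule rec_computes.comp[where ys = "[g i]"]) (simp_all add: rs)
  then show ?thesis unfolding cp_def by blast
qed

lemma cp_op2:
  assumes "c2 f" "cp args g" "cp args h"
  shows "cp args (\<lambda>i. f (g i) (h i))"
proof -
  obtain r s t where rs: "\<And>x y. rec_computes r [x, y] (f x y)" "\<And>i. rec_computes s (args i) (g i)"
    "\<And>i. rec_computes t (args i) (h i)"
    using c2D[OF assms(1)] assms(2,3) unfolding cp_def by blast
  have "rec_computes (Comp r [s, t]) (args i) (f (g i) (h i))" for i
    by (rule rec_computes.comp[where ys = "[g i, h i]"]) (simp_all add: rs)
  then show ?thesis unfolding cp_def by blast
qed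

lemma cp_op3:
  assumes "c3 f" "cp args g" "cp args h" "cp args k"
  shows "cp args (\<lambda>i. f (g i) (h i) (k i))"
proof -
  obtain r s t u where rs: "\<And>x y z. rec_computes r [x, y, z] (f x y z)" "\<And>i. rec_computes s (args i) (g i)"
    "\<And>i. rec_computes t (args i) (h i)" "\<And>i. rec_computes u (args i) (k i)"
    using c3D[OF assms(1)] assms(2-4) unfolding cp_def by blast
  have "rec_computes (Comp r [s, t, u]) (args i) (f (g i) (h i) (k i))" for i
    by (rule rec_computes.comp[where ys = "[g i, h i, k i]"]) (simp_all add: rs)
  then show ?thesis unfolding cp_def by blast
qed

lemma c2_args: "c2 (\<lambda>x y. x)" "c2 (\<lambda>x y. y)"
  unfolding c2_def by (rule cp_proj[of 0] cp_proj[of 1]; simp)+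

lemma c3_args: "c3 (\<lambda>x y z. x)" "c3 (\<lambda>x y z. y)" "c3 (\<lambda>x y z. z)"
  unfolding c3_def by (rule cp_proj[of 0] cp_proj[of 1] cp_proj[of 2]; simp)+

lemma c1_id: "c1 (\<lambda>x. x)"
  unfolding c1_def by (rule cp_proj[of 0]) simp_all

lemma c1_Suc: "c1 Suc"
  unfolding c1_def cp_def by (intro exI[of _ Succ]) (simp add: rec_computes.succ)

lemma cp_const: "cp args (\<lambda>_. n)"
  by (induction n) (simp_all add: cp_zero cp_op1[OF c1_Suc])

lemma c2_rec:
  assumes "c1 f" "c3 g"
  shows "c2 (\<lambda>n x. rec_nat (f x) (\<lambda>k r. g k r x) n)"
proof -
  obtain r s where rs: "\<And>x. rec_computes r [x] (f x)" "\<And>x y z. rec_computes s [x, y, z] (g x y z)"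
    using c1D[OF assms(1)] c3D[OF assms(2)] by blast
  have "rec_computes (PrimRec r s) [n, x] (rec_nat (f x) (\<lambda>k r. g k r x) n)" for n x
    by (induction n) (auto intro: rec_computes.prim_0 rec_computes.prim_Suc rs)
  then show ?thesis unfolding c2_def cp_def by auto
qed

lemma c3_if: "c3 (\<lambda>b x y. if b = 0 then y else x)"
proof -
  have *: "rec_computes (PrimRec (Proj 1) (Proj 2)) [n, x, y] (if n = 0 then y else x)" for n x y
  proof (induction n)
    case 0
    have "rec_computes (Proj 1) [x, y] ([x, y] ! 1)" by (rule rec_computes.proj) simp
    then show ?case by (simp add: rec_computes.prim_0)
  next
    case (Suc n)
    have "rec_computes (Proj 2) [n, m, x, y] ([n, m, x, y] ! 2)" for m by (rule rec_computes.proj) simp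
    then show ?case using rec_computes.prim_Suc[OF Suc] by simp
  qed
  show ?thesis unfolding c3_def cp_def by (intro exI allI) (rule *)
qed

lemma c1_const: "c1 (\<lambda>_. n)"
  unfolding c1_def by (rule cp_const)

lemmas cp_args = c1_id[unfolded c1_def] c2_args[unfolded c2_def] c3_args[unfolded c3_def] cp_const

lemma c2_add: "c2 (+)"
proof -
  have "c3 (\<lambda>k r x. Suc r)" unfolding c3_def by (intro cp_op1[OF c1_Suc] cp_args)
  from c2_rec[OF c1_id this] have "c2 (\<lambda>n x. rec_nat x (\<lambda>k r. Suc r) n)" .
  moreover have "rec_nat x (\<lambda>k r. Suc r) n = n + x" for n x by (induction n) simp_all
  ultimately show ?thesis by (simp add: c2_def)
qed

lemma c2_mult: "c2 (*)"
proof -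
  have "c3 (\<lambda>k r x. r + x)" unfolding c3_def by (intro cp_op2[OF c2_add] cp_args)
  from c2_rec[OF c1_const this] have "c2 (\<lambda>n x. rec_nat 0 (\<lambda>k r. r + x) n)" .
  moreover have "rec_nat 0 (\<lambda>k r. r + x) n = n * x" for n x :: nat by (induction n) simp_all
  ultimately show ?thesis by (simp add: c2_def)
qed

lemma c1_pred: "c1 (\<lambda>n. n - 1)"
proof -
  have "c2 (\<lambda>n x. rec_nat 0 (\<lambda>k r. k) n)" by (rule c2_rec[OF c1_const c3_args(1)])
  then have "c1 (\<lambda>n. rec_nat 0 (\<lambda>k r. k) n)"
    unfolding c1_def by (rule cp_op2) (rule cp_args)+
  moreover have "rec_nat 0 (\<lambda>k r. k) n = n - 1" for n :: nat by (cases n) simp_all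
  ultimately show ?thesis by simp
qed

lemma c2_diff: "c2 (-)"
proof -
  have "c3 (\<lambda>k r x. r - 1)" unfolding c3_def by (intro cp_op1[OF c1_pred] cp_args)
  from c2_rec[OF c1_id this] have "c2 (\<lambda>n x. rec_nat x (\<lambda>k r. r - 1) n)" .
  moreover have "rec_nat x (\<lambda>k r. r - 1) n = x - n" for n x :: nat by (induction n) simp_all
  ultimately have "c2 (\<lambda>n x. x - n)" by (simp add: c2_def)
  then have "cp (\<lambda>p. [fst p, snd p]) (\<lambda>p. (\<lambda>n x. x - n) (snd p) (fst p :: nat))"
    by (rule cp_op2) (rule cp_args)+
  then show ?thesis by (simp add: c2_def)
qed

lemma c1_triangle: "c1 triangle"
proof -
  have "c3 (\<lambda>k r x. r + Suc k)" unfolding c3_def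
    by (intro cp_op2[OF c2_add] cp_op1[OF c1_Suc] cp_args)
  from c2_rec[OF c1_const this] have "c2 (\<lambda>n x. rec_nat 0 (\<lambda>k r. r + Suc k) n)" .
  then have "c1 (\<lambda>n. rec_nat 0 (\<lambda>k r. r + Suc k) n)"
    unfolding c1_def by (rule cp_op2) (rule cp_args)+
  moreover have "rec_nat 0 (\<lambda>k r. r + Suc k) n = triangle n" for n by (induction n) simp_all
  ultimately show ?thesis by simp
qed

lemma c2_prod_encode: "c2 (\<lambda>x y. prod_encode (x, y))"
  unfolding prod_encode_def c2_def prod.case
  by (intro cp_op2[OF c2_add] cp_op1[OF c1_triangle] c2_args[unfolded c2_def])

lemma c1_mu:
  assumes "c2 f" "\<And>x. \<exists>n. f n x = 0"
  shows "c1 (\<lambda>x. LEAST n. f n x = 0)"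
proof -
  obtain r where r: "\<And>x y. rec_computes r [x, y] (f x y)" using c2D[OF assms(1)] by blast
  have "rec_computes (Mu r) [x] (LEAST n. f n x = 0)" for x
  proof (rule rec_computes.mu)
    have "f (LEAST n. f n x = 0) x = 0" using assms(2)[of x] by (rule LeastI_ex)
    then show "rec_computes r [LEAST n. f n x = 0, x] 0" using r by metis
    have "rec_computes r [m, x] (Suc (f m x - 1))" if "m < (LEAST n. f n x = 0)" for m
      using not_less_Least[OF that] r[of m x] by simp
    then show "\<forall>m<LEAST n. f n x = 0. \<exists>k. rec_computes r [m, x] (Suc k)" by blast
  qed
  then show ?thesis unfolding c1_def cp_def by blast
qed

text \<open>The pairing sends (m, k) to \<open>triangle (m + k) + m\<close>. The diagonal m + k is
  the least s with z < \<open>triangle (Suc s)\<close>, a condition expressed by truncated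
  subtraction and found by minimisation.\<close>

lemma c1_prod_decode: "c1 (\<lambda>z. fst (prod_decode z))" "c1 (\<lambda>z. snd (prod_decode z))"
proof -
  define root where "root z = (LEAST s. Suc z - triangle (Suc s) = 0)" for z
  have ex: "\<exists>s. Suc z - triangle (Suc s) = 0" for z
  proof -
    have "z \<le> triangle z" by (induction z) simp_all
    then show ?thesis by (intro exI[of _ z]) simp
  qed
  have "c2 (\<lambda>s z. Suc z - triangle (Suc s))"
    unfolding c2_def
    by (intro cp_op2[OF c2_diff] cp_op1[OF c1_Suc] cp_op1[OF c1_triangle] c2_args[unfolded c2_def])
  then have root: "c1 root" unfolding root_def using ex by (rule c1_mu)
  have mono: "m \<le> n \<Longrightarrow> triangle m \<le> triangle n" for m n
    by (induction n) (auto simp: le_Suc_eq)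
  have rt: "root (prod_encode (m, k)) = m + k" for m k
    unfolding root_def
  proof (rule Least_equality)
    fix s assume "Suc (prod_encode (m, k)) - triangle (Suc s) = 0"
    then have "triangle (m + k) < triangle (Suc s)" by (simp add: prod_encode_def)
    then show "m + k \<le> s" using mono[of "Suc s" "m + k"] by linarith
  qed (simp add: prod_encode_def)
  have fs: "fst (prod_decode z) = z - triangle (root z) \<and> snd (prod_decode z) = root z - (z - triangle (root z))" for z
  proof -
    obtain m k where mk: "prod_decode z = (m, k)" by (cases "prod_decode z")
    then have z: "z = prod_encode (m, k)" by (metis prod_decode_inverse)
    have "root z = m + k" "z = triangle (m + k) + m" using rt[of m k] by (simp_all add: z prod_encode_def)
    then have "z - triangle (root z) = m" "root z - (z - triangle (root z)) = k" by simp_all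
    then show ?thesis unfolding mk by simp
  qed
  then have f: "fst (prod_decode z) = z - triangle (root z)"
    and s: "snd (prod_decode z) = root z - (z - triangle (root z))" for z by blast+
  show "c1 (\<lambda>z. fst (prod_decode z))" unfolding f c1_def
    by (intro cp_op2[OF c2_diff] cp_op1[OF c1_triangle] cp_op1[OF root] c1_id[unfolded c1_def])
  show "c1 (\<lambda>z. snd (prod_decode z))" unfolding s c1_def
    by (intro cp_op2[OF c2_diff] cp_op1[OF c1_triangle] cp_op1[OF root] c1_id[unfolded c1_def])
qed

subsection \<open>Codes\<close>

text \<open>Codes are bijective, so every number decodes to a datum and a search through the numbers
  is a search through all data.\<close>

class coded =
  fixes code :: "'a \<Rightarrow> nat"
  assumes bij_code: "bij code"

instantiation nat :: coded
begin
definition "code (n :: nat) = n"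
instance
proof
  have eq: "code = (\<lambda>n :: nat. n)" by (simp add: code_nat_def fun_eq_iff)
  show "bij (code :: nat \<Rightarrow> nat)" unfolding eq by (simp add: bij_def)
qed
end

instantiation prod :: (coded, coded) coded
begin
definition "code p = prod_encode (code (fst p), code (snd p))"
instance
proof
  have eq: "code = prod_encode \<circ> map_prod code code" (is "(code :: 'a \<times> 'b \<Rightarrow> nat) = _")
    by (simp add: code_prod_def fun_eq_iff)
  have "bij (map_prod (code :: 'a \<Rightarrow> nat) (code :: 'b \<Rightarrow> nat))"
    using bij_code[where 'a = 'a] bij_code[where 'a = 'b]
    by (simp add: bij_def prod.inj_map map_prod_surj)
  then show "bij (code :: 'a \<times> 'b \<Rightarrow> nat)" unfolding eq by (intro bij_comp bij_prod_encode)
qed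
end

instantiation list :: (coded) coded
begin
definition "code xs = list_encode (map code xs)"
instance
proof
  have eq: "code = list_encode \<circ> map code" (is "(code :: 'a list \<Rightarrow> nat) = _")
    by (simp add: code_list_def fun_eq_iff)
  have "surj (map (code :: 'a \<Rightarrow> nat))"
    by (rule surjI[of _ "map (inv_into UNIV code)"])
      (simp add: o_def surj_f_inv_f[OF bij_is_surj[OF bij_code]])
  then have "bij (map (code :: 'a \<Rightarrow> nat))"
    using bij_code[where 'a = 'a] by (simp add: bij_def)
  then show "bij (code :: 'a list \<Rightarrow> nat)" unfolding eq by (intro bij_comp bij_list_encode)
qed
end

lemma code_eq_iff: "code x = code y \<longleftrightarrow> x = y"
  by (simp add: bij_code bij_is_inj inj_eq)

lemma code_surj: "\<exists>x. code x = n"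
  by (metis bij_code bij_pointE)

lemma code_Nil: "code [] = 0"
  by (simp add: code_list_def)

lemma code_Cons: "code (x # xs) = Suc (code (x, xs))"
  by (simp add: code_list_def code_prod_def)

definition cn :: "('a :: coded \<Rightarrow> nat) \<Rightarrow> bool" where
  "cn h \<longleftrightarrow> cp (\<lambda>x. [code x]) h"

definition cfun :: "('a :: coded \<Rightarrow> 'b :: coded) \<Rightarrow> bool" where
  "cfun f \<longleftrightarrow> cn (\<lambda>x. code (f x))"

definition cpred :: "('a :: coded \<Rightarrow> bool) \<Rightarrow> bool" where
  "cpred P \<longleftrightarrow> cn (\<lambda>x. if P x then 1 else 0)"

lemmas cn_op1 = cp_op1[where args = "\<lambda>x :: _ :: coded. [code x]", folded cn_def]
lemmas cn_op2 = cp_op2[where args = "\<lambda>x :: _ :: coded. [code x]", folded cn_def]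
lemmas cn_op3 = cp_op3[where args = "\<lambda>x :: _ :: coded. [code x]", folded cn_def]

lemma cn_const: "cn (\<lambda>_. n)"
  by (simp add: cn_def cp_const)

lemma cn_code: "cfun f \<Longrightarrow> cn (\<lambda>x. code (f x))"
  by (simp add: cfun_def)

lemma cn_comp:
  assumes "cn h" "cfun f"
  shows "cn (\<lambda>x. h (f x))"
proof -
  obtain r s where rs: "\<And>y. rec_computes r [code y] (h y)" "\<And>x. rec_computes s [code x] (code (f x))"
    using assms unfolding cn_def cp_def cfun_def by blast
  have "rec_computes (Comp r [s]) [code x] (h (f x))" for x
    by (rule rec_computes.comp[where ys = "[code (f x)]"]) (simp_all add: rs)
  then show ?thesis unfolding cn_def cp_def by blast
qed

lemma cfun_comp: "cfun g \<Longrightarrow> cfun f \<Longrightarrow> cfun (\<lambda>x. g (f x))"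
  unfolding cfun_def[of g] cfun_def[of "\<lambda>x. g (f x)"] by (rule cn_comp)

lemma cpred_comp: "cpred P \<Longrightarrow> cfun f \<Longrightarrow> cpred (\<lambda>x. P (f x))"
  unfolding cpred_def by (rule cn_comp)

lemma cfun_const: "cfun (\<lambda>_. c)"
  by (simp add: cfun_def cn_const)

lemma cfun_id: "cfun (\<lambda>x. x)"
  unfolding cfun_def cn_def by (rule cp_proj[of 0]) simp_all

lemma cfun_Pair: "cfun f \<Longrightarrow> cfun g \<Longrightarrow> cfun (\<lambda>x. (f x, g x))"
  unfolding cfun_def code_prod_def fst_conv snd_conv by (rule cn_op2[OF c2_prod_encode])

lemma cfun_fst: "cfun f \<Longrightarrow> cfun (\<lambda>x. fst (f x))"
  unfolding cfun_def by (drule cn_op1[OF c1_prod_decode(1)]) (simp add: code_prod_def)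

lemma cfun_snd: "cfun f \<Longrightarrow> cfun (\<lambda>x. snd (f x))"
  unfolding cfun_def by (drule cn_op1[OF c1_prod_decode(2)]) (simp add: code_prod_def)

lemma cfun_nat: "cfun h \<longleftrightarrow> cn h"
  by (simp add: cfun_def code_nat_def)

lemma cfun_Suc: "cfun f \<Longrightarrow> cfun (\<lambda>x. Suc (f x))"
  unfolding cfun_nat by (rule cn_op1[OF c1_Suc])

lemma cfun_plus: "cfun f \<Longrightarrow> cfun g \<Longrightarrow> cfun (\<lambda>x. f x + g x :: nat)"
  unfolding cfun_nat by (rule cn_op2[OF c2_add])

lemma cfun_times: "cfun f \<Longrightarrow> cfun g \<Longrightarrow> cfun (\<lambda>x. f x * g x :: nat)"
  unfolding cfun_nat by (rule cn_op2[OF c2_mult])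

lemma cfun_minus: "cfun f \<Longrightarrow> cfun g \<Longrightarrow> cfun (\<lambda>x. f x - g x :: nat)"
  unfolding cfun_nat by (rule cn_op2[OF c2_diff])

lemma cpred_zero: "cn f \<Longrightarrow> cpred (\<lambda>x. f x = 0)"
  unfolding cpred_def using cn_op3[OF c3_if _ cn_const[of 0] cn_const[of 1], of f] by simp

lemma cpred_not: "cpred P \<Longrightarrow> cpred (\<lambda>x. \<not> P x)"
proof -
  assume "cpred P"
  then have "cpred (\<lambda>x. (if P x then 1 else 0) = (0 :: nat))"
    unfolding cpred_def[of P] by (rule cpred_zero)
  moreover have "(\<lambda>x. (if P x then 1 else 0) = (0 :: nat)) = (\<lambda>x. \<not> P x)" by auto
  ultimately show ?thesis by (rule back_subst)
qed

lemma cpred_eq: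
  assumes "cfun f" "cfun g"
  shows "cpred (\<lambda>x. f x = g x)"
proof -
  have *: "(m - n) + (n - m) = 0 \<longleftrightarrow> m = n" for m n :: nat by auto
  have "cn (\<lambda>x. (code (f x) - code (g x)) + (code (g x) - code (f x)))"
    using assms unfolding cfun_def by (intro cn_op2[OF c2_add] cn_op2[OF c2_diff])
  from cpred_zero[OF this] show ?thesis by (simp only: * code_eq_iff)
qed

lemma cpred_less:
  assumes "cfun f" "cfun g"
  shows "cpred (\<lambda>x. f x < (g x :: nat))"
proof -
  have "cn (\<lambda>x. Suc (f x) - g x)"
    using assms unfolding cfun_nat by (intro cn_op2[OF c2_diff] cn_op1[OF c1_Suc])
  from cpred_zero[OF this] show ?thesis by (simp add: Suc_le_eq)
qed

lemma cfun_if: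
  assumes "cpred P" "cfun f" "cfun g"
  shows "cfun (\<lambda>x. if P x then f x else g x)"
proof -
  have "cn (\<lambda>x. if (if P x then 1 else 0) = (0 :: nat) then code (g x) else code (f x))"
    using assms unfolding cpred_def cfun_def by (rule cn_op3[OF c3_if])
  moreover have "(if (if P x then 1 else 0) = (0 :: nat) then code (g x) else code (f x)) =
    code (if P x then f x else g x)" for x by simp
  ultimately show ?thesis by (simp add: cfun_def)
qed

lemma cpred_conj: "cpred P \<Longrightarrow> cpred Q \<Longrightarrow> cpred (\<lambda>x. P x \<and> Q x)"
proof -
  assume "cpred P" "cpred Q"
  then have "cn (\<lambda>x. (if P x then 1 else 0) * (if Q x then 1 else 0))"
    unfolding cpred_def by (rule cn_op2[OF c2_mult])
  moreover have "(\<lambda>x. (if P x then 1 else 0) * (if Q x then 1 else 0)) = (\<lambda>x. if P x \<and> Q x then 1 else 0 :: nat)"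
    by auto
  ultimately show ?thesis unfolding cpred_def by (rule back_subst)
qed

lemma cpred_disj: "cpred P \<Longrightarrow> cpred Q \<Longrightarrow> cpred (\<lambda>x. P x \<or> Q x)"
  using cpred_not[OF cpred_conj[OF cpred_not cpred_not, of P Q]] by simp

subsection \<open>Iteration and lists\<close>

lemma cfun_Cons: "cfun f \<Longrightarrow> cfun g \<Longrightarrow> cfun (\<lambda>x. f x # g x)"
  using cn_op1[OF c1_Suc, OF cn_code[OF cfun_Pair]] by (simp add: cfun_def code_Cons)

lemma cfun_case_list:
  assumes l: "cfun l" and f: "cfun f" and g: "cfun (\<lambda>q. g (fst q) (fst (snd q)) (snd (snd q)))"
  shows "cfun (\<lambda>p. case l p of [] \<Rightarrow> f p | x # xs \<Rightarrow> g p x xs)"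
proof -
  obtain r where r: "\<And>q. rec_computes r [code q] (code (g (fst q) (fst (snd q)) (snd (snd q))))"
    using g unfolding cfun_def cn_def cp_def by blast
  \<comment> \<open>G is the branch function read off codes: 0 codes the empty list, and the
    predecessor of any other code is the code of head and tail as a pair.\<close>
  define G where "G n = code ((\<lambda>q. g (fst q) (fst (snd q)) (snd (snd q))) (SOME q. code q = n))" for n
  have "c1 G"
    unfolding c1_def cp_def G_def
  proof (intro exI[of _ r] allI)
    fix n
    have "code (SOME q :: 'a \<times> 'b \<times> 'b list. code q = n) = n" by (rule someI_ex[OF code_surj])
    then show "rec_computes r [n] (code ((\<lambda>q. g (fst q) (fst (snd q)) (snd (snd q))) (SOME q. code q = n)))"
      using r[of "SOME q. code q = n"] by simp
  qed
  have "cn (\<lambda>p. if code (l p) = 0 then code (f p) else G (prod_encode (code p, code (l p) - 1)))"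
    using l f cfun_id unfolding cfun_def
    by (intro cn_op3[OF c3_if] cn_op1[OF \<open>c1 G\<close>] cn_op2[OF c2_prod_encode] cn_op1[OF c1_pred])
  moreover have "(if code (l p) = 0 then code (f p) else G (prod_encode (code p, code (l p) - 1))) =
    code (case l p of [] \<Rightarrow> f p | x # xs \<Rightarrow> g p x xs)" for p
  proof (cases "l p")
    case (Cons x xs)
    have "prod_encode (code p, code (x, xs)) = code (p, x, xs)" by (simp add: code_prod_def)
    moreover have "(SOME q. code q = code (p, x, xs)) = (p, x, xs)"
      by (rule some_equality) (simp_all add: code_eq_iff)
    ultimately show ?thesis using Cons by (simp add: code_Cons G_def)
  qed (simp add: code_Nil)
  ultimately show ?thesis by (simp add: cfun_def)
qed

lemma cfun_funpow:
  fixes step :: "'s :: coded \<Rightarrow> 's"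
  assumes "cfun step" "cn n" "cfun i"
  shows "cfun (\<lambda>x. (step ^^ n x) (i x))"
proof -
  obtain r where r: "\<And>s. rec_computes r [code s] (code (step s))"
    using assms(1) unfolding cfun_def cn_def cp_def by blast
  obtain rn ri where rn: "\<And>x. rec_computes rn [code x] (n x)" "\<And>x. rec_computes ri [code x] (code (i x))"
    using assms(2,3) unfolding cfun_def cn_def cp_def by blast
  have it: "rec_computes (PrimRec (Proj 0) (Comp r [Proj 1])) [k, code s] (code ((step ^^ k) s))" for k s
  proof (induction k)
    case 0
    have "rec_computes (Proj 0) [code s] ([code s] ! 0)" by (rule rec_computes.proj) simp
    then show ?case by (simp add: rec_computes.prim_0)
  next
    case (Suc k)
    have "rec_computes (Proj 1) [k, m, code s] ([k, m, code s] ! 1)" for m by (rule rec_computes.proj) simp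
    then have "rec_computes (Comp r [Proj 1]) [k, code ((step ^^ k) s), code s] (code (step ((step ^^ k) s)))"
      by (intro rec_computes.comp[where ys = "[code ((step ^^ k) s)]"] r) simp
    then show ?case using rec_computes.prim_Suc[OF Suc] by simp
  qed
  have "rec_computes (Comp (PrimRec (Proj 0) (Comp r [Proj 1])) [rn, ri]) [code x] (code ((step ^^ n x) (i x)))" for x
    by (rule rec_computes.comp[where ys = "[n x, code (i x)]"]) (use rn it in simp_all)
  then show ?thesis unfolding cfun_def cn_def cp_def by blast
qed

lemma cfun_funpow_param:
  fixes step :: "'p :: coded \<Rightarrow> 's :: coded \<Rightarrow> 's"
  assumes "cfun (\<lambda>q. step (fst q) (snd q))" "cfun n" "cfun i"
  shows "cfun (\<lambda>p. (step p ^^ n p) (i p))"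
proof -
  have "cfun (\<lambda>q. (fst q, step (fst q) (snd q)))"
    using assms(1) by (intro cfun_Pair cfun_fst cfun_id)
  from cfun_funpow[OF this, of n "\<lambda>p. (p, i p)"]
  have "cfun (\<lambda>p. ((\<lambda>q. (fst q, step (fst q) (snd q))) ^^ n p) (p, i p))"
    using assms(2,3) by (simp add: cfun_nat[symmetric] cfun_Pair cfun_id)
  then have "cfun (\<lambda>p. snd (((\<lambda>q. (fst q, step (fst q) (snd q))) ^^ n p) (p, i p)))"
    by (rule cfun_snd)
  moreover have "((\<lambda>q. (fst q, step (fst q) (snd q))) ^^ k) (p, s) = (p, (step p ^^ k) s)" for k p s
    by (induction k) simp_all
  ultimately show ?thesis by simp
qed

lemma length_le_code: "length xs \<le> code xs"
proof (induction xs)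
  case (Cons x xs)
  have "code xs \<le> code (x, xs)" by (simp add: code_prod_def le_prod_encode_2)
  then show ?case using Cons by (simp add: code_Cons)
qed simp

lemma cfun_fold:
  assumes h: "cfun (\<lambda>q. h (fst q) (fst (snd q)) (snd (snd q)))" and l: "cfun l" and i: "cfun i"
  shows "cfun (\<lambda>p. fold (\<lambda>x acc. h p x acc) (l p) (i p))"
proof -
  define step where "step s = (case fst (snd s) of [] \<Rightarrow> s
    | x # xs \<Rightarrow> (fst s, xs, h (fst s) x (snd (snd s))))" for s
  have "cfun (\<lambda>q. h (fst (fst q)) (fst (snd q)) (snd (snd (fst q))))"
    using cfun_comp[OF h, of "\<lambda>q. (fst (fst q), fst (snd q), snd (snd (fst q)))"]
    by (simp add: cfun_Pair cfun_fst cfun_snd cfun_id)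
  then have step: "cfun step"
    unfolding step_def by (intro cfun_case_list cfun_Pair cfun_fst cfun_snd cfun_id)
  \<comment> \<open>The code of a list bounds its length, and surplus iterations idle on the empty
    list.\<close>
  have "cfun (\<lambda>p. snd (snd ((step ^^ code (l p)) (p, l p, i p))))"
    using l i by (intro cfun_snd cfun_funpow[OF step] cfun_Pair cfun_id cn_code)
  moreover have st: "(step ^^ n) (p, xs, a) = (p, drop n xs, fold (h p) (take n xs) a)" for n p xs a
  proof (induction n arbitrary: xs a)
    case (Suc n)
    show ?case
    proof (cases xs)
      case Nil
      then show ?thesis using Suc by (simp add: step_def funpow_Suc_right del: funpow.simps(2))
    next
      case (Cons x ys)
      then show ?thesis using Suc by (simp add: step_def funpow_Suc_right del: funpow.simps(2))
    qed
  qed simp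
  moreover have "take (code xs) xs = xs" for xs :: "'b list" using length_le_code by simp
  ultimately show ?thesis by simp
qed

lemma cfun_rev: "cfun l \<Longrightarrow> cfun (\<lambda>p. rev (l p))"
  using cfun_fold[of "\<lambda>_ x acc. x # acc" l "\<lambda>_. []"]
  by (simp add: fold_Cons_rev cfun_Cons cfun_fst cfun_snd cfun_id cfun_const)

lemma cfun_foldr:
  assumes "cfun (\<lambda>q. h (fst q) (fst (snd q)) (snd (snd q)))" "cfun l" "cfun i"
  shows "cfun (\<lambda>p. foldr (\<lambda>x acc. h p x acc) (l p) (i p))"
  using cfun_fold[OF assms(1) cfun_rev[OF assms(2)] assms(3)] by (simp add: foldr_conv_fold)

lemma cfun_append: "cfun f \<Longrightarrow> cfun g \<Longrightarrow> cfun (\<lambda>p. f p @ g p)"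
proof -
  assume "cfun f" "cfun g"
  then have "cfun (\<lambda>p. foldr (\<lambda>x acc. x # acc) (f p) (g p))"
    by (intro cfun_foldr cfun_Cons cfun_fst cfun_snd cfun_id)
  moreover have "foldr (\<lambda>x acc. x # acc) xs ys = xs @ ys" for xs ys :: "'b list" by (induction xs) simp_all
  ultimately show ?thesis by simp
qed

lemma cfun_map:
  assumes "cfun (\<lambda>q. h (fst q) (snd q))" "cfun l"
  shows "cfun (\<lambda>p. map (\<lambda>x. h p x) (l p))"
proof -
  have "cfun (\<lambda>q. h (fst q) (fst (snd q)))"
    using cfun_comp[OF assms(1), of "\<lambda>q. (fst q, fst (snd q))"]
    by (simp add: cfun_Pair cfun_fst cfun_snd cfun_id)
  then have "cfun (\<lambda>p. foldr (\<lambda>x acc. h p x # acc) (l p) [])"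
    using assms(2) by (intro cfun_foldr cfun_Cons cfun_fst cfun_snd cfun_id cfun_const)
  moreover have "foldr (\<lambda>x acc. h p x # acc) xs [] = map (h p) xs" for p xs by (induction xs) simp_all
  ultimately show ?thesis by simp
qed

lemma cpred_ball:
  assumes "cpred (\<lambda>q. P (fst q) (snd q))" "cfun l"
  shows "cpred (\<lambda>p. \<forall>x\<in>set (l p). P p x)"
proof -
  have "cpred (\<lambda>q. P (fst q) (fst (snd q)))"
    using cpred_comp[OF assms(1), of "\<lambda>q. (fst q, fst (snd q))"]
    by (simp add: cfun_Pair cfun_fst cfun_snd cfun_id)
  then have "cfun (\<lambda>p. foldr (\<lambda>x acc. if P p x then acc else (0 :: nat)) (l p) 1)"
    using assms(2) by (intro cfun_foldr cfun_if cfun_fst cfun_snd cfun_id cfun_const)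
  from cpred_eq[OF this cfun_const[of 1]]
  have "cpred (\<lambda>p. foldr (\<lambda>x acc. if P p x then acc else (0 :: nat)) (l p) 1 = 1)" .
  moreover have "foldr (\<lambda>x acc. if P p x then acc else (0 :: nat)) xs 1 = 1 \<longleftrightarrow> (\<forall>x\<in>set xs. P p x)" for p xs
    by (induction xs) auto
  ultimately show ?thesis by simp
qed

lemma cfun_drop: "cfun n \<Longrightarrow> cfun l \<Longrightarrow> cfun (\<lambda>p. drop (n p) (l p))"
proof -
  assume *: "cfun n" "cfun l"
  have "cfun (\<lambda>l :: 'b list. case l of [] \<Rightarrow> [] | x # xs \<Rightarrow> xs)"
    by (intro cfun_case_list cfun_id cfun_const cfun_snd)
  then have "cfun (\<lambda>p. ((\<lambda>l. case l of [] \<Rightarrow> [] | x # xs \<Rightarrow> xs) ^^ n p) (l p))"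
    using * by (intro cfun_funpow) (simp_all add: cfun_nat)
  moreover have "((\<lambda>l. case l of [] \<Rightarrow> [] | x # xs \<Rightarrow> xs) ^^ k) xs = drop k xs" for k and xs :: "'b list"
    by (induction k arbitrary: xs) (auto simp: funpow_Suc_right simp del: funpow.simps(2) split: list.split)
  ultimately show ?thesis by simp
qed

lemma cfun_length: "cfun l \<Longrightarrow> cfun (\<lambda>p. length (l p))"
proof -
  assume "cfun l"
  then have "cfun (\<lambda>p. foldr (\<lambda>x acc. Suc acc) (l p) 0)"
    by (intro cfun_foldr cfun_Suc cfun_snd cfun_id cfun_const)
  moreover have "foldr (\<lambda>x acc. Suc acc) xs 0 = length xs" for xs :: "'b list" by (induction xs) simp_all
  ultimately show ?thesis by simp
qed

lemma cfun_take: "cfun n \<Longrightarrow> cfun l \<Longrightarrow> cfun (\<lambda>p. take (n p) (l p))"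
proof -
  assume *: "cfun n" "cfun l"
  then have "cfun (\<lambda>p. rev (drop (length (l p) - n p) (rev (l p))))"
    by (intro cfun_rev cfun_drop cfun_minus cfun_length)
  moreover have "rev (drop (length xs - k) (rev xs)) = take k xs" for k and xs :: "'b list"
    by (cases "k \<le> length xs") (simp_all add: drop_rev)
  ultimately show ?thesis by simp
qed

lemmas cfun_basic = cfun_id cfun_const cfun_Pair cfun_fst cfun_snd cfun_Cons cfun_append cfun_rev
  cfun_if cpred_eq cpred_not cpred_conj cpred_disj cfun_foldr cfun_case_list cfun_map cpred_ball cfun_drop
  cfun_take cfun_length cfun_Suc cfun_plus cfun_times cpred_less

text \<open>Post's argument: take the first candidate accepted by A or by B, which exists by
  totality, and ask whether A accepts it.\<close>

lemma search_decides:
  fixes A B :: "'u :: coded \<times> 'c :: coded \<Rightarrow> bool"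
  assumes A: "cpred A" and B: "cpred B" and total: "\<And>u. \<exists>c. A (u, c) \<or> B (u, c)"
    and sound: "\<And>u c. A (u, c) \<Longrightarrow> P u" "\<And>u c. B (u, c) \<Longrightarrow> \<not> P u"
  shows "\<exists>r. \<forall>u. rec_computes r [code u] (if P u then 1 else 0)"
proof -
  define dec :: "nat \<Rightarrow> 'u \<times> 'c" where "dec n = (SOME q. code q = n)" for n
  have dec: "code (dec n) = n" for n unfolding dec_def by (rule someI_ex[OF code_surj])
  have dec_code: "dec (code q) = q" for q
    by (rule code_eq_iff[THEN iffD1]) (rule dec)
  have c1_pred: "c1 (\<lambda>n. if Q (dec n) then 1 else 0)" if Q: "cpred Q" for Q :: "'u \<times> 'c \<Rightarrow> bool"
  proof -
    obtain r where "\<And>q. rec_computes r [code q] (if Q q then 1 else 0)"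
      using Q unfolding cpred_def cn_def cp_def by blast
    from this[of "dec _"] show ?thesis unfolding c1_def cp_def dec by blast
  qed
  define f where "f n x = (if \<not> (A (dec (prod_encode (x, n))) \<or> B (dec (prod_encode (x, n)))) then 1 else 0 :: nat)" for n x
  have "c2 f"
    unfolding f_def c2_def
    by (intro cp_op1[OF c1_pred[OF cpred_not[OF cpred_disj[OF A B]]]] cp_op2[OF c2_prod_encode]
        c2_args[unfolded c2_def])
  have f0: "f (code c) (code u) = 0 \<longleftrightarrow> A (u, c) \<or> B (u, c)" for u c
    using dec_code[of "(u, c)"] by (simp add: f_def code_prod_def)
  have "\<exists>n. f n x = 0" for x
    using code_surj[of x, where 'a = 'u] total f0 by metis
  then have "c1 (\<lambda>x. LEAST n. f n x = 0)" by (rule c1_mu[OF \<open>c2 f\<close>])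
  then have "c1 (\<lambda>x. if A (dec (prod_encode (x, LEAST n. f n x = 0))) then 1 else 0)"
    unfolding c1_def
    by (intro cp_op1[OF c1_pred[OF A]] cp_op2[OF c2_prod_encode] c1_id[unfolded c1_def])
  then obtain r where r: "\<And>x. rec_computes r [x] (if A (dec (prod_encode (x, LEAST n. f n x = 0))) then 1 else 0)"
    using c1D by blast
  have "A (dec (prod_encode (code u, LEAST n. f n (code u) = 0))) \<longleftrightarrow> P u" for u
  proof -
    define n where "n = (LEAST n. f n (code u) = 0)"
    have n: "f n (code u) = 0" unfolding n_def by (rule LeastI_ex) (use f0 total in metis)
    obtain c :: 'c where c: "code c = n" using code_surj by blast
    have "dec (prod_encode (code u, n)) = (u, c)" using dec_code[of "(u, c)"] c by (simp add: code_prod_def)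
    moreover have "A (u, c) \<or> B (u, c)" using n c f0 by metis
    ultimately show ?thesis using sound n_def by metis
  qed
  then show ?thesis using r by metis
qed


subsection \<open>Recursively enumerable predicates\<close>

definition re :: "('a :: coded \<Rightarrow> bool) \<Rightarrow> bool" where
  "re P \<longleftrightarrow> (\<exists>R. cpred R \<and> (\<forall>p. P p \<longleftrightarrow> (\<exists>n :: nat. R (p, n))))"

lemma reI:
  fixes R :: "'a :: coded \<times> 'c :: coded \<Rightarrow> bool"
  assumes "cpred R" "\<And>p. P p \<longleftrightarrow> (\<exists>c. R (p, c))"
  shows "re P"
proof -
  define dec :: "nat \<Rightarrow> 'c" where "dec n = (SOME c. code c = n)" for n
  have dec: "code (dec n) = n" for n unfolding dec_def by (rule someI_ex[OF code_surj])
  have dec_code: "dec (code c) = c" for c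
    by (rule code_eq_iff[THEN iffD1]) (rule dec)
  have "code (p, n) = code (p, dec n)" for p :: 'a and n by (simp add: code_prod_def code_nat_def dec)
  then have "cpred (\<lambda>q. R (fst q, dec (snd q)))"
    using assms(1) unfolding cpred_def cn_def cp_def by (metis prod.collapse)
  moreover have "P p \<longleftrightarrow> (\<exists>n. R (fst (p, n), dec (snd (p, n))))" for p
    unfolding assms(2) by (metis dec_code fst_conv snd_conv)
  ultimately show ?thesis unfolding re_def by blast
qed

lemma re_cpred:
  assumes "cpred P"
  shows "re P"
  by (rule reI[where 'c = nat, OF cpred_comp[OF assms cfun_fst[OF cfun_id]]]) simp

lemma re_conj:
  assumes "re P" "re Q"
  shows "re (\<lambda>p. P p \<and> Q p)"
proof -
  obtain R S where R: "cpred R" "\<And>p. P p \<longleftrightarrow> (\<exists>n :: nat. R (p, n))"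
    and S: "cpred S" "\<And>p. Q p \<longleftrightarrow> (\<exists>n :: nat. S (p, n))"
    using assms unfolding re_def by blast
  have "cpred (\<lambda>q. R (fst q, fst (snd q)) \<and> S (fst q, snd (snd q)))"
    by (intro cpred_conj cpred_comp[OF R(1)] cpred_comp[OF S(1)] cfun_basic)
  then show ?thesis by (rule reI) (auto simp: R(2) S(2))
qed

lemma re_disj:
  assumes "re P" "re Q"
  shows "re (\<lambda>p. P p \<or> Q p)"
proof -
  obtain R S where R: "cpred R" "\<And>p. P p \<longleftrightarrow> (\<exists>n :: nat. R (p, n))"
    and S: "cpred S" "\<And>p. Q p \<longleftrightarrow> (\<exists>n :: nat. S (p, n))"
    using assms unfolding re_def by blast
  show ?thesis by (rule reI[OF cpred_disj[OF R(1) S(1)]]) (auto simp: R(2) S(2))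
qed

lemma re_ex:
  fixes P :: "'a :: coded \<Rightarrow> 'b :: coded \<Rightarrow> bool"
  assumes "re (\<lambda>q. P (fst q) (snd q))"
  shows "re (\<lambda>p. \<exists>x. P p x)"
proof -
  obtain R where R: "cpred R" "\<And>p x. P p x \<longleftrightarrow> (\<exists>n :: nat. R ((p, x), n))"
    using assms unfolding re_def by (metis fst_conv snd_conv)
  have "cpred (\<lambda>q. R ((fst q, fst (snd q)), snd (snd q)))"
    by (intro cpred_comp[OF R(1)] cfun_basic)
  then show ?thesis by (rule reI) (auto simp: R(2))
qed

lemma cpred_mem:
  assumes "cfun f" "cfun l"
  shows "cpred (\<lambda>p. f p \<in> set (l p))"
proof -
  have "cpred (\<lambda>p. \<not> (\<forall>y\<in>set (l p). \<not> f p = y))"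
    using assms by (intro cpred_not cpred_ball cpred_eq cfun_comp[OF assms(1)] cfun_basic)
  moreover have "(\<lambda>p. \<not> (\<forall>y\<in>set (l p). \<not> f p = y)) = (\<lambda>p. f p \<in> set (l p))" by auto
  ultimately show ?thesis by (rule back_subst)
qed

text \<open>One list serves as joint witness: each member of the range finds its own witness
  somewhere in it.\<close>

lemma re_ball:
  assumes "re (\<lambda>q. P (fst q) (snd q))" "cfun l"
  shows "re (\<lambda>p. \<forall>x\<in>set (l p). P p x)"
proof -
  obtain R where R: "cpred R" "\<And>p x. P p x \<longleftrightarrow> (\<exists>n :: nat. R ((p, x), n))"
    using assms unfolding re_def by (metis fst_conv snd_conv)
  have "cpred (\<lambda>q. \<forall>x\<in>set (l (fst q)). \<not> (\<forall>n\<in>set (snd q). \<not> R ((fst q, x), n)))"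
    by (intro cpred_ball cpred_not cpred_comp[OF R(1)] cfun_comp[OF assms(2)] cfun_basic)
  then show ?thesis
  proof (rule reI)
    fix p
    show "(\<forall>x\<in>set (l p). P p x) \<longleftrightarrow>
      (\<exists>ns. \<forall>x\<in>set (l (fst (p, ns))). \<not> (\<forall>n\<in>set (snd (p, ns)). \<not> R ((fst (p, ns), x), n)))"
    proof
      assume "\<forall>x\<in>set (l p). P p x"
      then obtain n where "\<forall>x\<in>set (l p). R ((p, x), n x)" unfolding R(2) by metis
      then show "\<exists>ns. \<forall>x\<in>set (l (fst (p, ns))). \<not> (\<forall>n\<in>set (snd (p, ns)). \<not> R ((fst (p, ns), x), n))"
        by (intro exI[of _ "map n (l p)"]) auto
    qed (auto simp: R(2))
  qed
qed

lemma re_bex: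
  assumes "re (\<lambda>q. P (fst q) (snd q))" "cfun l"
  shows "re (\<lambda>p. \<exists>x\<in>set (l p). P p x)"
  unfolding Bex_def using assms
  by (intro re_ex re_conj re_cpred[OF cpred_mem] cfun_comp[OF assms(2)] cfun_basic)

lemma decidable_if_re:
  fixes P :: "'a :: coded \<Rightarrow> bool"
  assumes "re P" "re (\<lambda>p. \<not> P p)"
  shows "\<exists>r. \<forall>p. rec_computes r [code p] (if P p then 1 else 0)"
proof -
  obtain R S where R: "cpred R" "\<And>p. P p \<longleftrightarrow> (\<exists>n :: nat. R (p, n))"
    and S: "cpred S" "\<And>p. \<not> P p \<longleftrightarrow> (\<exists>n :: nat. S (p, n))"
    using assms unfolding re_def by blast
  show ?thesis by (rule search_decides[OF R(1) S(1)]) (use R(2) S(2) in blast)+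
qed

subsection \<open>Computing in the free group\<close>

text \<open>All numbers from 3 upwards denote the inverse of b, so every list of numbers denotes a
  group element and quantifiers over elements become quantifiers over lists.\<close>

definition letter_dec :: "nat \<Rightarrow> gen letter" where
  "letter_dec l = (if l = 0 then (Gen_a, True) else if l = 1 then (Gen_a, False)
     else if l = 2 then (Gen_b, True) else (Gen_b, False))"

definition den :: "nat list \<Rightarrow> gen fg" where
  "den w = elt (map letter_dec w)"

definition lcode :: "gen fg \<Rightarrow> nat list" where
  "lcode x = map letter_code (wd x)"

definition celt :: "('a :: coded \<Rightarrow> gen fg) \<Rightarrow> bool" where
  "celt f \<longleftrightarrow> cfun (\<lambda>p. lcode (f p))"

lemma letter_dec_code [simp]: "letter_dec (letter_code l) = l"
  by (cases l rule: letter_code.cases) (simp_all add: letter_dec_def)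

lemma den_map_letter_code: "den (map letter_code w) = elt w"
  by (simp add: den_def o_def)

lemma den_lcode [simp]: "den (lcode x) = x"
  by (simp add: lcode_def den_map_letter_code)

lemma lcode_eq_iff: "lcode x = lcode y \<longleftrightarrow> x = y"
  by (metis den_lcode)

lemma den_append: "den (v @ w) = den v + den w"
  by (simp add: den_def elt_append)

lemma den_Nil [simp]: "den [] = 0"
  by (simp add: den_def)

lemma den_single: "den [l] = (if l = 0 then ga else if l = 1 then - ga else if l = 2 then gb else - gb)"
  by (simp add: den_def letter_dec_def elt_single)

lemma den_Cons: "den (l # w) = den [l] + den w"
  using den_append[of "[l]" w] by simp

definition letter_neg :: "nat \<Rightarrow> nat" where
  "letter_neg l = (if l = 0 then 1 else if l = 1 then 0 else if l = 2 then 3 else 2)"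

lemma letter_neg: "letter_neg l = letter_code (letter_inv (letter_dec l))"
  by (simp add: letter_neg_def letter_dec_def letter_inv_def)

lemma celt_den:
  assumes "cfun w"
  shows "celt (\<lambda>p. den (w p))"
proof -
  \<comment> \<open>This is \<open>red_cons\<close> carried out on codes, with numbers above 3
    normalised to 3.\<close>
  define step where "step l v = (case v of [] \<Rightarrow> [if l < 3 then l else 3]
    | y # t \<Rightarrow> if y = letter_neg l then t else (if l < 3 then l else 3) # v)" for l and v :: "nat list"
  have "cfun (\<lambda>p. foldr (\<lambda>l v. step l v) (w p) [])"
    unfolding step_def letter_neg_def
    by (intro cfun_foldr cfun_case_list cfun_if cpred_eq cpred_less assms cfun_basic)
  moreover have "foldr (\<lambda>l v. step l v) u [] = lcode (den u)" for u
  proof (induction u)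
    case (Cons l u)
    have l: "(if l < 3 then l else 3) = letter_code (letter_dec l)" by (simp add: letter_dec_def)
    have "lcode (den (l # u)) = map letter_code (red_cons (letter_dec l) (wd (den u)))"
      by (simp add: lcode_def den_def wd_elt reduce_def)
    also have "\<dots> = step l (lcode (den u))"
    proof (cases "wd (den u)")
      case (Cons y t)
      have "y = letter_inv (letter_dec l) \<longleftrightarrow> letter_code y = letter_neg l"
        unfolding letter_neg by (metis letter_dec_code)
      then show ?thesis unfolding step_def l lcode_def Cons by simp
    qed (simp add: step_def l lcode_def del: if_split)
    finally show ?case using Cons by simp
  qed (simp add: lcode_def den_def wd_elt reduce_def del: den_Nil elt_Nil)
  ultimately show ?thesis by (simp add: celt_def)
qed

lemma celt_const: "celt (\<lambda>_. x)"
  by (simp add: celt_def cfun_const)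

lemma celt_plus:
  assumes "celt f" "celt g"
  shows "celt (\<lambda>p. f p + g p)"
  using celt_den[of "\<lambda>p. lcode (f p) @ lcode (g p)"] assms
  by (simp add: celt_def[of f] celt_def[of g] cfun_append den_append)

lemma celt_uminus:
  assumes "celt f"
  shows "celt (\<lambda>p. - f p)"
proof -
  have "celt (\<lambda>p. den (rev (map (\<lambda>l. letter_neg l) (lcode (f p)))))"
    using assms unfolding celt_def[of f] letter_neg_def by (intro celt_den cfun_basic)
  moreover have "den (rev (map (\<lambda>l. letter_neg l) (lcode x))) = - x" for x
    using elt_winv[of "wd x"] by (simp add: den_def lcode_def letter_neg rev_map o_def)
  ultimately show ?thesis by simp
qed

lemma celt_conj: "celt g \<Longrightarrow> celt f \<Longrightarrow> celt (\<lambda>p. conj (g p) (f p))"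
  unfolding conj_def diff_conv_add_uminus by (intro celt_plus celt_uminus)

lemma celt_zmul:
  assumes "celt f" "cfun n"
  shows "celt (\<lambda>p. zmul (int (n p)) (f p))"
proof -
  have "cfun (\<lambda>q. (\<lambda>p v. lcode (f p) @ v) (fst q) (snd q))"
    by (intro cfun_append cfun_comp[OF assms(1)[unfolded celt_def]] cfun_fst cfun_snd cfun_id)
  from cfun_funpow_param[OF this assms(2) cfun_const[of "[]"]]
  have "celt (\<lambda>p. den (((@) (lcode (f p)) ^^ n p) []))" by (intro celt_den) simp
  moreover have "den (((@) (lcode x) ^^ k) []) = zmul (int k) x" for k x
    by (induction k) (simp_all add: den_append zmul_succ add.commute[of 1])
  ultimately show ?thesis by simp
qed

lemma celt_sub:
  assumes "celt f" "celt g" "celt h"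
  shows "celt (\<lambda>p. sub (f p) (g p) (h p))"
proof -
  have c: "cfun (\<lambda>q :: 'a \<times> 'b :: coded. lcode (f (fst q)))" "cfun (\<lambda>q :: 'a \<times> 'b. lcode (- f (fst q)))"
    "cfun (\<lambda>q :: 'a \<times> 'b. lcode (g (fst q)))" "cfun (\<lambda>q :: 'a \<times> 'b. lcode (- g (fst q)))"
    using cfun_comp[OF assms(1)[unfolded celt_def] cfun_fst[OF cfun_id]]
      cfun_comp[OF assms(2)[unfolded celt_def] cfun_fst[OF cfun_id]]
      cfun_comp[OF celt_uminus[OF assms(1), unfolded celt_def] cfun_fst[OF cfun_id]]
      cfun_comp[OF celt_uminus[OF assms(2), unfolded celt_def] cfun_fst[OF cfun_id]] by simp_all
  have "celt (\<lambda>p. den (foldr (\<lambda>l v. (if l = 0 then lcode (f p) else if l = 1 then lcode (- f p)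
      else if l = 2 then lcode (g p) else lcode (- g p)) @ v) (lcode (h p)) []))"
    by (intro celt_den cfun_foldr cfun_append cfun_if cpred_eq c assms(3)[unfolded celt_def]
        cfun_fst cfun_snd cfun_id cfun_const)
  moreover have "den (foldr (\<lambda>l v. (if l = 0 then lcode x else if l = 1 then lcode (- x)
      else if l = 2 then lcode y else lcode (- y)) @ v) w []) = sub x y (den w)" for x y w
  proof (induction w)
    case (Cons l w)
    then show ?case unfolding den_Cons[of l w] by (simp add: den_append sub_simps den_single)
  qed (simp add: sub_simps)
  ultimately show ?thesis by simp
qed

lemma celt_eq: "celt f \<Longrightarrow> celt g \<Longrightarrow> cpred (\<lambda>p. f p = g p)"
  unfolding celt_def lcode_eq_iff[symmetric] by (rule cpred_eq)

lemma celt_comp: "celt f \<Longrightarrow> cfun g \<Longrightarrow> celt (\<lambda>p. f (g p))"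
  unfolding celt_def by (rule cfun_comp)

text \<open>Exponent sums are integers while codes carry natural numbers; counting positive and
  negative letters separately avoids negative values.\<close>

definition occ :: "nat \<Rightarrow> gen fg \<Rightarrow> nat" where
  "occ k x = foldr (\<lambda>l n. if l = k then Suc n else n) (lcode x) 0"

lemma cfun_occ: "celt f \<Longrightarrow> cfun (\<lambda>p. occ k (f p))"
  unfolding occ_def celt_def by (intro cfun_basic)

lemma exponents_occ: "ea x = int (occ 0 x) - int (occ 1 x)" "eb x = int (occ 2 x) - int (occ 3 x)"
proof -
  let ?o = "\<lambda>k w. foldr (\<lambda>l n. if l = k then Suc n else n) (map letter_code w) 0"
  have "ea (elt w) = int (?o 0 w) - int (?o 1 w) \<and> eb (elt w) = int (?o 2 w) - int (?o 3 w)" for w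
  proof (induction w)
    case (Cons l w)
    then show ?case
      using elt_Cons[of l w] by (cases l rule: letter_code.cases) (simp_all add: elt_single)
  qed simp
  from this[of "wd x"] show "ea x = int (occ 0 x) - int (occ 1 x)" "eb x = int (occ 2 x) - int (occ 3 x)"
    by (simp_all add: occ_def lcode_def)
qed

lemma cpred_eb_zero: "celt f \<Longrightarrow> cpred (\<lambda>p. eb (f p) = 0)"
  unfolding exponents_occ right_minus_eq of_nat_eq_iff by (intro cpred_eq cfun_occ)

lemma cpred_parallel:
  assumes "celt f" "celt g"
  shows "cpred (\<lambda>p. ea (f p) * eb (g p) = eb (f p) * ea (g p))"
proof -
  have *: "(int a - int a') * (int d - int d') = (int b - int b') * (int c - int c') \<longleftrightarrow>
    a * d + a' * d' + b * c' + b' * c = a * d' + a' * d + b * c + b' * c'" for a a' b b' c c' d d'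
  proof -
    have "(int a - int a') * (int d - int d') - (int b - int b') * (int c - int c') =
      int (a * d + a' * d' + b * c' + b' * c) - int (a * d' + a' * d + b * c + b' * c')"
      by (simp add: algebra_simps)
    then show ?thesis by (metis of_nat_eq_iff right_minus_eq)
  qed
  show ?thesis unfolding exponents_occ * using assms by (intro cpred_eq cfun_plus cfun_times cfun_occ)
qed

lemma cyc_reduced_iff_length: "cyc_reduced x \<longleftrightarrow> length (lcode (x + x)) = length (lcode x) + length (lcode x)"
  using wlen_plus[of "\<lambda>_. True" x x] by (simp add: cyc_reduced_def lcode_def wlen_def cnt_def) arith

lemma cpred_cyc_reduced:
  assumes "celt f"
  shows "cpred (\<lambda>p. cyc_reduced (f p))"
  unfolding cyc_reduced_iff_length
  by (intro cpred_eq cfun_length cfun_plus assms[unfolded celt_def] celt_plus[OF assms assms, unfolded celt_def])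

lemma cpred_primitive:
  assumes "celt f"
  shows "cpred (\<lambda>p. cyc_reduced (f p) \<and> f p \<noteq> 0 \<and> \<not> proper_power (f p))"
proof -
  \<comment> \<open>Lists the numbers below the length of w, so that the bounded search for a
    rotation becomes a quantifier over a list.\<close>
  define positions where "positions w = foldr (\<lambda>l ns. length ns # ns) w []" for w :: "nat list"
  have len: "length (positions w) = length w" for w by (induction w) (simp_all add: positions_def)
  have pos: "set (positions w) = {..<length w}" for w
  proof (induction w)
    case (Cons l w)
    have "positions (l # w) = length (positions w) # positions w" by (simp add: positions_def)
    then show ?case using Cons by (simp only: len list.set list.size lessThan_Suc add_0_right add_Suc_right)
  qed (simp add: positions_def)
  have f: "cfun (\<lambda>p. lcode (f p))" using assms by (simp add: celt_def)
  then have f': "cfun (\<lambda>q. lcode (f (fst q)))" by (rule cfun_comp) (intro cfun_basic)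
  have "cpred (\<lambda>p. \<forall>d\<in>set (positions (lcode (f p))). \<not> (\<not> d = 0 \<and>
      drop d (lcode (f p)) @ take d (lcode (f p)) = lcode (f p)))"
    unfolding positions_def by (intro cpred_ball cfun_foldr cpred_not cpred_conj cpred_eq f f' cfun_basic)
  then have "cpred (\<lambda>p. cyc_reduced (f p) \<and> \<not> f p = 0 \<and>
      (\<forall>d\<in>set (positions (lcode (f p))). \<not> (\<not> d = 0 \<and>
      drop d (lcode (f p)) @ take d (lcode (f p)) = lcode (f p))))"
    by (intro cpred_conj cpred_not cpred_cyc_reduced celt_eq assms celt_const)
  moreover have "cyc_reduced x \<and> \<not> x = 0 \<and> (\<forall>d\<in>set (positions (lcode x)). \<not> (\<not> d = 0 \<and>
      drop d (lcode x) @ take d (lcode x) = lcode x)) \<longleftrightarrow> cyc_reduced x \<and> x \<noteq> 0 \<and> \<not> proper_power x" for x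
  proof (cases "cyc_reduced x \<and> x \<noteq> 0")
    case True
    have "drop d (lcode x) @ take d (lcode x) = lcode x \<longleftrightarrow> drop d (wd x) @ take d (wd x) = wd x" for d
    proof -
      have "inj letter_code" by (rule injI) (metis letter_dec_code)
      then have "map letter_code (drop d (wd x) @ take d (wd x)) = map letter_code (wd x) \<longleftrightarrow>
        drop d (wd x) @ take d (wd x) = wd x" by (rule inj_map_eq_map)
      then show ?thesis by (simp add: lcode_def drop_map take_map)
    qed
    moreover have "(\<forall>d\<in>{..<length (lcode x)}. \<not> (\<not> d = 0 \<and> Q d)) \<longleftrightarrow> \<not> (\<exists>d. 0 < d \<and> d < length (wd x) \<and> Q d)" for Q
      unfolding lcode_def length_map Ball_def lessThan_iff neq0_conv by blast
    ultimately show ?thesis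
      unfolding pos proper_power_iff_rotation[OF conjunct1[OF True] conjunct2[OF True]] using True by simp
  qed auto
  ultimately show ?thesis by simp
qed

lemma cfun_swaps: "cfun s \<Longrightarrow> cfun n \<Longrightarrow> cfun (\<lambda>p. swaps (s p) (n p))"
  unfolding swaps_def by (intro cfun_foldr cfun_if cpred_eq cfun_fst cfun_snd cfun_id)

lemma cfun_perm_act:
  assumes "cfun s" "cfun t" "celt f" "cfun n"
  shows "cfun (\<lambda>p. perm_act (s p) (t p) (f p) (n p))"
proof -
  have c: "cfun (\<lambda>q :: 'a \<times> 'b :: coded. s (fst q))" "cfun (\<lambda>q :: 'a \<times> 'b. t (fst q))"
    using cfun_comp[OF assms(1) cfun_fst[OF cfun_id]] cfun_comp[OF assms(2) cfun_fst[OF cfun_id]] by simp_all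
  have "cfun (\<lambda>p. foldr (\<lambda>l m. if l = 0 then swaps (s p) m else if l = 1 then swaps (rev (s p)) m
     else if l = 2 then swaps (t p) m else swaps (rev (t p)) m) (lcode (f p)) (n p))"
    by (intro cfun_foldr cfun_if cpred_eq cfun_swaps cfun_rev c assms(4) assms(3)[unfolded celt_def]
        cfun_fst cfun_snd cfun_id cfun_const)
  moreover have "foldr (\<lambda>l m. if l = 0 then swaps s m else if l = 1 then swaps (rev s) m
     else if l = 2 then swaps t m else swaps (rev t) m) (map letter_code w) m =
     foldr (perm_letter s t) w m" for s t w m
  proof (induction w)
    case (Cons l w)
    then show ?case by (cases l rule: letter_code.cases) simp_all
  qed simp
  ultimately show ?thesis by (simp add: perm_act_def lcode_def)
qed


lemma ex_elt: "(\<exists>x. P x) \<longleftrightarrow> (\<exists>w. P (den w))"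
  by (metis den_lcode)

section \<open>Comparing finitely generated subgroups given by lists\<close>

definition cgen :: "('a :: coded \<Rightarrow> gen fg set) \<Rightarrow> bool" where
  "cgen F \<longleftrightarrow> (\<exists>vs. cfun vs \<and> (\<forall>p. F p = sgp (den ` set (vs p))))"

lemma cgen_den: "cfun vs \<Longrightarrow> cgen (\<lambda>p. sgp (den ` set (vs p)))"
  unfolding cgen_def by blast

lemma cgen_single: "celt f \<Longrightarrow> cgen (\<lambda>p. sgp {f p})"
  using cgen_den[of "\<lambda>p. [lcode (f p)]"] by (simp add: celt_def cfun_Cons cfun_const)

lemma cgen_pair: "celt f \<Longrightarrow> celt g \<Longrightarrow> cgen (\<lambda>p. sgp {f p, g p})"
  using cgen_den[of "\<lambda>p. [lcode (f p), lcode (g p)]"] by (simp add: celt_def cfun_Cons cfun_const)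

lemma cgen_UNIV: "cgen (\<lambda>_. UNIV)"
  unfolding sgp_gens[symmetric] by (intro cgen_pair celt_const)

lemma cgen_image:
  assumes "cgen F" "\<And>p. ghom (h p)" "celt (\<lambda>q. h (fst q) (den (snd q)))"
  shows "cgen (\<lambda>p. h p ` F p)"
proof -
  obtain vs where vs: "cfun vs" "\<And>p. F p = sgp (den ` set (vs p))" using assms(1) unfolding cgen_def by blast
  have "cfun (\<lambda>p. map (\<lambda>w. lcode (h p (den w))) (vs p))"
    using assms(3) unfolding celt_def by (intro cfun_map vs(1))
  moreover have "h p ` F p = sgp (den ` set (map (\<lambda>w. lcode (h p (den w))) (vs p)))" for p
    unfolding vs(2) sgp_image[OF assms(2)] by (simp add: image_image)
  ultimately show ?thesis unfolding cgen_def by blast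
qed

text \<open>The evidence for membership is a list of words, each denoting a generator or the inverse
  of one; checking it takes only equality in the free group.\<close>

lemma sgp_iff_concat:
  "x \<in> sgp U \<longleftrightarrow> (\<exists>ws. (\<forall>w\<in>set ws. den w \<in> U \<or> - den w \<in> U) \<and> x = den (concat ws))"
proof
  assume "x \<in> sgp U"
  then show "\<exists>ws. (\<forall>w\<in>set ws. den w \<in> U \<or> - den w \<in> U) \<and> x = den (concat ws)"
  proof induction
    case zero
    show ?case by (rule exI[of _ "[]"]) simp
  next
    case (plus u x)
    then obtain ws where "\<forall>w\<in>set ws. den w \<in> U \<or> - den w \<in> U" "x = den (concat ws)" by blast
    then show ?case using plus(1) by (intro exI[of _ "lcode u # ws"]) (simp add: den_append)
  next
    case (minus u x)
    then obtain ws where "\<forall>w\<in>set ws. den w \<in> U \<or> - den w \<in> U" "x = den (concat ws)" by blast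
    then show ?case using minus(1) by (intro exI[of _ "lcode (- u) # ws"]) (simp add: den_append)
  qed
next
  assume "\<exists>ws. (\<forall>w\<in>set ws. den w \<in> U \<or> - den w \<in> U) \<and> x = den (concat ws)"
  then obtain ws where "\<forall>w\<in>set ws. den w \<in> U \<or> - den w \<in> U" "x = den (concat ws)" by blast
  then show "x \<in> sgp U"
  proof (induction ws arbitrary: x)
    case (Cons w ws)
    have "den w \<in> sgp U"
    proof (cases "den w \<in> U")
      case False
      then have "- den w \<in> sgp U" using Cons.prems(1) by (auto intro: sgp_base)
      then have "- (- den w) \<in> sgp U" by (rule sgp_uminus)
      then show ?thesis by simp
    qed (rule sgp_base)
    then show ?case using Cons by (simp add: den_append sgp_add)
  qed (simp add: sgp.zero)
qed

lemma re_in_sgp: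
  assumes "celt f" "cfun vs"
  shows "re (\<lambda>p. f p \<in> sgp (den ` set (vs p)))"
proof -
  have mem: "cpred (\<lambda>p. g p \<in> den ` set (l p))" if "celt g" "cfun l" for g :: "'c :: coded \<Rightarrow> gen fg" and l
  proof -
    have "cpred (\<lambda>p. \<not> (\<forall>w\<in>set (l p). \<not> g p = den w))"
      using that(2) by (intro cpred_not cpred_ball celt_eq celt_comp[OF that(1)] celt_den cfun_basic)
    moreover have "(\<lambda>p. \<not> (\<forall>w\<in>set (l p). \<not> g p = den w)) = (\<lambda>p. g p \<in> den ` set (l p))" by auto
    ultimately show ?thesis by (rule back_subst)
  qed
  have c: "cfun (\<lambda>q. vs (fst (fst q)))" by (intro cfun_comp[OF assms(2)] cfun_basic)
  have "cpred (\<lambda>q. (\<forall>w\<in>set (snd q). den w \<in> den ` set (vs (fst q)) \<or> - den w \<in> den ` set (vs (fst q))) \<and>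
      f (fst q) = den (foldr (\<lambda>w v. w @ v) (snd q) []))"
    by (intro cpred_conj cpred_ball cpred_disj mem celt_eq celt_uminus celt_den c celt_comp[OF assms(1)] cfun_basic)
  then show ?thesis
    unfolding sgp_iff_concat by (rule reI) (simp add: concat_conv_foldr)
qed

lemma re_sgp_eq:
  assumes "cgen F" "cgen G"
  shows "re (\<lambda>p. F p = G p)"
proof -
  obtain us vs where us: "cfun us" "\<And>p. F p = sgp (den ` set (us p))"
    and vs: "cfun vs" "\<And>p. G p = sgp (den ` set (vs p))" using assms unfolding cgen_def by blast
  have "re (\<lambda>p. (\<forall>u\<in>set (us p). den u \<in> sgp (den ` set (vs p))) \<and> (\<forall>v\<in>set (vs p). den v \<in> sgp (den ` set (us p))))"
    by (intro re_conj re_ball re_in_sgp celt_den cfun_comp[OF us(1)] cfun_comp[OF vs(1)] us(1) vs(1) cfun_basic)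
  moreover have "(\<forall>u\<in>set xs. den u \<in> sgp (den ` set ys)) \<and> (\<forall>v\<in>set ys. den v \<in> sgp (den ` set xs)) \<longleftrightarrow>
    sgp (den ` set xs) = sgp (den ` set ys)" for xs ys
  proof
    assume "(\<forall>u\<in>set xs. den u \<in> sgp (den ` set ys)) \<and> (\<forall>v\<in>set ys. den v \<in> sgp (den ` set xs))"
    then show "sgp (den ` set xs) = sgp (den ` set ys)" by (intro sgp_eqI image_subsetI) blast+
  next
    assume eq: "sgp (den ` set xs) = sgp (den ` set ys)"
    have base: "\<forall>w\<in>set ws. den w \<in> sgp (den ` set ws)" for ws by (intro ballI sgp_base imageI)
    show "(\<forall>u\<in>set xs. den u \<in> sgp (den ` set ys)) \<and> (\<forall>v\<in>set ys. den v \<in> sgp (den ` set xs))"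
      using base[of xs] base[of ys] unfolding eq by blast
  qed
  ultimately show ?thesis by (simp add: us(2) vs(2))
qed

lemma re_sgp_neq:
  assumes "cgen F" "cgen G"
  shows "re (\<lambda>p. F p \<noteq> G p)"
proof -
  obtain us vs where us: "cfun us" "\<And>p. F p = sgp (den ` set (us p))"
    and vs: "cfun vs" "\<And>p. G p = sgp (den ` set (vs p))" using assms unfolding cgen_def by blast
  have "re (\<lambda>p. \<exists>s t. (\<forall>u\<in>set (us p). perm_act s t (den u) 0 = 0) \<and> \<not> (\<forall>v\<in>set (vs p). perm_act s t (den v) 0 = 0) \<or>
      \<not> (\<forall>u\<in>set (us p). perm_act s t (den u) 0 = 0) \<and> (\<forall>v\<in>set (vs p). perm_act s t (den v) 0 = 0))"
    by (intro re_ex re_cpred cpred_disj cpred_conj cpred_not cpred_ball cpred_eq cfun_perm_act celt_den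
        cfun_comp[OF us(1)] cfun_comp[OF vs(1)] cfun_basic)
  moreover have "(\<exists>s t. (\<forall>u\<in>set xs. perm_act s t (den u) 0 = 0) \<and> \<not> (\<forall>v\<in>set ys. perm_act s t (den v) 0 = 0) \<or>
      \<not> (\<forall>u\<in>set xs. perm_act s t (den u) 0 = 0) \<and> (\<forall>v\<in>set ys. perm_act s t (den v) 0 = 0)) \<longleftrightarrow>
    sgp (den ` set xs) \<noteq> sgp (den ` set ys)" for xs ys
  proof -
    have *: "(\<exists>s t. A s t \<and> \<not> B s t \<or> \<not> A s t \<and> B s t) \<longleftrightarrow> (\<exists>s t. A s t \<noteq> B s t)"
      for A B :: "(nat \<times> nat) list \<Rightarrow> (nat \<times> nat) list \<Rightarrow> bool" by blast
    show ?thesis unfolding * by (simp add: subgroups_neq_iff)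
  qed
  ultimately show ?thesis by (simp add: us(2) vs(2))
qed


lemma re_yes_certificate: "re (\<lambda>us. yes_certificate (sgp (den ` set us)))"
proof -
  have zero: "H = {0} \<longleftrightarrow> H = sgp {0}" for H :: "gen fg set" by (simp add: sgp_single)
  \<comment> \<open>Groups the three conditions on r, since \<open>cpred_primitive\<close> decides
    them jointly: the rotation test for powers is valid only for nonzero cyclically reduced
    elements.\<close>
  have c: "(a \<and> b \<and> n \<and> e) = ((a \<and> b \<and> n) \<and> e)" for a b n e by simp
  have H: "cgen (\<lambda>q. sgp (den ` set (f q)))" if "cfun f" for f :: "'a :: coded \<Rightarrow> nat list list"
    using that by (rule cgen_den)
  show ?thesis
    unfolding yes_certificate_def zero ex_elt c
    by (intro re_disj re_ex re_conj re_sgp_eq H cgen_UNIV cgen_pair cgen_single re_cpred[OF cpred_primitive]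
        celt_conj celt_den celt_const cfun_id cfun_fst cfun_snd)
qed

lemma re_no_certificate: "re (\<lambda>us. no_certificate (den ` set us) (sgp (den ` set us)))"
proof -
  \<comment> \<open>The integer exponent becomes a natural number shifted by two, a coded value
    without side condition.\<close>
  have pow: "(\<exists>k\<ge>2. H = sgp {zmul k w}) \<longleftrightarrow> (\<exists>n. H = sgp {zmul (int (Suc (Suc n))) w})" for H and w :: "gen fg"
  proof
    assume "\<exists>k\<ge>2. H = sgp {zmul k w}"
    then obtain k where k: "2 \<le> k" "H = sgp {zmul k w}" by blast
    have "k = int (Suc (Suc (nat (k - 2))))" using k(1) by simp
    then show "\<exists>n. H = sgp {zmul (int (Suc (Suc n))) w}" using k(2) by metis
  next
    assume "\<exists>n. H = sgp {zmul (int (Suc (Suc n))) w}"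
    then obtain n where "H = sgp {zmul (int (Suc (Suc n))) w}" by blast
    then show "\<exists>k\<ge>2. H = sgp {zmul k w}" by (intro exI[of _ "int (Suc (Suc n))"]) simp
  qed
  have pow': "(\<exists>w k. w \<noteq> 0 \<and> 2 \<le> k \<and> H = sgp {zmul k w}) \<longleftrightarrow>
    (\<exists>w. \<not> w = 0 \<and> (\<exists>n. H = sgp {zmul (int (Suc (Suc n))) w}))" for H :: "gen fg set"
    unfolding pow[symmetric] by blast
  have K0: "cgen (\<lambda>_ :: 'a :: coded. K0)" "cgen (\<lambda>_ :: 'a :: coded. conj (- gb) ` K0)"
  proof -
    show "cgen (\<lambda>_ :: 'a. K0)" unfolding K0_def by (intro cgen_pair celt_const)
    then show "cgen (\<lambda>_ :: 'a :: coded. conj (- gb) ` K0)"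
      by (intro cgen_image ghom_conj celt_conj celt_const celt_den cfun_snd cfun_id)
  qed
  have image: "cgen (\<lambda>q. conj (g q) ` sub (x q) (y q) ` sgp (den ` set (f q)))"
    if "cfun f" "celt g" "celt x" "celt y" for f :: "'a :: coded \<Rightarrow> nat list list" and g x y
    by (intro cgen_image cgen_den ghom_conj ghom_sub celt_conj celt_sub celt_den that celt_comp[OF that(2)]
        celt_comp[OF that(3)] celt_comp[OF that(4)] cfun_fst cfun_snd cfun_id)
  show ?thesis
    unfolding no_certificate_def pow' ex_elt bex_simps ball_simps
    by (intro re_disj re_ex re_bex re_conj re_sgp_eq re_sgp_neq image K0 cgen_den cgen_UNIV cgen_pair cgen_single
        re_cpred[OF cpred_ball] re_cpred[OF cpred_not] re_cpred[OF cpred_cyc_reduced] cpred_parallel cpred_eb_zero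
        celt_eq celt_zmul celt_sub celt_conj celt_plus celt_den celt_const cfun_id cfun_fst cfun_snd cfun_Suc)
qed

lemma re_fixgroup: "re (\<lambda>us. fixgroup (sgp (den ` set us)))" "re (\<lambda>us. \<not> fixgroup (sgp (den ` set us)))"
proof -
  have yes: "fixgroup (sgp (den ` set us)) \<longleftrightarrow> yes_certificate (sgp (den ` set us))"
    and no: "\<not> fixgroup (sgp (den ` set us)) \<longleftrightarrow> no_certificate (den ` set us) (sgp (den ` set us))" for us
    using certificates_complete[of "den ` set us"] yes_certificate_sound
      no_certificate_sound[of "den ` set us"] by blast+
  show "re (\<lambda>us. fixgroup (sgp (den ` set us)))" unfolding yes by (rule re_yes_certificate)
  show "re (\<lambda>us. \<not> fixgroup (sgp (den ` set us)))" unfolding no by (rule re_no_certificate)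
qed

subsection \<open>Reduced words and the free group\<close>

lemma generate_eq_sgp:
  fixes U :: "'g fg set"
  shows "generate free_group (wd ` U) = wd ` sgp U"
proof
  have inv: "inv\<^bsub>free_group\<^esub> (wd u) = wd (- u)" for u :: "'g fg"
    by (rule group.inv_equality[OF group_free_group])
      (simp_all add: free_group_def wd_plus[symmetric])
  show "generate free_group (wd ` U) \<subseteq> wd ` sgp U"
  proof
    fix w assume "w \<in> generate free_group (wd ` U)"
    then show "w \<in> wd ` sgp U"
    proof induction
      case one
      have "wd (0 :: 'g fg) = \<one>\<^bsub>free_group\<^esub>" by (simp add: free_group_def)
      then show ?case using sgp.zero by (metis imageI)
    next
      case (incl h)
      then show ?case by (auto intro: sgp_base)
    next
      case (inv h)
      then show ?case using \<open>\<And>u. inv\<^bsub>free_group\<^esub> (wd u) = wd (- u)\<close> by (auto intro: sgp_base sgp_uminus)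
    next
      case (eng h1 h2)
      then obtain x y where xy: "h1 = wd x" "x \<in> sgp U" "h2 = wd y" "y \<in> sgp U" by blast
      have "h1 \<otimes>\<^bsub>free_group\<^esub> h2 = wd (x + y)" by (simp add: xy free_group_def wd_plus)
      then show ?case using sgp_add[OF xy(2,4)] by blast
    qed
  qed
  show "wd ` sgp U \<subseteq> generate free_group (wd ` U)"
  proof
    fix w assume "w \<in> wd ` sgp U"
    then obtain x where "w = wd x" "x \<in> sgp U" by blast
    from this(2) have "wd x \<in> generate free_group (wd ` U)"
    proof induction
      case zero
      have "\<one>\<^bsub>free_group\<^esub> = wd (0 :: 'g fg)" by (simp add: free_group_def)
      then show ?case using generate.one by metis
    next
      case (plus u x)
      have "wd (u + x) = wd u \<otimes>\<^bsub>free_group\<^esub> wd x" by (simp add: free_group_def wd_plus)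
      then show ?case using plus by (auto intro: generate.eng generate.incl)
    next
      case (minus u x)
      have "wd (- u + x) = inv\<^bsub>free_group\<^esub> (wd u) \<otimes>\<^bsub>free_group\<^esub> wd x"
        unfolding inv by (simp add: free_group_def wd_plus)
      then show ?case using minus by (auto intro: generate.eng generate.inv)
    qed
    then show "w \<in> generate free_group (wd ` U)" using \<open>w = wd x\<close> by simp
  qed
qed

lemma is_fixed_point_group_iff: "is_fixed_point_group F2 (wd ` H) \<longleftrightarrow> fixgroup H"
proof
  assume "is_fixed_point_group F2 (wd ` H)"
  then obtain \<phi> where iso: "\<phi> \<in> iso F2 F2" and H: "wd ` H = fixed_points F2 \<phi>"
    unfolding is_fixed_point_group_def by blast
  have bij: "bij_betw \<phi> {w. reduced w} {w. reduced w}"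
    and mult: "\<And>u v. reduced u \<Longrightarrow> reduced v \<Longrightarrow> \<phi> (reduce (u @ v)) = reduce (\<phi> u @ \<phi> v)"
    using iso by (auto simp: iso_def hom_def free_group_def)
  define f where "f x = elt (\<phi> (wd x))" for x
  have wd_f: "wd (f x) = \<phi> (wd x)" for x
    using bij_betwE[OF bij] by (simp add: f_def wd_elt reduce_reduced)
  have "ghom f"
    unfolding ghom_def by (intro allI wd_inject[THEN iffD1]) (simp add: wd_f wd_plus mult)
  moreover have "bij f"
  proof (rule bijI)
    show "inj f"
      by (rule injI) (metis wd_f wd_inject bij_betw_imp_inj_on[OF bij] inj_on_eq_iff reduced_wd mem_Collect_eq)
    show "surj f"
    proof (rule surjI[of _ "\<lambda>y. elt (inv_into {w. reduced w} \<phi> (wd y))"])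
      fix y :: "gen fg"
      have y: "wd y \<in> \<phi> ` {w. reduced w}" using bij by (simp add: bij_betw_def)
      then have "reduced (inv_into {w. reduced w} \<phi> (wd y))" using inv_into_into[OF y] by simp
      then show "f (elt (inv_into {w. reduced w} \<phi> (wd y))) = y"
        by (simp add: f_def elt_reduced_wd f_inv_into_f[OF y])
    qed
  qed
  moreover have "H = {x. f x = x}"
  proof -
    have "x \<in> H \<longleftrightarrow> wd x \<in> wd ` H" for x by (auto simp: wd_inject)
    then show ?thesis unfolding H by (auto simp: fixed_points_def free_group_def wd_f[symmetric] wd_inject)
  qed
  ultimately show "fixgroup H" unfolding fixgroup_def aut_def by blast
next
  assume "fixgroup H"
  then obtain f where f: "ghom f" "bij f" "H = {x. f x = x}" unfolding fixgroup_def aut_def by blast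
  define \<phi> where "\<phi> w = wd (f (elt w))" for w
  have "\<phi> \<in> hom F2 F2"
  proof (rule homI)
    fix x y :: "gen word"
    have "elt (reduce (x @ y)) = elt x + elt y" by (metis elt_append elt_wd wd_elt)
    then show "\<phi> (x \<otimes>\<^bsub>F2\<^esub> y) = \<phi> x \<otimes>\<^bsub>F2\<^esub> \<phi> y"
      by (simp add: free_group_def \<phi>_def ghom_plus[OF f(1)] wd_plus)
  qed (simp add: free_group_def \<phi>_def)
  moreover have "bij_betw \<phi> (carrier F2) (carrier F2)"
    by (rule bij_betw_byWitness[where f' = "\<lambda>w. wd (finv f (elt w))"])
      (auto simp: free_group_def \<phi>_def inv_f_f[OF bij_is_inj[OF f(2)]] surj_f_inv_f[OF bij_is_surj[OF f(2)]] elt_reduced_wd)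
  moreover have "wd ` H = fixed_points F2 \<phi>"
  proof
    show "wd ` H \<subseteq> fixed_points F2 \<phi>" by (auto simp: f(3) fixed_points_def free_group_def \<phi>_def)
    show "fixed_points F2 \<phi> \<subseteq> wd ` H"
    proof
      fix w assume w: "w \<in> fixed_points F2 \<phi>"
      then have fixed: "wd (f (elt w)) = w" and wd: "wd (elt w) = w"
        by (auto simp: fixed_points_def free_group_def \<phi>_def elt_reduced_wd)
      have "f (elt w) = elt w" using arg_cong[OF fixed, of elt] by simp
      then have "wd (elt w) \<in> wd ` H" unfolding f(3) by blast
      then show "w \<in> wd ` H" unfolding wd .
    qed
  qed
  ultimately show "is_fixed_point_group F2 (wd ` H)"
    unfolding is_fixed_point_group_def iso_def by blast
qed

lemma words_code_eq: "words_code us = code (map (map letter_code) us)"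
proof -
  have "code = (\<lambda>n :: nat. n)" by (simp add: fun_eq_iff code_nat_def)
  then have "code w = list_encode w" for w :: "nat list" unfolding code_list_def by (metis list.map_ident)
  then show ?thesis by (simp add: words_code_def word_code_def[abs_def] code_list_def[of "map _ us"] o_def)
qed

theorem mainTheorem7:
  "decidable words_code
     (\<lambda>us :: gen word list. is_fixed_point_group F2 (generate F2 (reduce ` set us)))"
proof -
  obtain r where r: "\<And>us. rec_computes r [code us] (if fixgroup (sgp (den ` set us)) then 1 else 0)"
    using decidable_if_re[OF re_fixgroup] by blast
  have "is_fixed_point_group F2 (generate F2 (reduce ` set us)) \<longleftrightarrow>
    fixgroup (sgp (den ` set (map (map letter_code) us)))" for us :: "gen word list"
  proof -
    have "reduce ` set us = wd ` den ` set (map (map letter_code) us)"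
      by (simp add: image_image den_map_letter_code wd_elt)
    then show ?thesis by (simp only: generate_eq_sgp is_fixed_point_group_iff)
  qed
  then show ?thesis
    unfolding decidable_def words_code_eq by (simp only:) (rule exI[of _ r], rule allI, rule r)
qed

end
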